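(* Let $k$ be a field, let $d$ be a positive integer, and let $G$ be a tree on $[n]$ with $\Delta(G)>d$. Then $L_G(d)$ is an almost complete intersection if and only if $G$ is obtained by adding an edge between two trees $H_1$ and $H_2$ with $\Delta(H_1)\le d$ and $\Delta(H_2)\le d$; that is, if and only if there are vertex-disjoint trees $H_1,H_2$ with $V(H_1)\cup V(H_2)=V(G)$, $\Delta(H_i)\le d$ for $i=1,2$, and vertices $u\in V(H_1)$, $v\in V(H_2)$ such that $E(G)=E(H_1)\cup E(H_2)\cup\{\{u,v\}\}$.
   Context: Graphs are finite, simple and undirected, with vertex set $V(G)=[n]=\{1,\dots,n\}$ and edge set $E(G)$. $\Delta(G)$ is the maximal degree of a vertex of $G$. For a field $k$ and $d\ge1$, the LSS-ideal of $G$ is $$L_G(d)=\Big(f_e^{(d)}=\sum_{\ell=1}^d x_{i\ell}x_{j\ell}\ :\ e=\{i,j\}\in E(G)\Big)\subset S=k[x_{ij}: i\in[n],\ j\in[d]].$$ An ideal is a complete intersection if its minimal number of generators equals its height. An ideal $I$ is an almost complete intersection if its minimal number of generators is one more than its height and $I_{\mathfrak p}$ is a complete intersection for every minimal prime $\mathfrak p$ of $I$. *)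

theory Defs
  imports
    "HOL-Algebra.Ideal"
    "HOL-Library.Extended_Nat"
    "HOL-Library.Poly_Mapping"
begin

section \<open>Finite simple graphs\<close>

text \<open>A graph is given by its vertex set \<open>V\<close> and its set \<open>E\<close> of edges, an edge being
  a two-element set of vertices.\<close>

definition simple_graph :: "'a set \<Rightarrow> 'a set set \<Rightarrow> bool" where
  "simple_graph V E \<longleftrightarrow> finite V \<and> (\<forall>e\<in>E. \<exists>u\<in>V. \<exists>v\<in>V. u \<noteq> v \<and> e = {u, v})"

definition graph_connected :: "'a set \<Rightarrow> 'a set set \<Rightarrow> bool" where
  "graph_connected V E \<longleftrightarrow> V \<noteq> {} \<and> (\<forall>u\<in>V. \<forall>v\<in>V. (u, v) \<in> {(x, y). {x, y} \<in> E}\<^sup>*)"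

text \<open>A cycle is listed without repeating its starting vertex at the end.\<close>

definition graph_cycle :: "'a set set \<Rightarrow> 'a list \<Rightarrow> bool" where
  "graph_cycle E vs \<longleftrightarrow> 3 \<le> length vs \<and> distinct vs \<and>
     (\<forall>i<length vs. {vs ! i, vs ! (Suc i mod length vs)} \<in> E)"

definition graph_tree :: "'a set \<Rightarrow> 'a set set \<Rightarrow> bool" where
  "graph_tree V E \<longleftrightarrow> simple_graph V E \<and> graph_connected V E \<and> \<not> (\<exists>vs. graph_cycle E vs)"

definition graph_degree :: "'a set set \<Rightarrow> 'a \<Rightarrow> nat" where
  "graph_degree E v = card {e \<in> E. v \<in> e}"

definition max_degree :: "'a set \<Rightarrow> 'a set set \<Rightarrow> nat" where
  "max_degree V E = Max (graph_degree E ` V)"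


section \<open>Localization of commutative rings\<close>

definition loc_frac_rel :: "('a, 'b) ring_scheme \<Rightarrow> 'a set \<Rightarrow> (('a \<times> 'a) \<times> ('a \<times> 'a)) set" where
  "loc_frac_rel R S = {((a, s), (b, t)). a \<in> carrier R \<and> b \<in> carrier R \<and> s \<in> S \<and> t \<in> S \<and>
     (\<exists>u\<in>S. u \<otimes>\<^bsub>R\<^esub> (a \<otimes>\<^bsub>R\<^esub> t) = u \<otimes>\<^bsub>R\<^esub> (b \<otimes>\<^bsub>R\<^esub> s))}"

definition loc_frac :: "('a, 'b) ring_scheme \<Rightarrow> 'a set \<Rightarrow> 'a \<Rightarrow> 'a \<Rightarrow> ('a \<times> 'a) set" where
  "loc_frac R S a s = loc_frac_rel R S `` {(a, s)}"

text \<open>The unions in the operations range over all representatives; as all of these give the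
  same fraction, the union is that fraction (lemmas \<open>loc_frac_mult\<close> and \<open>loc_frac_add\<close> below).\<close>

definition localization :: "('a, 'b) ring_scheme \<Rightarrow> 'a set \<Rightarrow> ('a \<times> 'a) set ring" where
  "localization R S = \<lparr>
     carrier = (carrier R \<times> S) // loc_frac_rel R S,
     mult = (\<lambda>X Y. \<Union>(a, s)\<in>X. \<Union>(b, t)\<in>Y. loc_frac R S (a \<otimes>\<^bsub>R\<^esub> b) (s \<otimes>\<^bsub>R\<^esub> t)),
     one = loc_frac R S \<one>\<^bsub>R\<^esub> \<one>\<^bsub>R\<^esub>,
     zero = loc_frac R S \<zero>\<^bsub>R\<^esub> \<one>\<^bsub>R\<^esub>,
     add = (\<lambda>X Y. \<Union>(a, s)\<in>X. \<Union>(b, t)\<in>Y.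
              loc_frac R S (a \<otimes>\<^bsub>R\<^esub> t \<oplus>\<^bsub>R\<^esub> b \<otimes>\<^bsub>R\<^esub> s) (s \<otimes>\<^bsub>R\<^esub> t))\<rparr>"

definition localization_at :: "('a, 'b) ring_scheme \<Rightarrow> 'a set \<Rightarrow> ('a \<times> 'a) set ring" where
  "localization_at R P = localization R (carrier R - P)"

definition ideal_localization_at ::
    "('a, 'b) ring_scheme \<Rightarrow> 'a set \<Rightarrow> 'a set \<Rightarrow> ('a \<times> 'a) set set" where
  "ideal_localization_at R P I =
     genideal (localization_at R P) ((\<lambda>a. loc_frac R (carrier R - P) a \<one>\<^bsub>R\<^esub>) ` I)"

locale cring_mult_set = cring R + submonoid S R for R (structure) and S
begin

lemma S_carrier [simp]: "s \<in> S \<Longrightarrow> s \<in> carrier R"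
  using subset by blast

lemma equiv_loc_frac_rel: "equiv (carrier R \<times> S) (loc_frac_rel R S)"
proof (rule equivI)
  show "loc_frac_rel R S \<subseteq> (carrier R \<times> S) \<times> (carrier R \<times> S)"
    by (auto simp: loc_frac_rel_def)
  show "refl_on (carrier R \<times> S) (loc_frac_rel R S)"
    by (auto simp: loc_frac_rel_def refl_on_def)
  show "sym (loc_frac_rel R S)"
    by (auto simp: loc_frac_rel_def sym_def) (metis)
  show "trans (loc_frac_rel R S)"
  proof (rule transI, clarify)
    fix a s b t c r
    assume "((a, s), (b, t)) \<in> loc_frac_rel R S" and "((b, t), (c, r)) \<in> loc_frac_rel R S"
    then obtain u v where c: "a \<in> carrier R" "b \<in> carrier R" "c \<in> carrier R"
        "s \<in> S" "t \<in> S" "r \<in> S" "u \<in> S" "v \<in> S"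
      and 1: "u \<otimes> (a \<otimes> t) = u \<otimes> (b \<otimes> s)" and 2: "v \<otimes> (b \<otimes> r) = v \<otimes> (c \<otimes> t)"
      by (auto simp: loc_frac_rel_def)
    have "(u \<otimes> v \<otimes> t) \<otimes> (a \<otimes> r) = (u \<otimes> (a \<otimes> t)) \<otimes> (v \<otimes> r)"
      using c by (simp add: m_ac)
    also have "\<dots> = (u \<otimes> s) \<otimes> (v \<otimes> (b \<otimes> r))"
      unfolding 1 using c by (simp add: m_ac)
    also have "\<dots> = (u \<otimes> v \<otimes> t) \<otimes> (c \<otimes> s)"
      unfolding 2 using c by (simp add: m_ac)
    finally show "((a, s), (c, r)) \<in> loc_frac_rel R S"
      using c by (auto simp: loc_frac_rel_def intro!: bexI[of _ "u \<otimes> v \<otimes> t"])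
  qed
qed

lemma loc_frac_eq_iff:
  assumes "a \<in> carrier R" "b \<in> carrier R" "s \<in> S" "t \<in> S"
  shows "loc_frac R S a s = loc_frac R S b t \<longleftrightarrow> (\<exists>u\<in>S. u \<otimes> (a \<otimes> t) = u \<otimes> (b \<otimes> s))"
proof -
  have "loc_frac R S a s = loc_frac R S b t \<longleftrightarrow> ((a, s), (b, t)) \<in> loc_frac_rel R S"
    unfolding loc_frac_def using assms by (intro eq_equiv_class_iff[OF equiv_loc_frac_rel]) auto
  then show ?thesis
    using assms by (simp add: loc_frac_rel_def)
qed

lemma loc_frac_eqI:
  assumes "a \<in> carrier R" "b \<in> carrier R" "s \<in> S" "t \<in> S" "a \<otimes> t = b \<otimes> s"
  shows "loc_frac R S a s = loc_frac R S b t"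
  using assms one_closed by (subst loc_frac_eq_iff) (auto intro!: bexI[of _ \<one>])

lemma loc_frac_closed [simp]:
  "a \<in> carrier R \<Longrightarrow> s \<in> S \<Longrightarrow> loc_frac R S a s \<in> carrier (localization R S)"
  by (auto simp: localization_def loc_frac_def intro: quotientI)

lemma localizationE:
  assumes "X \<in> carrier (localization R S)"
  obtains a s where "a \<in> carrier R" "s \<in> S" "X = loc_frac R S a s"
  using assms by (auto simp: localization_def loc_frac_def elim!: quotientE)

lemma loc_frac_mult:
  assumes "a \<in> carrier R" "b \<in> carrier R" "s \<in> S" "t \<in> S"
  shows "loc_frac R S a s \<otimes>\<^bsub>localization R S\<^esub> loc_frac R S b t = loc_frac R S (a \<otimes> b) (s \<otimes> t)"
proof -
  define f where "f = (\<lambda>p q. loc_frac R S (fst p \<otimes> fst q) (snd p \<otimes> snd q))"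
  have "congruent2 (loc_frac_rel R S) (loc_frac_rel R S) f"
  proof (rule congruent2_commuteI[OF equiv_loc_frac_rel])
    show "f p q = f q p" if "p \<in> carrier R \<times> S" "q \<in> carrier R \<times> S" for p q
      using that by (auto simp: f_def m_comm)
    fix p q r
    assume p: "p \<in> carrier R \<times> S" and "(q, r) \<in> loc_frac_rel R S"
    then obtain u where *: "fst q \<in> carrier R" "snd q \<in> S" "fst r \<in> carrier R" "snd r \<in> S"
        "u \<in> S" "u \<otimes> (fst q \<otimes> snd r) = u \<otimes> (fst r \<otimes> snd q)"
      by (auto simp: loc_frac_rel_def)
    have "u \<otimes> ((fst p \<otimes> fst q) \<otimes> (snd p \<otimes> snd r)) = (fst p \<otimes> snd p) \<otimes> (u \<otimes> (fst q \<otimes> snd r))"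
      using p * by (auto simp: m_ac)
    also have "\<dots> = u \<otimes> ((fst p \<otimes> fst r) \<otimes> (snd p \<otimes> snd q))"
      unfolding *(6) using p *(1-5) by (auto simp: m_ac)
    finally show "f p q = f p r"
      unfolding f_def using p * by (subst loc_frac_eq_iff) (auto intro!: bexI[of _ u])
  qed
  from UN_equiv_class2[OF equiv_loc_frac_rel equiv_loc_frac_rel this, of "(a, s)" "(b, t)"] assms
  show ?thesis
    by (simp add: localization_def loc_frac_def f_def case_prod_beta)
qed

lemma loc_frac_add:
  assumes "a \<in> carrier R" "b \<in> carrier R" "s \<in> S" "t \<in> S"
  shows "loc_frac R S a s \<oplus>\<^bsub>localization R S\<^esub> loc_frac R S b t
           = loc_frac R S (a \<otimes> t \<oplus> b \<otimes> s) (s \<otimes> t)"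
proof -
  define f where "f = (\<lambda>p q. loc_frac R S (fst p \<otimes> snd q \<oplus> fst q \<otimes> snd p) (snd p \<otimes> snd q))"
  have "congruent2 (loc_frac_rel R S) (loc_frac_rel R S) f"
  proof (rule congruent2_commuteI[OF equiv_loc_frac_rel])
    show "f p q = f q p" if "p \<in> carrier R \<times> S" "q \<in> carrier R \<times> S" for p q
      using that by (auto simp: f_def m_comm a_comm)
    fix p q r
    assume p: "p \<in> carrier R \<times> S" and "(q, r) \<in> loc_frac_rel R S"
    then obtain u where *: "fst q \<in> carrier R" "snd q \<in> S" "fst r \<in> carrier R" "snd r \<in> S"
        "u \<in> S" "u \<otimes> (fst q \<otimes> snd r) = u \<otimes> (fst r \<otimes> snd q)"
      by (auto simp: loc_frac_rel_def)
    have "u \<otimes> ((fst p \<otimes> snd q \<oplus> fst q \<otimes> snd p) \<otimes> (snd p \<otimes> snd r))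
        = u \<otimes> (fst p \<otimes> snd p \<otimes> snd q \<otimes> snd r) \<oplus> (snd p \<otimes> snd p) \<otimes> (u \<otimes> (fst q \<otimes> snd r))"
      using p * by (auto simp: m_ac l_distr r_distr)
    also have "\<dots> = u \<otimes> ((fst p \<otimes> snd r \<oplus> fst r \<otimes> snd p) \<otimes> (snd p \<otimes> snd q))"
      unfolding *(6) using p *(1-5) by (auto simp: m_ac l_distr r_distr)
    finally show "f p q = f p r"
      unfolding f_def using p * by (subst loc_frac_eq_iff) (auto intro!: bexI[of _ u])
  qed
  from UN_equiv_class2[OF equiv_loc_frac_rel equiv_loc_frac_rel this, of "(a, s)" "(b, t)"] assms
  show ?thesis
    by (simp add: localization_def loc_frac_def f_def case_prod_beta)
qed

lemma loc_frac_one: "\<one>\<^bsub>localization R S\<^esub> = loc_frac R S \<one> \<one>"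
  by (simp add: localization_def)

lemma loc_frac_zero: "\<zero>\<^bsub>localization R S\<^esub> = loc_frac R S \<zero> \<one>"
  by (simp add: localization_def)

lemma localization_cring: "cring (localization R S)"
proof (rule cringI)
  have [simp]: "\<one> \<in> S" by (rule one_closed)
  show "abelian_group (localization R S)"
  proof (rule abelian_groupI)
    fix X assume X: "X \<in> carrier (localization R S)"
    then obtain a s where a: "a \<in> carrier R" "s \<in> S" "X = loc_frac R S a s"
      by (rule localizationE)
    show "\<exists>Y\<in>carrier (localization R S). Y \<oplus>\<^bsub>localization R S\<^esub> X = \<zero>\<^bsub>localization R S\<^esub>"
    proof
      have "\<zero> \<otimes> \<one> = \<zero> \<otimes> (s \<otimes> s)"
        using a by simp
      then have "loc_frac R S \<zero> (s \<otimes> s) = loc_frac R S \<zero> \<one>"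
        using a by (intro loc_frac_eqI) auto
      then show "loc_frac R S (\<ominus> a) s \<oplus>\<^bsub>localization R S\<^esub> X = \<zero>\<^bsub>localization R S\<^esub>"
        using a by (simp add: loc_frac_add loc_frac_zero l_minus l_neg)
    qed (use a in simp)
    fix Y assume Y: "Y \<in> carrier (localization R S)"
    then obtain b t where b: "b \<in> carrier R" "t \<in> S" "Y = loc_frac R S b t"
      by (rule localizationE)
    show "X \<oplus>\<^bsub>localization R S\<^esub> Y \<in> carrier (localization R S)"
      using a b by (simp add: loc_frac_add)
    show "X \<oplus>\<^bsub>localization R S\<^esub> Y = Y \<oplus>\<^bsub>localization R S\<^esub> X"
      using a b by (simp add: loc_frac_add m_comm a_comm)
    fix Z assume "Z \<in> carrier (localization R S)"
    then obtain c r where "c \<in> carrier R" "r \<in> S" "Z = loc_frac R S c r"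
      by (rule localizationE)
    with a b show "X \<oplus>\<^bsub>localization R S\<^esub> Y \<oplus>\<^bsub>localization R S\<^esub> Z
        = X \<oplus>\<^bsub>localization R S\<^esub> (Y \<oplus>\<^bsub>localization R S\<^esub> Z)"
      by (simp add: loc_frac_add l_distr r_distr m_ac a_ac)
  qed (auto simp: loc_frac_zero loc_frac_add elim!: localizationE)
  show "comm_monoid (localization R S)"
  proof (rule comm_monoidI)
    fix X Y Z
    assume "X \<in> carrier (localization R S)" "Y \<in> carrier (localization R S)"
      "Z \<in> carrier (localization R S)"
    then show "X \<otimes>\<^bsub>localization R S\<^esub> Y \<otimes>\<^bsub>localization R S\<^esub> Z
        = X \<otimes>\<^bsub>localization R S\<^esub> (Y \<otimes>\<^bsub>localization R S\<^esub> Z)"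
      by (auto simp: loc_frac_mult m_assoc elim!: localizationE)
  next
    fix X Y
    assume "X \<in> carrier (localization R S)" "Y \<in> carrier (localization R S)"
    then show "X \<otimes>\<^bsub>localization R S\<^esub> Y = Y \<otimes>\<^bsub>localization R S\<^esub> X"
      by (auto simp: loc_frac_mult m_comm elim!: localizationE)
  qed (auto simp: loc_frac_one loc_frac_mult elim!: localizationE)
  fix X Y Z
  assume "X \<in> carrier (localization R S)" "Y \<in> carrier (localization R S)"
    "Z \<in> carrier (localization R S)"
  then obtain a s b t c r where *: "a \<in> carrier R" "s \<in> S" "X = loc_frac R S a s"
      "b \<in> carrier R" "t \<in> S" "Y = loc_frac R S b t" "c \<in> carrier R" "r \<in> S" "Z = loc_frac R S c r"
    by (metis localizationE)
  have "loc_frac R S ((a \<otimes> t \<oplus> b \<otimes> s) \<otimes> c) (s \<otimes> t \<otimes> r)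
      = loc_frac R S (a \<otimes> c \<otimes> (t \<otimes> r) \<oplus> b \<otimes> c \<otimes> (s \<otimes> r)) (s \<otimes> r \<otimes> (t \<otimes> r))"
    by (rule loc_frac_eqI) (use * in \<open>simp_all add: l_distr r_distr m_ac\<close>)
  with * show "(X \<oplus>\<^bsub>localization R S\<^esub> Y) \<otimes>\<^bsub>localization R S\<^esub> Z =
      X \<otimes>\<^bsub>localization R S\<^esub> Z \<oplus>\<^bsub>localization R S\<^esub> Y \<otimes>\<^bsub>localization R S\<^esub> Z"
    by (simp add: loc_frac_mult loc_frac_add)
qed

end

lemma (in cring) localization_at_cring:
  assumes "primeideal P R"
  shows "cring (localization_at R P)"
proof -
  interpret primeideal P R by fact
  have "cring_mult_set R (carrier R - P)"
  proof (intro cring_mult_set.intro submonoid.intro cring_axioms)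
    show "\<one> \<in> carrier R - P"
      using I_notcarr one_imp_carrier by auto
  qed (use I_prime in auto)
  then show ?thesis
    unfolding localization_at_def by (rule cring_mult_set.localization_cring)
qed


section \<open>Height and complete intersections\<close>

text \<open>Heights and numbers of generators are extended natural numbers: the infimum over the empty
  set is \<open>\<infinity>\<close>, so the unit ideal has height \<open>\<infinity>\<close> and an ideal that is not finitely generated
  needs \<open>\<infinity>\<close> generators.\<close>

definition prime_height :: "('a, 'b) ring_scheme \<Rightarrow> 'a set \<Rightarrow> enat" where
  "prime_height R P =
     (SUP Qs \<in> {Qs. Qs \<noteq> [] \<and> (\<forall>Q\<in>set Qs. primeideal Q R) \<and> sorted_wrt (\<subset>) Qs \<and> last Qs = P}.
        enat (length Qs - 1))"

definition ideal_height :: "('a, 'b) ring_scheme \<Rightarrow> 'a set \<Rightarrow> enat" where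
  "ideal_height R I = (INF P \<in> {P. primeideal P R \<and> I \<subseteq> P}. prime_height R P)"

definition minimal_prime :: "('a, 'b) ring_scheme \<Rightarrow> 'a set \<Rightarrow> 'a set \<Rightarrow> bool" where
  "minimal_prime R I P \<longleftrightarrow> primeideal P R \<and> I \<subseteq> P \<and>
     (\<forall>Q. primeideal Q R \<and> I \<subseteq> Q \<and> Q \<subseteq> P \<longrightarrow> Q = P)"

definition min_generators :: "('a, 'b) ring_scheme \<Rightarrow> 'a set \<Rightarrow> enat" where
  "min_generators R I = (INF A \<in> {A. finite A \<and> A \<subseteq> carrier R \<and> genideal R A = I}. enat (card A))"

definition complete_intersection :: "('a, 'b) ring_scheme \<Rightarrow> 'a set \<Rightarrow> bool" where
  "complete_intersection R I \<longleftrightarrow> ideal I R \<and> min_generators R I = ideal_height R I"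

definition almost_complete_intersection :: "('a, 'b) ring_scheme \<Rightarrow> 'a set \<Rightarrow> bool" where
  "almost_complete_intersection R I \<longleftrightarrow> ideal I R \<and>
     min_generators R I = ideal_height R I + 1 \<and>
     (\<forall>P. minimal_prime R I P \<longrightarrow>
        complete_intersection (localization_at R P) (ideal_localization_at R P I))"


section \<open>Polynomial rings and LSS-ideals\<close>

text \<open>A polynomial is a finitely supported map from monomials to coefficients, and a monomial is a
  finitely supported map from variables to exponents. The ring below consists of the polynomials
  in which only variables from \<open>X\<close> occur.\<close>

definition polynomial_ring :: "'v set \<Rightarrow> (('v \<Rightarrow>\<^sub>0 nat) \<Rightarrow>\<^sub>0 'k::comm_ring_1) ring" where
  "polynomial_ring X = \<lparr>
     carrier = {p. \<forall>m\<in>Poly_Mapping.keys p. Poly_Mapping.keys m \<subseteq> X},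
     mult = (*), one = 1, zero = 0, add = (+)\<rparr>"

definition poly_var :: "'v \<Rightarrow> (('v \<Rightarrow>\<^sub>0 nat) \<Rightarrow>\<^sub>0 'k::comm_ring_1)" where
  "poly_var x = Poly_Mapping.single (Poly_Mapping.single x 1) 1"

lemma poly_var_closed: "x \<in> X \<Longrightarrow> poly_var x \<in> carrier (polynomial_ring X)"
  by (simp add: poly_var_def polynomial_ring_def)

lemma polynomial_ring_cring: "cring (polynomial_ring X)"
proof (rule cringI)
  let ?R = "polynomial_ring X :: (('a \<Rightarrow>\<^sub>0 nat) \<Rightarrow>\<^sub>0 'b) ring"
  have add: "p + q \<in> carrier ?R" if "p \<in> carrier ?R" "q \<in> carrier ?R" for p q
    using that Poly_Mapping.keys_add[of p q] by (auto simp: polynomial_ring_def)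
  have mult: "p * q \<in> carrier ?R" if "p \<in> carrier ?R" "q \<in> carrier ?R" for p q
  proof -
    have "Poly_Mapping.keys m \<subseteq> X" if "m \<in> Poly_Mapping.keys (p * q)" for m
    proof -
      from that Poly_Mapping.keys_mult[of p q] obtain a b
        where "m = a + b" "a \<in> Poly_Mapping.keys p" "b \<in> Poly_Mapping.keys q"
        by blast
      then have "Poly_Mapping.keys a \<subseteq> X" "Poly_Mapping.keys b \<subseteq> X"
        using \<open>p \<in> carrier ?R\<close> \<open>q \<in> carrier ?R\<close> by (auto simp: polynomial_ring_def)
      then show ?thesis
        unfolding \<open>m = a + b\<close> using Poly_Mapping.keys_add[of a b] by blast
    qed
    then show ?thesis by (auto simp: polynomial_ring_def)
  qed
  have uminus: "- p \<in> carrier ?R" if "p \<in> carrier ?R" for p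
    using that by (auto simp: polynomial_ring_def in_keys_iff)
  have [simp]: "\<zero>\<^bsub>?R\<^esub> = 0" "\<one>\<^bsub>?R\<^esub> = 1" "p \<oplus>\<^bsub>?R\<^esub> q = p + q" "p \<otimes>\<^bsub>?R\<^esub> q = p * q" for p q
    by (simp_all add: polynomial_ring_def)
  have zero: "0 \<in> carrier ?R" and one: "1 \<in> carrier ?R"
    by (simp_all add: polynomial_ring_def)
  show "abelian_group ?R"
  proof (rule abelian_groupI)
    show "\<exists>q\<in>carrier ?R. q \<oplus>\<^bsub>?R\<^esub> p = \<zero>\<^bsub>?R\<^esub>" if "p \<in> carrier ?R" for p
      using uminus[OF that] by (intro bexI[of _ "- p"]) simp_all
  qed (simp_all add: add zero ac_simps)
  show "comm_monoid ?R"
    by (rule comm_monoidI) (simp_all add: mult one ac_simps)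
  show "(p \<oplus>\<^bsub>?R\<^esub> q) \<otimes>\<^bsub>?R\<^esub> r = p \<otimes>\<^bsub>?R\<^esub> r \<oplus>\<^bsub>?R\<^esub> q \<otimes>\<^bsub>?R\<^esub> r" for p q r
    by (simp add: distrib_right)
qed

text \<open>The variable \<open>x\<^sub>i\<^sub>l\<close> has index \<open>(i, l)\<close>; the sum and product below are those of the ambient
  type, which agree with the ring operations of \<open>lss_ring\<close>.\<close>

definition lss_ring :: "nat \<Rightarrow> nat \<Rightarrow> ((nat \<times> nat \<Rightarrow>\<^sub>0 nat) \<Rightarrow>\<^sub>0 'k::field) ring" where
  "lss_ring n d = polynomial_ring ({1..n} \<times> {1..d})"

definition lss_ideal :: "nat \<Rightarrow> nat set set \<Rightarrow> nat \<Rightarrow> ((nat \<times> nat \<Rightarrow>\<^sub>0 nat) \<Rightarrow>\<^sub>0 'k::field) set" where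
  "lss_ideal n E d = genideal (lss_ring n d)
     {\<Sum>l = 1..d. poly_var (i, l) * poly_var (j, l) | i j. {i, j} \<in> E}"

end

theory Submission
  imports Defs "HOL-Algebra.Ring_Divisibility" "HOL-Library.Product_Lexorder"
begin

text \<open>Let \<open>m\<close> be the number of edges of \<open>G\<close>, let \<open>f\<^sub>e\<close> be the polynomial of an edge \<open>e\<close> and let \<open>I\<close> be the
ideal of all \<open>f\<^sub>e\<close>. The \<open>f\<^sub>e\<close> are linearly independent quadrics, so \<open>I\<close> needs exactly \<open>m\<close> generators
(\<open>min_generators_lss\<close>). Hence \<open>I\<close> can only be an almost complete intersection if its height is
\<open>m - 1\<close>.

Heights are bounded from above by Krull's height theorem (\<open>krull_height\<close>). For a set \<open>C\<close> of vertices,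
the variables at \<open>C\<close> together with the \<open>f\<^sub>e\<close> of the edges that avoid \<open>C\<close> generate an ideal over \<open>I\<close>
with \<open>d |C| + |{e. e \<inter> C = {}}|\<close> generators, which bounds the height of \<open>I\<close> (\<open>height_lss_le\<close>). If
\<open>G\<close> has a vertex of degree at least \<open>d + 2\<close> or two non-adjacent vertices of degree \<open>d + 1\<close>, then these
vertices form a set \<open>C\<close> for which the bound is at most \<open>m - 2\<close>. In a tree the only other possibility is
that some edge \<open>e\<^sub>0\<close> contains all vertices of degree greater than \<open>d\<close> and that these have degree
\<open>d + 1\<close>; in other words, \<open>G - e\<^sub>0\<close> has maximal degree at most \<open>d\<close> (\<open>forest_obstruction\<close>). Deleting an
edge from a tree leaves two trees, so this is the condition of the theorem (\<open>tree_split_iff\<close>).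

Conversely, let \<open>G - e\<^sub>0\<close> have maximal degree at most \<open>d\<close>. Building this forest leaf by leaf one finds a
proper colouring of its edges by \<open>{1..d}\<close> and weights of the variables such that \<open>x\<^sub>i\<^sub>l x\<^sub>j\<^sub>l\<close>, where \<open>l\<close>
is the colour of \<open>{i, j}\<close>, is the initial monomial of the polynomial of \<open>{i, j}\<close>
(\<open>forest_dominating_colouring\<close>). As the colouring is proper, these monomials are pairwise coprime, and
they are squarefree. Therefore the \<open>f\<^sub>e\<close> with \<open>e \<noteq> e\<^sub>0\<close> form a regular sequence in every order
(\<open>regular\<close>), so that every prime over the ideal \<open>J\<close> generated by them has height at least \<open>m - 1\<close>, and
\<open>J\<close> is a radical ideal (\<open>radical\<close>). A vertex of degree greater than \<open>d\<close> shows that the height of \<open>I\<close> is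
at most, hence equal to, \<open>m - 1\<close>.

It remains to localize at a minimal prime \<open>P\<close> of \<open>I\<close>. Its height is \<open>m - 1\<close> or \<open>m\<close>, and by Krull's
theorem \<open>I\<^sub>P\<close> cannot be generated by fewer elements than this height. If the height is \<open>m\<close>, then the
\<open>m\<close> given generators are enough. If it is \<open>m - 1\<close>, then \<open>P\<close> is also minimal over \<open>J\<close>; as \<open>J\<close> is
radical, \<open>J\<^sub>P\<close> is the maximal ideal of the localization and contains the image of \<open>f\<^sub>e\<close> for \<open>e = e\<^sub>0\<close>.
So \<open>I\<^sub>P = J\<^sub>P\<close> is generated by \<open>m - 1\<close> elements.\<close>

section \<open>Rings carried by a subset of a commutative ring type\<close>

text \<open>Identities between elements of a commutative ring type hold without side conditions. This is why
the rings below are given by their carriers inside such a type.\<close>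

definition ring_on :: "'a::comm_ring_1 set \<Rightarrow> 'a ring" where
  "ring_on A = \<lparr>carrier = A, monoid.mult = (*), one = 1, zero = 0, add = (+)\<rparr>"

lemma ring_on_simps [simp]:
  "carrier (ring_on A) = A" "\<one>\<^bsub>ring_on A\<^esub> = 1" "\<zero>\<^bsub>ring_on A\<^esub> = 0"
  "x \<oplus>\<^bsub>ring_on A\<^esub> y = x + y" "x \<otimes>\<^bsub>ring_on A\<^esub> y = x * y"
  by (simp_all add: ring_on_def)

lemma (in cring) ideal_of_closed:
  assumes "I \<subseteq> carrier R" "\<zero> \<in> I" "\<And>x y. x \<in> I \<Longrightarrow> y \<in> I \<Longrightarrow> x \<oplus> y \<in> I"
    and "\<And>a x. a \<in> carrier R \<Longrightarrow> x \<in> I \<Longrightarrow> a \<otimes> x \<in> I"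
  shows "ideal I R"
proof (rule idealI[OF ring_axioms])
  show "subgroup I (add_monoid R)"
  proof (rule group.subgroupI[OF a_group], fold a_inv_def)
    fix x assume x: "x \<in> I"
    then have "x \<in> carrier R" using assms(1) by blast
    moreover have "\<ominus> \<one> \<otimes> x \<in> I" using x by (intro assms(4)) auto
    ultimately show "\<ominus> x \<in> I" by (simp add: l_minus)
  qed (use assms in auto)
  show "a \<otimes> x \<in> I" "x \<otimes> a \<in> I" if "x \<in> I" "a \<in> carrier R" for a x
    using assms(1) assms(4)[OF that(2,1)] that m_comm[of a x] by auto
qed

locale comm_subring =
  fixes A :: "'a::comm_ring_1 set"
  assumes zero_mem [simp, intro]: "0 \<in> A" and one_mem [simp, intro]: "1 \<in> A"
    and add_mem [intro]: "x \<in> A \<Longrightarrow> y \<in> A \<Longrightarrow> x + y \<in> A"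
    and mult_mem [intro]: "x \<in> A \<Longrightarrow> y \<in> A \<Longrightarrow> x * y \<in> A"
    and uminus_mem [intro]: "x \<in> A \<Longrightarrow> - x \<in> A"
begin

abbreviation "R \<equiv> ring_on A"

lemma diff_mem [intro]: "x \<in> A \<Longrightarrow> y \<in> A \<Longrightarrow> x - y \<in> A"
  using add_mem[of x "- y"] uminus_mem by simp

lemma power_mem [intro]: "x \<in> A \<Longrightarrow> x ^ n \<in> A"
  by (induction n) auto

lemma cring_R: "cring R"
proof (rule cringI)
  show "abelian_group R"
  proof (rule abelian_groupI)
    show "\<exists>y\<in>carrier R. y \<oplus>\<^bsub>R\<^esub> x = \<zero>\<^bsub>R\<^esub>" if "x \<in> carrier R" for x
      using that by (intro bexI[of _ "- x"]) auto
  qed (auto simp: ac_simps)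
  show "comm_monoid R"
    by (rule comm_monoidI) (auto simp: ac_simps)
qed (simp add: algebra_simps)

sublocale cring R by (rule cring_R)

lemma ideal_iff:
  "ideal I R \<longleftrightarrow> I \<subseteq> A \<and> 0 \<in> I \<and> (\<forall>x\<in>I. \<forall>y\<in>I. x + y \<in> I) \<and> (\<forall>a\<in>A. \<forall>x\<in>I. a * x \<in> I)"
proof
  assume "ideal I R"
  then interpret I: ideal I R .
  show "I \<subseteq> A \<and> 0 \<in> I \<and> (\<forall>x\<in>I. \<forall>y\<in>I. x + y \<in> I) \<and> (\<forall>a\<in>A. \<forall>x\<in>I. a * x \<in> I)"
    using I.a_subset I.zero_closed I.a_closed I.I_l_closed by auto
next
  assume "I \<subseteq> A \<and> 0 \<in> I \<and> (\<forall>x\<in>I. \<forall>y\<in>I. x + y \<in> I) \<and> (\<forall>a\<in>A. \<forall>x\<in>I. a * x \<in> I)"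
  then show "ideal I R" by (intro ideal_of_closed) auto
qed

lemma
  assumes "ideal I R"
  shows ideal_sub: "I \<subseteq> A" and ideal_zero [simp]: "0 \<in> I"
    and ideal_add: "x \<in> I \<Longrightarrow> y \<in> I \<Longrightarrow> x + y \<in> I"
    and ideal_mult: "a \<in> A \<Longrightarrow> x \<in> I \<Longrightarrow> a * x \<in> I"
    and ideal_mult': "a \<in> A \<Longrightarrow> x \<in> I \<Longrightarrow> x * a \<in> I"
    and ideal_diff: "x \<in> I \<Longrightarrow> y \<in> I \<Longrightarrow> x - y \<in> I"
    and ideal_mem: "x \<in> I \<Longrightarrow> x \<in> A"
proof -
  note * = assms[unfolded ideal_iff]
  show "I \<subseteq> A" "0 \<in> I" "x \<in> I \<Longrightarrow> y \<in> I \<Longrightarrow> x + y \<in> I" "a \<in> A \<Longrightarrow> x \<in> I \<Longrightarrow> a * x \<in> I"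
    "a \<in> A \<Longrightarrow> x \<in> I \<Longrightarrow> x * a \<in> I" "x \<in> I \<Longrightarrow> x \<in> A"
    using * by (auto simp: mult.commute)
  have uminus: "- x \<in> I" if "x \<in> I" for x
  proof -
    from * that have "(- 1) * x \<in> I" by blast
    then show "- x \<in> I" by simp
  qed
  show "x \<in> I \<Longrightarrow> y \<in> I \<Longrightarrow> x - y \<in> I"
    using * uminus[of y] by (metis uminus_add_conv_diff add.commute)
qed

lemma ideal_one: "ideal I R \<Longrightarrow> 1 \<in> I \<Longrightarrow> I = A"
  using ideal_mult[of I _ 1] ideal_sub[of I] by auto

lemma ideal_sum:
  assumes "ideal I R" "\<And>i. i \<in> S \<Longrightarrow> f i \<in> I"
  shows "sum f S \<in> I"
  using assms by (induction S rule: infinite_finite_induct) (auto intro: ideal_add ideal_zero)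

lemma primeideal_iff:
  "primeideal P R \<longleftrightarrow> ideal P R \<and> 1 \<notin> P \<and> (\<forall>a\<in>A. \<forall>b\<in>A. a * b \<in> P \<longrightarrow> a \<in> P \<or> b \<in> P)"
proof
  assume "primeideal P R"
  then interpret P: primeideal P R .
  have "1 \<notin> P"
    using P.one_imp_carrier P.I_notcarr by auto
  then show "ideal P R \<and> 1 \<notin> P \<and> (\<forall>a\<in>A. \<forall>b\<in>A. a * b \<in> P \<longrightarrow> a \<in> P \<or> b \<in> P)"
    using P.is_ideal P.I_prime by auto
next
  assume *: "ideal P R \<and> 1 \<notin> P \<and> (\<forall>a\<in>A. \<forall>b\<in>A. a * b \<in> P \<longrightarrow> a \<in> P \<or> b \<in> P)"
  show "primeideal P R"
    by (rule primeidealI[OF _ is_cring]) (use * one_mem in auto)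
qed

lemma
  assumes "primeideal P R"
  shows prime_ideal: "ideal P R" and prime_one: "1 \<notin> P"
    and prime_disj: "a \<in> A \<Longrightarrow> b \<in> A \<Longrightarrow> a * b \<in> P \<Longrightarrow> a \<in> P \<or> b \<in> P"
  using assms unfolding primeideal_iff by blast+

lemma prime_power:
  assumes "primeideal P R" "a \<in> A" "a ^ n \<in> P"
  shows "a \<in> P"
  using assms(3)
proof (induction n)
  case 0
  then show ?case using prime_one[OF assms(1)] by simp
next
  case (Suc n)
  then show ?case using prime_disj[OF assms(1), of a "a ^ n"] assms(2) by auto
qed

lemma genideal_insert:
  assumes "F \<subseteq> A" "a \<in> A"
  shows "genideal R (insert a F) = {r * a + y |r y. r \<in> A \<and> y \<in> genideal R F}" (is "_ = ?I")
proof
  have F: "ideal (genideal R F) R"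
    using genideal_ideal assms by simp
  note F' = ideal_add[OF F] ideal_mult[OF F] ideal_mem[OF F]
  have "ideal ?I R"
    unfolding ideal_iff
  proof (intro conjI ballI)
    show "?I \<subseteq> A" using assms F' by auto
    show "0 \<in> ?I" using F by (auto intro!: exI[of _ 0])
    show "x + y \<in> ?I" if xy: "x \<in> ?I" "y \<in> ?I" for x y
    proof -
      obtain r s r' s' where *: "x = r * a + s" "y = r' * a + s'" "r \<in> A" "r' \<in> A"
        "s \<in> genideal R F" "s' \<in> genideal R F"
        using xy by blast
      then have "x + y = (r + r') * a + (s + s')" by (simp add: algebra_simps)
      with * F' show ?thesis by blast
    qed
    show "b * x \<in> ?I" if bx: "b \<in> A" "x \<in> ?I" for b x
    proof -
      obtain r s where *: "x = r * a + s" "r \<in> A" "s \<in> genideal R F"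
        using bx by blast
      then have "b * x = (b * r) * a + b * s" by (simp add: algebra_simps)
      with * F' bx show ?thesis by blast
    qed
  qed
  moreover have "insert a F \<subseteq> ?I"
  proof -
    have "a = 1 * a + 0" "x = 0 * a + x" for x by simp_all
    moreover have "F \<subseteq> genideal R F" using genideal_self assms by simp
    ultimately show ?thesis using ideal_zero[OF F] one_mem zero_mem by blast
  qed
  ultimately show "genideal R (insert a F) \<subseteq> ?I"
    by (rule genideal_minimal)
  have G: "ideal (genideal R (insert a F)) R"
    using genideal_ideal assms by simp
  have "a \<in> genideal R (insert a F)" "F \<subseteq> genideal R (insert a F)"
    using genideal_self[of "insert a F"] assms by auto
  moreover from this(2) have "genideal R F \<subseteq> genideal R (insert a F)"
    by (intro genideal_minimal[OF G])
  ultimately show "?I \<subseteq> genideal R (insert a F)"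
    using ideal_add[OF G] ideal_mult[OF G] by auto
qed

lemma genideal_empty: "genideal R {} = {0}"
proof
  show "genideal R {} \<subseteq> {0}"
    by (rule genideal_minimal) (auto simp: ideal_iff)
  show "{0} \<subseteq> genideal R {}"
    using genideal_ideal[of "{}"] by auto
qed

text \<open>The ideal \<open>C + (a)\<close>.\<close>

definition ideal_join :: "'a set \<Rightarrow> 'a \<Rightarrow> 'a set" where
  "ideal_join C a = {c + r * a |c r. c \<in> C \<and> r \<in> A}"

lemma ideal_join:
  assumes "ideal C R" "a \<in> A"
  shows "ideal (ideal_join C a) R" "C \<subseteq> ideal_join C a" "a \<in> ideal_join C a"
proof -
  have C: "C \<subseteq> A" by (rule ideal_sub[OF assms(1)])
  have "genideal R C = C"
    using genideal_minimal[OF assms(1) order_refl] genideal_self[of C] C by auto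
  then have eq: "ideal_join C a = genideal R (insert a C)"
    unfolding genideal_insert[OF C assms(2)] ideal_join_def by (auto simp: add.commute; metis add.commute)
  have sub: "insert a C \<subseteq> carrier R" using C assms(2) by simp
  show "ideal (ideal_join C a) R" "C \<subseteq> ideal_join C a" "a \<in> ideal_join C a"
    unfolding eq using genideal_ideal[OF sub] genideal_self[OF sub] by auto
qed

lemma ideal_join_least:
  assumes "ideal I R" "C \<subseteq> I" "a \<in> I"
  shows "ideal_join C a \<subseteq> I"
  using assms ideal_add[OF assms(1)] ideal_mult[OF assms(1)] by (auto simp: ideal_join_def)

end

section \<open>Prime ideals of a Noetherian ring\<close>

locale noetherian_subring = comm_subring +
  assumes noetherian: "noetherian_ring R"
begin

lemma fin_gen:
  assumes "ideal I R"
  obtains F where "finite F" "F \<subseteq> A" "I = genideal R F"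
  using noetherian_ring.finetely_gen[OF noetherian assms] by auto

text \<open>The union of a chain of ideals has finitely many generators, all of which lie in one member of the
chain, so Zorn's lemma applies.\<close>

lemma maximal_ideal_in_family:
  assumes "\<And>I. I \<in> \<I> \<Longrightarrow> ideal I R" and "I\<^sub>0 \<in> \<I>"
  obtains M where "M \<in> \<I>" "\<And>I. I \<in> \<I> \<Longrightarrow> M \<subseteq> I \<Longrightarrow> I = M"
proof -
  have "\<exists>M\<in>\<I>. \<forall>X\<in>\<I>. M \<subseteq> X \<longrightarrow> X = M"
  proof (rule subset_Zorn)
    fix C assume C: "subset.chain \<I> C"
    show "\<exists>U\<in>\<I>. \<forall>X\<in>C. X \<subseteq> U"
    proof (cases "C = {}")
      case False
      have "subset.chain {I. ideal I R} C"
        using C assms(1) unfolding pred_on.chain_def by auto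
      then have "\<Union>C \<in> C"
        by (rule noetherian_ring.ideal_chain_is_trivial[OF noetherian False])
      moreover from this have "\<Union>C \<in> \<I>"
        using C unfolding pred_on.chain_def by blast
      ultimately show ?thesis by (intro bexI[of _ "\<Union>C"]) auto
    qed (use assms(2) in auto)
  qed
  then obtain M where "M \<in> \<I>" "\<forall>X\<in>\<I>. M \<subseteq> X \<longrightarrow> X = M" by blast
  then show ?thesis by (intro that[of M]) simp_all
qed

text \<open>An ideal \<open>Q\<close> that is maximal among the ideals over \<open>C\<close> avoiding \<open>M\<close> is prime: if \<open>a\<close> and \<open>b\<close> are not
in \<open>Q\<close>, then \<open>Q + (a)\<close> and \<open>Q + (b)\<close> meet \<open>M\<close>, hence so does their product, which would be contained in
\<open>Q\<close> if \<open>a * b\<close> were in \<open>Q\<close>.\<close>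

lemma prime_avoiding_mult_set:
  assumes M: "1 \<in> M" "\<And>x y. x \<in> M \<Longrightarrow> y \<in> M \<Longrightarrow> x * y \<in> M" and C: "ideal C R" "C \<inter> M = {}"
  obtains Q where "primeideal Q R" "C \<subseteq> Q" "Q \<inter> M = {}"
proof -
  obtain Q where Q: "ideal Q R" "C \<subseteq> Q" "Q \<inter> M = {}"
    and max: "\<And>I. ideal I R \<Longrightarrow> C \<subseteq> I \<Longrightarrow> I \<inter> M = {} \<Longrightarrow> Q \<subseteq> I \<Longrightarrow> I = Q"
    by (rule maximal_ideal_in_family[of "{I. ideal I R \<and> C \<subseteq> I \<and> I \<inter> M = {}}" C]) (use C in auto)
  have meet: "\<exists>q\<in>Q. \<exists>r\<in>A. q + r * a \<in> M" if "a \<in> A" "a \<notin> Q" for a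
  proof -
    note J = ideal_join[OF Q(1) that(1)]
    have "ideal_join Q a \<inter> M \<noteq> {}"
      using max[OF J(1)] J Q(2) that(2) by auto
    then show ?thesis by (auto simp: ideal_join_def)
  qed
  have "primeideal Q R"
    unfolding primeideal_iff
  proof (intro conjI ballI impI)
    show "1 \<notin> Q" using Q(3) M(1) by auto
    fix a b assume ab: "a \<in> A" "b \<in> A" "a * b \<in> Q"
    show "a \<in> Q \<or> b \<in> Q"
    proof (rule ccontr)
      assume "\<not> (a \<in> Q \<or> b \<in> Q)"
      then obtain q r q' r' where *: "q \<in> Q" "r \<in> A" "q + r * a \<in> M" "q' \<in> Q" "r' \<in> A" "q' + r' * b \<in> M"
        using meet[OF ab(1)] meet[OF ab(2)] by blast
      have "(q + r * a) * (q' + r' * b) = q * (q' + r' * b) + (r * a) * q' + (r * r') * (a * b)"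
        by (simp add: algebra_simps)
      also have "\<dots> \<in> Q"
      proof (intro ideal_add[OF Q(1)])
        have "q' + r' * b \<in> A" "r * a \<in> A" "r * r' \<in> A"
          using * ab ideal_mem[OF Q(1)] by auto
        then show "q * (q' + r' * b) \<in> Q" "(r * a) * q' \<in> Q" "(r * r') * (a * b) \<in> Q"
          using * ab ideal_mult'[OF Q(1)] ideal_mult[OF Q(1)] by auto
      qed
      finally show False using M(2)[OF *(3,6)] Q(3) by auto
    qed
  qed (rule Q)
  with that Q show ?thesis by auto
qed

abbreviation minimal_over :: "'a set \<Rightarrow> 'a set \<Rightarrow> bool" where
  "minimal_over P C \<equiv> minimal_prime R C P"

text \<open>The multiplicative set generated by \<open>A - P\<close> and \<open>b\<close> does not meet \<open>C\<close>. A prime ideal over \<open>C\<close>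
that avoids it lies in \<open>P\<close> and misses \<open>b\<close>.\<close>

lemma smaller_prime:
  assumes P: "primeideal P R" and C: "ideal C R" and b: "b \<in> A"
    and disj: "\<And>s k. s \<in> A - P \<Longrightarrow> s * b ^ k \<notin> C"
  obtains Q where "primeideal Q R" "C \<subseteq> Q" "Q \<subseteq> P" "b \<notin> Q"
proof -
  define M where "M = {s * b ^ k |s k. s \<in> A - P}"
  have "1 = 1 * b ^ 0" by simp
  then have "1 \<in> M" unfolding M_def using prime_one[OF P] by blast
  moreover have "x * y \<in> M" if xy: "x \<in> M" "y \<in> M" for x y
  proof -
    obtain s k t l where *: "x = s * b ^ k" "y = t * b ^ l" "s \<in> A - P" "t \<in> A - P"
      using xy by (auto simp: M_def)
    then have "x * y = (s * t) * b ^ (k + l)" by (simp add: power_add algebra_simps)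
    moreover have "s * t \<in> A - P" using * prime_disj[OF P] by auto
    ultimately show ?thesis unfolding M_def by blast
  qed
  moreover have "C \<inter> M = {}" using disj by (auto simp: M_def)
  ultimately obtain Q where Q: "primeideal Q R" "C \<subseteq> Q" "Q \<inter> M = {}"
    using prime_avoiding_mult_set[of M C] C by blast
  have "s \<in> M" if "s \<in> A - P" for s
  proof -
    have "s = s * b ^ 0" by simp
    with that show ?thesis unfolding M_def by blast
  qed
  then have "Q \<subseteq> P" using Q(3) ideal_mem[OF prime_ideal[OF Q(1)]] by auto
  moreover have "b \<in> M"
  proof -
    have "b = 1 * b ^ 1" by simp
    then show ?thesis unfolding M_def using prime_one[OF P] by blast
  qed
  ultimately show ?thesis using that[of Q] Q by auto
qed

text \<open>In the localization at \<open>P\<close> the maximal ideal is the only prime over \<open>C\<close>, so its elements are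
nilpotent modulo \<open>C\<close>.\<close>

lemma minimal_over_power:
  assumes "minimal_over P C" "ideal C R" "b \<in> P"
  obtains s k where "s \<in> A - P" "s * b ^ k \<in> C"
proof (rule ccontr)
  assume "\<not> thesis"
  with that have *: "s * b ^ k \<notin> C" if "s \<in> A - P" for s k using that by blast
  from assms(1) have P: "primeideal P R" by (simp add: minimal_prime_def)
  from smaller_prime[OF P assms(2) _ *] obtain Q where "primeideal Q R" "C \<subseteq> Q" "Q \<subseteq> P" "b \<notin> Q"
    using assms(3) ideal_mem[OF prime_ideal[OF P]] by blast
  with assms(1,3) show False by (auto simp: minimal_prime_def)
qed

section \<open>Krull's principal ideal theorem\<close>

text \<open>The saturated ideals are the contractions of the ideals of the localization at \<open>P\<close>. They allow local
arguments to be carried out inside \<open>A\<close>.\<close>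

definition saturated :: "'a set \<Rightarrow> 'a set \<Rightarrow> bool" where
  "saturated P C \<longleftrightarrow> (\<forall>s\<in>A - P. \<forall>f\<in>A. s * f \<in> C \<longrightarrow> f \<in> C)"

definition saturation :: "'a set \<Rightarrow> 'a set \<Rightarrow> 'a set" where
  "saturation P C = {f \<in> A. \<exists>s\<in>A - P. s * f \<in> C}"

lemma compl_prime_mult:
  assumes "primeideal P R" "s \<in> A - P" "t \<in> A - P"
  shows "s * t \<in> A - P"
  using assms prime_disj[OF assms(1), of s t] by auto

lemma one_compl_prime: "primeideal P R \<Longrightarrow> 1 \<in> A - P"
  using prime_one by auto

lemma saturation:
  assumes P: "primeideal P R" and C: "ideal C R"
  shows "ideal (saturation P C) R" "saturated P (saturation P C)" "C \<subseteq> saturation P C"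
proof -
  show "ideal (saturation P C) R"
    unfolding ideal_iff
  proof (intro conjI ballI)
    show "0 \<in> saturation P C"
      using one_compl_prime[OF P] C by (auto simp: saturation_def)
    fix x y assume "x \<in> saturation P C" "y \<in> saturation P C"
    then obtain s t where *: "x \<in> A" "y \<in> A" "s \<in> A - P" "t \<in> A - P" "s * x \<in> C" "t * y \<in> C"
      by (auto simp: saturation_def)
    have "t * (s * x) \<in> C" "s * (t * y) \<in> C"
      using * ideal_mult[OF C] by auto
    then have "t * (s * x) + s * (t * y) \<in> C"
      by (rule ideal_add[OF C])
    moreover have "t * (s * x) + s * (t * y) = (s * t) * (x + y)" by (simp add: algebra_simps)
    ultimately show "x + y \<in> saturation P C"
      using compl_prime_mult[OF P *(3,4)] * by (auto simp: saturation_def intro!: bexI[of _ "s * t"])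
  next
    fix a x assume "a \<in> A" "x \<in> saturation P C"
    then obtain s where *: "x \<in> A" "a \<in> A" "s \<in> A - P" "s * x \<in> C"
      by (auto simp: saturation_def)
    have "a * (s * x) \<in> C" using * ideal_mult[OF C] by auto
    then have "s * (a * x) \<in> C" by (simp add: algebra_simps)
    with * show "a * x \<in> saturation P C" unfolding saturation_def by blast
  qed (auto simp: saturation_def)
  show "saturated P (saturation P C)"
    unfolding saturated_def
  proof (intro ballI impI)
    fix s f assume "s \<in> A - P" "f \<in> A" "s * f \<in> saturation P C"
    then obtain t where "t \<in> A - P" "t * (s * f) \<in> C" by (auto simp: saturation_def)
    moreover from this have "(t * s) * f \<in> C" by (simp add: algebra_simps)
    ultimately show "f \<in> saturation P C"
      using compl_prime_mult[OF P \<open>t \<in> A - P\<close> \<open>s \<in> A - P\<close>] \<open>f \<in> A\<close>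
      unfolding saturation_def by blast
  qed
  show "C \<subseteq> saturation P C"
    using one_compl_prime[OF P] ideal_mem[OF C] unfolding saturation_def
    by (auto intro!: bexI[of _ 1])
qed

text \<open>A maximal ideal among the \<open>C : c\<close> with \<open>c \<notin> C\<close> is prime. It contains \<open>C0\<close>, and it is contained in \<open>P\<close>
because \<open>C\<close> is saturated, so it equals \<open>P\<close>.\<close>

lemma prime_annihilates_mod:
  assumes P: "minimal_over P C0" and C: "ideal C R" "C0 \<subseteq> C" "saturated P C" "1 \<notin> C"
  obtains c where "c \<in> A" "c \<notin> C" "\<And>p. p \<in> P \<Longrightarrow> p * c \<in> C"
proof -
  define colon where "colon c = {t \<in> A. t * c \<in> C}" for c
  have ideal_colon: "ideal (colon c) R" if "c \<in> A" for c
    unfolding ideal_iff colon_def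
    using ideal_add[OF C(1)] ideal_mult[OF C(1)] C(1)
    by (auto simp: distrib_right mult.assoc)
  obtain M where M: "M \<in> colon ` (A - C)" and max: "\<And>I. I \<in> colon ` (A - C) \<Longrightarrow> M \<subseteq> I \<Longrightarrow> I = M"
    by (rule maximal_ideal_in_family[of "colon ` (A - C)" "colon 1"])
      (use ideal_colon C(4) in auto)
  from M obtain c where c: "c \<in> A" "c \<notin> C" "M = colon c" by auto
  have "primeideal M R"
    unfolding primeideal_iff
  proof (intro conjI ballI impI)
    show "ideal M R" using c ideal_colon by simp
    show "1 \<notin> M" using c by (simp add: colon_def)
    fix t u assume tu: "t \<in> A" "u \<in> A" "t * u \<in> M"
    show "t \<in> M \<or> u \<in> M"
    proof (cases "u \<in> M")
      case False
      then have "u * c \<in> A - C" using tu c by (auto simp: colon_def)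
      moreover have "M \<subseteq> colon (u * c)"
      proof
        fix x assume "x \<in> M"
        then have "x \<in> A" "u * (x * c) \<in> C" using c(3) tu ideal_mult[OF C(1)] by (auto simp: colon_def)
        then show "x \<in> colon (u * c)" by (auto simp: colon_def algebra_simps)
      qed
      ultimately have "colon (u * c) = M" using max by blast
      then show ?thesis using tu c by (auto simp: colon_def algebra_simps)
    qed simp
  qed
  moreover have "C0 \<subseteq> M"
    using C(2) c ideal_mult'[OF C(1)] ideal_mem[OF C(1)] by (auto simp: colon_def)
  moreover have "M \<subseteq> P"
    using c C(3) by (auto simp: colon_def saturated_def)
  ultimately have "M = P" using P by (auto simp: minimal_prime_def)
  then have "p * c \<in> C" if "p \<in> P" for p using that c(3) by (auto simp: colon_def)
  then show ?thesis using that[of c] c by auto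
qed

text \<open>Modulo \<open>C0\<close> the local ring at \<open>P\<close> has only one prime ideal and is therefore Artinian. The proof
avoids composition series: if \<open>C\<close> is maximal among the ideals on which the chain is eventually constant
and \<open>C\<close> is proper, choose \<open>c \<notin> C\<close> with \<open>P c \<subseteq> C\<close>. Locally, \<open>C + (c)\<close> is one dimension larger than \<open>C\<close>
over the residue field, so the chain is eventually constant on it, too.\<close>

lemma saturated_chain_stabilises:
  assumes P: "minimal_over P C0" and C0: "ideal C0 R"
    and B: "\<And>n. ideal (B n) R" "\<And>n. saturated P (B n)" "\<And>n. C0 \<subseteq> B n" and "decseq B"
  obtains n where "\<And>m. m \<ge> n \<Longrightarrow> B n \<subseteq> B m"
proof -
  have prime: "primeideal P R" using P by (simp add: minimal_prime_def)
  have dec: "B m \<subseteq> B n" if "n \<le> m" for n m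
    using assms(6) that by (auto simp: decseq_def)
  define stab where "stab C \<longleftrightarrow> (\<exists>n. \<forall>m\<ge>n. B n \<inter> C \<subseteq> B m)" for C
  define \<C> where "\<C> = {C. ideal C R \<and> saturated P C \<and> C0 \<subseteq> C \<and> stab C}"
  have "saturation P C0 \<in> \<C>"
  proof -
    have "saturation P C0 \<subseteq> B n" for n
      using B(2)[of n] B(3)[of n] by (auto simp: saturation_def saturated_def)
    then show ?thesis using saturation[OF prime C0] by (auto simp: \<C>_def stab_def)
  qed
  then obtain C where C\<C>: "C \<in> \<C>" and max: "\<And>D. D \<in> \<C> \<Longrightarrow> C \<subseteq> D \<Longrightarrow> D = C"
    by (rule maximal_ideal_in_family[of \<C>, rotated]) (auto simp: \<C>_def)
  then have C: "ideal C R" "saturated P C" "C0 \<subseteq> C" "stab C" by (auto simp: \<C>_def)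
  have "1 \<in> C"
  proof (rule ccontr)
    assume "1 \<notin> C"
    then obtain c where c: "c \<in> A" "c \<notin> C" and Pc: "\<And>p. p \<in> P \<Longrightarrow> p * c \<in> C"
      using prime_annihilates_mod[OF P C(1,3,2)] by blast
    note J = ideal_join[OF C(1) c(1)]
    define C' where "C' = saturation P (ideal_join C c)"
    note C' = saturation[OF prime J(1), folded C'_def]
    have rep: "\<exists>s g r. s \<in> A - P \<and> g \<in> C \<and> r \<in> A \<and> s * x = g + r * c" if "x \<in> C'" for x
      using that by (auto simp: C'_def saturation_def ideal_join_def)
    have rep': "\<exists>s g r. s \<in> A - P \<and> g \<in> C \<and> r \<in> A - P \<and> s * x = g + r * c" if x: "x \<in> C'" "x \<notin> C" for x
    proof -
      obtain s g r where *: "s \<in> A - P" "g \<in> C" "r \<in> A" "s * x = g + r * c" using rep[OF x(1)] by blast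
      have "r \<notin> P"
      proof
        assume "r \<in> P"
        then have "s * x \<in> C" using * Pc ideal_add[OF C(1)] by auto
        then show False using C(2) *(1) x ideal_mem[OF C'(1)] by (auto simp: saturated_def)
      qed
      with * show ?thesis by blast
    qed
    obtain n1 where n1: "\<And>m. m \<ge> n1 \<Longrightarrow> B n1 \<inter> C \<subseteq> B m"
      using C(4) by (auto simp: stab_def)
    have "stab C'"
    proof (cases "\<exists>n0. B n0 \<inter> C' \<subseteq> C")
      case True
      then obtain n0 where n0: "B n0 \<inter> C' \<subseteq> C" by blast
      have "B (max n0 n1) \<inter> C' \<subseteq> B m" if "m \<ge> max n0 n1" for m
        using n0 n1[of m] that dec[of n0 "max n0 n1"] dec[of n1 "max n0 n1"] by auto
      then show ?thesis unfolding stab_def by blast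
    next
      case False
      have "x \<in> B m" if m: "m \<ge> n1" and x: "x \<in> B n1 \<inter> C'" for m x
      proof -
        obtain b where b: "b \<in> B m" "b \<in> C'" "b \<notin> C" using False by blast
        obtain t h u where t: "t \<in> A - P" "h \<in> C" "u \<in> A - P" "t * b = h + u * c"
          using rep'[OF b(2,3)] by blast
        obtain s g r where s: "s \<in> A - P" "g \<in> C" "r \<in> A" "s * x = g + r * c"
          using rep x by blast
        have xb: "x \<in> A" "b \<in> A" "x \<in> B n1" "b \<in> B n1"
          using x b(1) dec[OF m] ideal_mem[OF B(1)] by auto
        have eq: "u * (s * x) - r * (t * b) = u * g - r * h"
          unfolding s(4) t(4) by (simp add: algebra_simps)
        have "u * (s * x) - r * (t * b) \<in> C"
          unfolding eq using s t by (intro ideal_diff[OF C(1)] ideal_mult[OF C(1)]) auto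
        moreover have "u * (s * x) - r * (t * b) \<in> B n1"
          using s t xb by (intro ideal_diff[OF B(1)] ideal_mult[OF B(1)]) auto
        ultimately have "u * (s * x) - r * (t * b) \<in> B m"
          using n1[OF m] by blast
        moreover have "r * (t * b) \<in> B m"
          using s t b by (intro ideal_mult[OF B(1)]) auto
        ultimately have "u * (s * x) - r * (t * b) + r * (t * b) \<in> B m"
          by (rule ideal_add[OF B(1)])
        then have "(u * s) * x \<in> B m" by (simp add: algebra_simps)
        then show ?thesis
          using B(2)[of m] compl_prime_mult[OF prime t(3) s(1)] xb(1) unfolding saturated_def by blast
      qed
      then show ?thesis unfolding stab_def by blast
    qed
    then have "C' \<in> \<C>" using C'(1,2,3) J(2) C(3) by (auto simp: \<C>_def)
    then have "C' = C" using max C'(3) J(2) by blast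
    then show False using c J(3) C'(3) by auto
  qed
  then have "C = A" by (rule ideal_one[OF C(1)])
  then obtain n where "\<forall>m\<ge>n. B n \<inter> A \<subseteq> B m" using C(4) by (auto simp: stab_def)
  then have "B n \<subseteq> B m" if "m \<ge> n" for m using that ideal_sub[OF B(1)[of n]] by blast
  then show ?thesis using that by blast
qed

text \<open>Nakayama's lemma at \<open>P\<close>, by induction on the number of generators: the equation for \<open>s * e\<close> has the
coefficient \<open>s - a * r\<close> outside \<open>P\<close> at \<open>e\<close> and can be solved for \<open>e\<close>.\<close>

lemma nakayama:
  assumes P: "primeideal P R" and N: "ideal N R" "saturated P N" and a: "a \<in> P"
    and F: "finite F" "F \<subseteq> A"
    and gen: "\<And>d. d \<in> F \<Longrightarrow> \<exists>s\<in>A - P. \<exists>x\<in>N. \<exists>g\<in>genideal R F. s * d = x + a * g"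
  shows "F \<subseteq> N"
  using F gen
proof (induction F)
  case (insert e F)
  have aA: "a \<in> A" using a ideal_mem[OF prime_ideal[OF P]] by blast
  have eA: "e \<in> A" and FA: "F \<subseteq> A" using insert.prems by auto
  have F: "ideal (genideal R F) R" using genideal_ideal FA by simp
  have "\<exists>s\<in>A - P. \<exists>x\<in>N. \<exists>g\<in>genideal R F. s * e = x + a * g"
  proof -
    obtain s x g r where *: "s \<in> A - P" "x \<in> N" "g \<in> genideal R F" "r \<in> A" "s * e = x + a * (r * e + g)"
      using insert.prems(2)[of e] genideal_insert[OF FA eA] by auto
    have "s - a * r \<in> A - P"
    proof -
      have "s = (s - a * r) + r * a" by simp
      then have "s - a * r \<notin> P"
        using *(1,4) a ideal_add[OF prime_ideal[OF P]] ideal_mult[OF prime_ideal[OF P]] by (metis DiffD2)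
      then show ?thesis using * aA by auto
    qed
    moreover have "(s - a * r) * e = x + a * g"
      using *(5) by (simp add: algebra_simps)
    ultimately show ?thesis using * by blast
  qed
  then obtain s x g where e: "s \<in> A - P" "x \<in> N" "g \<in> genideal R F" "s * e = x + a * g" by blast
  have FN: "F \<subseteq> N"
  proof (rule insert.IH[OF FA])
    fix d assume "d \<in> F"
    then obtain t y h r where *: "t \<in> A - P" "y \<in> N" "h \<in> genideal R F" "r \<in> A" "t * d = y + a * (r * e + h)"
      using insert.prems(2)[of d] genideal_insert[OF FA eA] by auto
    have "(s * t) * d = s * (t * d)" by (simp add: algebra_simps)
    also have "\<dots> = s * y + a * (r * (s * e) + s * h)"
      unfolding *(5) by (simp add: algebra_simps)
    also have "\<dots> = (s * y + (a * r) * x) + a * ((r * a) * g + s * h)"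
      unfolding e(4) by (simp add: algebra_simps)
    finally have eq: "(s * t) * d = (s * y + (a * r) * x) + a * ((r * a) * g + s * h)" .
    show "\<exists>s\<in>A - P. \<exists>x\<in>N. \<exists>g\<in>genideal R F. s * d = x + a * g"
    proof (intro bexI)
      show "(s * t) * d = (s * y + (a * r) * x) + a * ((r * a) * g + s * h)" by (fact eq)
      show "(r * a) * g + s * h \<in> genideal R F"
        using * e aA by (intro ideal_add[OF F] ideal_mult[OF F]) auto
      show "s * y + (a * r) * x \<in> N"
        using * e aA by (intro ideal_add[OF N(1)] ideal_mult[OF N(1)]) auto
      show "s * t \<in> A - P" by (rule compl_prime_mult[OF P e(1) *(1)])
    qed
  qed
  then have "genideal R F \<subseteq> N" using genideal_minimal[OF N(1)] by simp
  then have "s * e \<in> N"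
    using e aA ideal_add[OF N(1)] ideal_mult[OF N(1)] by auto
  then have "e \<in> N" using N(2) e(1) eA by (auto simp: saturated_def)
  with FN show ?case by auto
qed simp

text \<open>Take \<open>y\<close> in \<open>Q\<close> but not in \<open>Q0\<close>, and let \<open>D n\<close> consist of the elements that, locally at \<open>Q\<close>, are
multiples of \<open>y ^ n\<close> modulo \<open>Q0\<close>. Locally at \<open>P\<close> the ideals \<open>D n + (a)\<close> are eventually constant. Since
\<open>a\<close> is not in \<open>Q\<close>, this gives \<open>D n \<subseteq> D (n + 1) + a D n\<close> locally at \<open>P\<close>, and Nakayama's lemma
yields \<open>D n = D (n + 1)\<close>. So \<open>y ^ n\<close> is a multiple of \<open>y ^ (n + 1)\<close> modulo \<open>Q0\<close> in the local domain at \<open>Q\<close>, which is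
impossible for the nonzero non-unit \<open>y\<close>.\<close>

theorem krull_principal_ideal:
  assumes Q0: "primeideal Q0 R" and Q: "primeideal Q R" "Q0 \<subset> Q" "Q \<subset> P"
    and a: "a \<in> A" and P: "minimal_over P (ideal_join Q0 a)"
  shows False
proof -
  note C0 = ideal_join[OF prime_ideal[OF Q0] a]
  note iQ = prime_ideal[OF Q(1)] and iQ\<^sub>0 = prime_ideal[OF Q0]
  have prime: "primeideal P R" using P by (simp add: minimal_prime_def)
  note iP = prime_ideal[OF prime]
  have aP: "a \<in> P" using P C0 by (auto simp: minimal_prime_def)
  have aQ: "a \<notin> Q"
  proof
    assume "a \<in> Q"
    then have "ideal_join Q0 a \<subseteq> Q"
      using Q(2) by (intro ideal_join_least[OF iQ]) auto
    with P Q(1,3) show False by (auto simp: minimal_prime_def)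
  qed
  from Q(2) obtain y where y: "y \<in> Q" "y \<notin> Q0" by auto
  have yA: "y \<in> A" using y(1) ideal_mem[OF iQ] by blast
  define D where "D n = saturation Q (ideal_join Q0 (y ^ n))" for n
  note Jy = ideal_join[OF iQ\<^sub>0 power_mem[OF yA]]
  note D_ideal = saturation(1)[OF Q(1) Jy(1), folded D_def]
    and D_satQ = saturation(2)[OF Q(1) Jy(1), folded D_def]
    and JD = saturation(3)[OF Q(1) Jy(1), folded D_def]
  have Q0D: "Q0 \<subseteq> D n" for n using Jy(2) JD by blast
  have D_sat: "saturated P (D n)" for n
    using D_satQ[of n] Q(3) unfolding saturated_def by blast
  have D_dec: "D (Suc n) \<subseteq> D n" for n
  proof -
    have "y ^ Suc n \<in> ideal_join Q0 (y ^ n)" using ideal_mult[OF Jy(1) yA Jy(3)] by simp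
    then have "ideal_join Q0 (y ^ Suc n) \<subseteq> ideal_join Q0 (y ^ n)"
      by (rule ideal_join_least[OF Jy(1,2)])
    then show ?thesis unfolding D_def saturation_def by blast
  qed
  define B where "B n = saturation P (ideal_join (D n) a)" for n
  note J = ideal_join[OF D_ideal a]
  note B = saturation[OF prime J(1), folded B_def]
  have B_dec: "B (Suc n) \<subseteq> B n" for n
    using D_dec[of n] unfolding B_def saturation_def ideal_join_def by blast
  have C0B: "ideal_join Q0 a \<subseteq> B n" for n
    using Q0D[of n] B(3)[of n] unfolding ideal_join_def by blast
  have "decseq B" using B_dec by (intro decseq_SucI)
  from saturated_chain_stabilises[OF P C0(1) B(1,2) C0B this]
  obtain n where n: "\<And>m. m \<ge> n \<Longrightarrow> B n \<subseteq> B m" by blast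
  obtain F where F: "finite F" "F \<subseteq> A" "D n = genideal R F"
    using fin_gen[OF D_ideal] by blast
  have "F \<subseteq> D (Suc n)"
  proof (rule nakayama[OF prime D_ideal D_sat aP F(1,2)])
    fix f assume "f \<in> F"
    then have f: "f \<in> D n" using genideal_self[of F] F by auto
    then have "f \<in> B (Suc n)" using J(2) B(3)[of n] n[of "Suc n"] by auto
    then obtain s g h where *: "s \<in> A - P" "g \<in> D (Suc n)" "h \<in> A" "s * f = g + h * a"
      unfolding B_def saturation_def ideal_join_def by blast
    have "a * h = s * f - g" using *(4) by (simp add: algebra_simps)
    also have "\<dots> \<in> D n"
      using * f D_dec[of n] by (intro ideal_diff[OF D_ideal] ideal_mult[OF D_ideal]) auto
    finally have "h \<in> D n"
      using D_satQ[of n] *(3) a aQ unfolding saturated_def by blast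
    then show "\<exists>s\<in>A - P. \<exists>x\<in>D (Suc n). \<exists>g\<in>genideal R F. s * f = x + a * g"
      using * F(3) by (metis mult.commute)
  qed
  then have "D n \<subseteq> D (Suc n)"
    unfolding F(3) using genideal_minimal[OF D_ideal] by simp
  moreover have "y ^ n \<in> D n" using Jy(3) JD by blast
  ultimately obtain s r q where s: "s \<in> A - Q" "r \<in> A" "q \<in> Q0" "s * y ^ n = q + r * y ^ Suc n"
    unfolding D_def saturation_def ideal_join_def by blast
  then have "(s - r * y) * y ^ n = q" by (simp add: algebra_simps)
  then have "s - r * y \<in> Q0"
    using prime_disj[OF Q0, of "s - r * y" "y ^ n"] prime_power[OF Q0 yA, of n] s y yA by auto
  then have "s - r * y \<in> Q" using Q(2) by auto
  then have "s - r * y + r * y \<in> Q"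
    using y s by (intro ideal_add[OF iQ] ideal_mult[OF iQ]) auto
  then show False using s(1) by simp
qed

end

section \<open>Krull's height theorem\<close>

text \<open>The condition \<open>h \<le> prime_height R P\<close> in a form suited to induction on \<open>h\<close>; see
\<open>prime_height_ge_iff\<close>.\<close>

primrec height_ge :: "('a, 'b) ring_scheme \<Rightarrow> nat \<Rightarrow> 'a set \<Rightarrow> bool" where
  "height_ge R 0 P \<longleftrightarrow> primeideal P R"
| "height_ge R (Suc h) P \<longleftrightarrow> primeideal P R \<and> (\<exists>Q. Q \<subset> P \<and> height_ge R h Q)"

lemma height_ge_prime: "height_ge R h P \<Longrightarrow> primeideal P R"
  by (cases h) auto

lemma height_ge_superset:
  assumes "height_ge R h Q" "Q \<subseteq> P" "primeideal P R"
  shows "height_ge R h P"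
proof (cases h)
  case (Suc h')
  then obtain Q' where "Q' \<subset> Q" "height_ge R h' Q'" using assms(1) by auto
  with assms(2,3) Suc show ?thesis by (auto intro!: exI[of _ Q'])
qed (use assms in simp)

lemma height_ge_antimono: "height_ge R h P \<Longrightarrow> h' \<le> h \<Longrightarrow> height_ge R h' P"
proof (induction h arbitrary: h' P)
  case (Suc h)
  then show ?case by (cases h') auto
qed simp

lemma height_ge_chain:
  assumes "Qs \<noteq> []" "\<forall>Q\<in>set Qs. primeideal Q R" "sorted_wrt (\<subset>) Qs"
  shows "height_ge R (length Qs - 1) (last Qs)"
  using assms
proof (induction Qs rule: rev_induct)
  case (snoc P Qs)
  show ?case
  proof (cases "Qs = []")
    case False
    then have "last Qs \<subset> P" using snoc.prems(3) by (simp add: sorted_wrt_append)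
    moreover have "height_ge R (length Qs - 1) (last Qs)"
      using snoc False by (simp add: sorted_wrt_append)
    moreover have "length (Qs @ [P]) - 1 = Suc (length Qs - 1)" using False by (cases Qs) auto
    ultimately show ?thesis using snoc.prems(2) by (auto simp del: length_append)
  qed (use snoc.prems in auto)
qed simp

lemma chain_of_height_ge:
  assumes "height_ge R h P"
  shows "\<exists>Qs. length Qs = Suc h \<and> (\<forall>Q\<in>set Qs. primeideal Q R \<and> Q \<subseteq> P) \<and> sorted_wrt (\<subset>) Qs \<and> last Qs = P"
  using assms
proof (induction h arbitrary: P)
  case 0
  then show ?case by (intro exI[of _ "[P]"]) auto
next
  case (Suc h)
  then obtain Q where Q: "primeideal P R" "Q \<subset> P" "height_ge R h Q" by auto
  from Suc.IH[OF Q(3)] obtain Qs where "length Qs = Suc h" "\<forall>Q'\<in>set Qs. primeideal Q' R \<and> Q' \<subseteq> Q"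
    "sorted_wrt (\<subset>) Qs" by blast
  with Q show ?case
    by (intro exI[of _ "Qs @ [P]"]) (auto simp: sorted_wrt_append)
qed

lemma prime_height_ge_iff:
  assumes "primeideal P R"
  shows "enat h \<le> prime_height R P \<longleftrightarrow> height_ge R h P"
proof
  let ?S = "{Qs. Qs \<noteq> [] \<and> (\<forall>Q\<in>set Qs. primeideal Q R) \<and> sorted_wrt (\<subset>) Qs \<and> last Qs = P}"
  assume le: "enat h \<le> prime_height R P"
  show "height_ge R h P"
  proof (rule ccontr)
    assume not: "\<not> height_ge R h P"
    then have "h > 0" using assms by (cases h) auto
    have "prime_height R P \<le> enat (h - 1)"
      unfolding prime_height_def
    proof (rule SUP_least)
      fix Qs assume "Qs \<in> ?S"
      then have "height_ge R (length Qs - 1) P" using height_ge_chain[of Qs R] by auto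
      then have "\<not> h \<le> length Qs - 1" using not height_ge_antimono by blast
      then show "enat (length Qs - 1) \<le> enat (h - 1)" by simp
    qed
    with le have "enat h \<le> enat (h - 1)" by (rule order_trans)
    with \<open>h > 0\<close> show False by simp
  qed
next
  assume "height_ge R h P"
  from chain_of_height_ge[OF this] obtain Qs where Qs: "length Qs = Suc h" "\<forall>Q\<in>set Qs. primeideal Q R"
    "sorted_wrt (\<subset>) Qs" "last Qs = P" by blast
  show "enat h \<le> prime_height R P"
    unfolding prime_height_def by (rule SUP_upper2[of Qs]) (use Qs in auto)
qed

lemma ideal_height_geI:
  assumes "\<And>P. primeideal P R \<Longrightarrow> I \<subseteq> P \<Longrightarrow> height_ge R h P"
  shows "enat h \<le> ideal_height R I"
  unfolding ideal_height_def
  by (rule INF_greatest) (use assms prime_height_ge_iff in auto)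

lemma enat_less_not_le: "x \<le> enat h \<longleftrightarrow> \<not> enat (Suc h) \<le> x"
  by (cases x) auto

lemma prime_height_le_iff:
  "primeideal P R \<Longrightarrow> prime_height R P \<le> enat h \<longleftrightarrow> \<not> height_ge R (Suc h) P"
  unfolding enat_less_not_le by (simp only: prime_height_ge_iff)

context noetherian_subring
begin

text \<open>Choose a prime \<open>Q\<close> immediately below \<open>P\<close> and some \<open>a\<close> in \<open>F\<close> but not in \<open>Q\<close>. Then \<open>P\<close> is minimal over
\<open>Q + (a)\<close>, so every \<open>b \<in> F\<close> has a power that, up to a factor outside \<open>P\<close>, is the sum of some \<open>q b \<in> Q\<close>
and a multiple of \<open>a\<close>. By the principal ideal theorem \<open>Q\<close> is minimal over the \<open>q b\<close> with \<open>b \<noteq> a\<close>, and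
there are fewer of these than elements of \<open>F\<close>.\<close>

theorem krull_height:
  assumes "finite F" "F \<subseteq> A" "minimal_over P F" "height_ge R h P"
  shows "h \<le> card F"
  using assms
proof (induction h arbitrary: P F)
  case (Suc h)
  note F = Suc.prems(1,2) and P = Suc.prems(3)
  have prime: "primeideal P R" using P by (simp add: minimal_prime_def)
  obtain Q' where Q': "Q' \<subset> P" "height_ge R h Q'" using Suc.prems(4) by auto
  obtain Q where Q\<Q>: "Q \<in> {Q. primeideal Q R \<and> Q' \<subseteq> Q \<and> Q \<subset> P}"
    and max: "\<And>I. I \<in> {Q. primeideal Q R \<and> Q' \<subseteq> Q \<and> Q \<subset> P} \<Longrightarrow> Q \<subseteq> I \<Longrightarrow> I = Q"
    by (rule maximal_ideal_in_family[of "{Q. primeideal Q R \<and> Q' \<subseteq> Q \<and> Q \<subset> P}" Q'])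
      (use Q' height_ge_prime prime_ideal in auto)
  then have Q: "primeideal Q R" "Q \<subset> P" and hQ: "height_ge R h Q"
    using Q' height_ge_superset[of R h Q' Q] by auto
  have "\<not> F \<subseteq> Q" using P Q by (auto simp: minimal_prime_def)
  then obtain a where a: "a \<in> F" "a \<notin> Q" by blast
  have aA: "a \<in> A" using a F by blast
  note J = ideal_join[OF prime_ideal[OF Q(1)] aA]
  have aP: "a \<in> P" using a P by (auto simp: minimal_prime_def)
  have PQ: "minimal_over P (ideal_join Q a)"
    unfolding minimal_prime_def
  proof (intro conjI allI impI)
    show "ideal_join Q a \<subseteq> P"
      by (rule ideal_join_least[OF prime_ideal[OF prime]]) (use Q aP in auto)
    fix P' assume P': "primeideal P' R \<and> ideal_join Q a \<subseteq> P' \<and> P' \<subseteq> P"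
    show "P' = P"
    proof (rule ccontr)
      assume "P' \<noteq> P"
      then have "P' = Q" using max[of P'] P' J(2) Q\<Q> by auto
      then show False using P' J(3) a by auto
    qed
  qed (fact prime)
  have "\<exists>q\<in>Q. \<exists>s\<in>A - P. \<exists>k. \<exists>r\<in>A. s * b ^ k = q + r * a" if b: "b \<in> F" for b
  proof -
    have "b \<in> P" using b P by (auto simp: minimal_prime_def)
    then obtain s k where "s \<in> A - P" "s * b ^ k \<in> ideal_join Q a"
      using minimal_over_power[OF PQ J(1)] by blast
    then show ?thesis unfolding ideal_join_def by blast
  qed
  then obtain q where q: "\<And>b. b \<in> F \<Longrightarrow> q b \<in> Q \<and> (\<exists>s\<in>A - P. \<exists>k. \<exists>r\<in>A. s * b ^ k = q b + r * a)"
    by metis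
  define F' where "F' = q ` (F - {a})"
  have F': "finite F'" "F' \<subseteq> Q" using F q by (auto simp: F'_def)
  have "minimal_over Q F'"
    unfolding minimal_prime_def
  proof (intro conjI allI impI)
    fix Q0 assume Q0: "primeideal Q0 R \<and> F' \<subseteq> Q0 \<and> Q0 \<subseteq> Q"
    have i0: "ideal Q0 R" using Q0 prime_ideal by auto
    note J0 = ideal_join[OF i0 aA]
    have "minimal_over P (ideal_join Q0 a)"
      unfolding minimal_prime_def
    proof (intro conjI allI impI)
      show "ideal_join Q0 a \<subseteq> P"
        by (rule ideal_join_least[OF prime_ideal[OF prime]]) (use Q Q0 aP in auto)
      fix P' assume P': "primeideal P' R \<and> ideal_join Q0 a \<subseteq> P' \<and> P' \<subseteq> P"
      have iP': "ideal P' R" using P' prime_ideal by auto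
      have "F \<subseteq> P'"
      proof
        fix b assume b: "b \<in> F"
        show "b \<in> P'"
        proof (cases "b = a")
          case False
          obtain s k r where *: "s \<in> A - P" "r \<in> A" "s * b ^ k = q b + r * a" using q[OF b] by blast
          have "q b \<in> P'" using b False Q0 P' J0 by (auto simp: F'_def)
          then have "s * b ^ k \<in> P'"
            unfolding *(3) using * P' J0 by (intro ideal_add[OF iP'] ideal_mult[OF iP']) auto
          then have "b ^ k \<in> P'"
            using prime_disj[of P' s "b ^ k"] P' *(1) b F by blast
          then show ?thesis using prime_power[of P' b k] P' b F by blast
        qed (use P' J0 in auto)
      qed
      then show "P' = P" using P P' by (auto simp: minimal_prime_def)
    qed (fact prime)
    then have "\<not> Q0 \<subset> Q" using krull_principal_ideal[of Q0 Q P a] Q0 Q aA by blast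
    then show "Q0 = Q" using Q0 by auto
  qed (use Q F' in auto)
  then have "h \<le> card F'"
    using Suc.IH[of F' Q] F' ideal_mem[OF prime_ideal[OF Q(1)]] hQ by blast
  also have "\<dots> \<le> card (F - {a})" unfolding F'_def by (rule card_image_le) (use F in auto)
  also have "\<dots> < card F" using F a by (intro psubset_card_mono) auto
  finally show ?case by simp
qed simp

text \<open>A prime is minimal over its own finite set of generators.\<close>

lemma prime_height_finite:
  assumes "primeideal P R"
  obtains h where "\<not> height_ge R (Suc h) P"
proof -
  obtain F where F: "finite F" "F \<subseteq> A" "P = genideal R F"
    using fin_gen[OF prime_ideal[OF assms]] by blast
  have "minimal_over P F"
    unfolding minimal_prime_def
  proof (intro conjI allI impI)
    show "F \<subseteq> P" using F genideal_self by auto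
    fix Q assume "primeideal Q R \<and> F \<subseteq> Q \<and> Q \<subseteq> P"
    then show "Q = P" using F genideal_minimal[of Q F] prime_ideal by blast
  qed fact
  then have "\<not> height_ge R (Suc (card F)) P" using krull_height[OF F(1,2)] by (metis not_less_eq_eq order_refl)
  then show ?thesis using that by blast
qed

text \<open>As the heights of primes are finite, a prime of least height between \<open>F\<close> and \<open>P0\<close> exists, and it is
minimal over \<open>F\<close>.\<close>

lemma exists_minimal_over:
  assumes "primeideal P0 R" "F \<subseteq> P0"
  obtains P where "minimal_over P F" "P \<subseteq> P0"
proof -
  define ht where "ht Q = (LEAST h. \<not> height_ge R (Suc h) Q)" for Q
  have ht: "\<not> height_ge R (Suc (ht Q)) Q" "height_ge R (ht Q) Q" if "primeideal Q R" for Q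
  proof -
    show "\<not> height_ge R (Suc (ht Q)) Q"
      unfolding ht_def using prime_height_finite[OF that] by (metis (mono_tags, lifting) LeastI_ex)
    show "height_ge R (ht Q) Q"
      using not_less_Least[of "ht Q - 1" "\<lambda>h. \<not> height_ge R (Suc h) Q"] that
      by (cases "ht Q") (auto simp: ht_def)
  qed
  obtain P where P: "primeideal P R \<and> F \<subseteq> P \<and> P \<subseteq> P0"
    and min: "\<And>Q. primeideal Q R \<and> F \<subseteq> Q \<and> Q \<subseteq> P0 \<Longrightarrow> ht P \<le> ht Q"
    using ex_has_least_nat[of "\<lambda>Q. primeideal Q R \<and> F \<subseteq> Q \<and> Q \<subseteq> P0" P0 ht] assms by blast
  have "Q = P" if Q: "primeideal Q R" "F \<subseteq> Q" "Q \<subseteq> P" for Q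
  proof (rule ccontr)
    assume "Q \<noteq> P"
    then have "Q \<subset> P" using Q by blast
    then have "height_ge R (Suc (ht Q)) P"
      unfolding height_ge.simps using ht(2)[OF Q(1)] P by blast
    moreover have "ht P \<le> ht Q" using min[of Q] Q P by blast
    ultimately have "height_ge R (Suc (ht P)) P"
      using height_ge_antimono[of R "Suc (ht Q)" P "Suc (ht P)"] by simp
    then show False using ht(1)[of P] P by blast
  qed
  then show ?thesis using that[of P] P by (auto simp: minimal_prime_def)
qed

lemma ideal_height_le_card:
  assumes F: "finite F" "F \<subseteq> A" and P0: "primeideal P0 R" "F \<subseteq> P0" and I: "I \<subseteq> genideal R F"
  shows "ideal_height R I \<le> enat (card F)"
proof -
  obtain P where P: "minimal_over P F" using exists_minimal_over[OF P0] by blast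
  then have P': "primeideal P R" "F \<subseteq> P" by (auto simp: minimal_prime_def)
  have "I \<subseteq> P" using I genideal_minimal[OF prime_ideal[OF P'(1)] P'(2)] by simp
  then have "ideal_height R I \<le> prime_height R P"
    unfolding ideal_height_def using P' by (intro INF_lower) auto
  also have "\<dots> \<le> enat (card F)"
    using krull_height[OF F P, of "Suc (card F)"] by (subst prime_height_le_iff[OF P'(1)]) auto
  finally show ?thesis .
qed

text \<open>If \<open>g i\<close> is a nonzerodivisor modulo the ideal generated by the preceding ones, then no product of a power of
\<open>g i\<close> with an element outside \<open>P\<close> lies in this ideal. So \<open>P\<close> properly contains a prime over it, and each
\<open>g i\<close> contributes one step to a chain of primes.\<close>

lemma height_ge_regular:
  assumes "finite I" "g ` I \<subseteq> A"
    and reg: "\<And>J i h. J \<subseteq> I \<Longrightarrow> i \<in> I - J \<Longrightarrow> h \<in> A \<Longrightarrow> h * g i \<in> genideal R (g ` J) \<Longrightarrow>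
      h \<in> genideal R (g ` J)"
    and P: "primeideal P R" "g ` I \<subseteq> P"
  shows "height_ge R (card I) P"
  using assms
proof (induction I arbitrary: P rule: finite_induct)
  case (insert i I)
  let ?C = "genideal R (g ` I)"
  have C: "ideal ?C R" using insert.prems(1) by (intro genideal_ideal) auto
  have CP: "?C \<subseteq> P" using insert.prems by (intro genideal_minimal prime_ideal) auto
  have gi: "g i \<in> A" using insert.prems by auto
  have "s * g i ^ k \<notin> ?C" if s: "s \<in> A - P" for s k
  proof
    assume "s * g i ^ k \<in> ?C"
    then have "s \<in> ?C"
    proof (induction k)
      case (Suc k)
      have "(s * g i ^ k) * g i \<in> ?C" using Suc.prems by (simp add: mult_ac)
      moreover have "s * g i ^ k \<in> A" using gi s by auto
      ultimately have "s * g i ^ k \<in> ?C"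
        using insert.prems(2)[of I i "s * g i ^ k"] insert.hyps(2) by blast
      then show ?case by (rule Suc.IH)
    qed simp
    with CP s show False by blast
  qed
  then obtain Q where Q: "primeideal Q R" "?C \<subseteq> Q" "Q \<subseteq> P" "g i \<notin> Q"
    using smaller_prime[OF insert.prems(3) C gi] by blast
  have "height_ge R (card I) Q"
  proof (rule insert.IH)
    show "g ` I \<subseteq> Q" using Q(2) genideal_self[of "g ` I"] insert.prems(1) by auto
    show "h \<in> genideal R (g ` J)"
      if "J \<subseteq> I" "j \<in> I - J" "h \<in> A" "h * g j \<in> genideal R (g ` J)" for J j h
      using insert.prems(2)[of J j h] that by blast
  qed (use insert.prems(1) Q(1) in auto)
  moreover have "Q \<subset> P" using Q insert.prems(4) by auto
  ultimately have "height_ge R (Suc (card I)) P"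
    unfolding height_ge.simps using insert.prems(3) by blast
  then show ?case using insert.hyps by simp
qed simp

end

section \<open>Hilbert's basis theorem\<close>

text \<open>The polynomials in \<open>t\<close> of degree less than \<open>m\<close> over \<open>A\<close>; the element \<open>t\<close> may be algebraic over \<open>A\<close>, so
that the coefficients of an element are not unique.\<close>

definition power_span :: "'a::comm_ring_1 set \<Rightarrow> 'a \<Rightarrow> nat \<Rightarrow> 'a set" where
  "power_span A t m = {\<Sum>i<m. c i * t ^ i |c. \<forall>i. c i \<in> A}"

context comm_subring
begin

lemma power_span_0: "power_span A t 0 = {0}"
  by (auto simp: power_span_def)

lemma power_span_Suc: "power_span A t (Suc m) = {a * t ^ m + p |a p. a \<in> A \<and> p \<in> power_span A t m}"
proof (intro equalityI subsetI)
  fix f assume "f \<in> {a * t ^ m + p |a p. a \<in> A \<and> p \<in> power_span A t m}"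
  then obtain a p where "a \<in> A" "p \<in> power_span A t m" "f = a * t ^ m + p" by blast
  moreover from this(2) obtain c where "\<forall>i. c i \<in> A" "p = (\<Sum>i<m. c i * t ^ i)"
    by (auto simp: power_span_def)
  ultimately have *: "a \<in> A" "\<forall>i. c i \<in> A" "f = a * t ^ m + (\<Sum>i<m. c i * t ^ i)" by simp_all
  then have "f = (\<Sum>i<Suc m. (c(m := a)) i * t ^ i)" by simp
  moreover have "\<forall>i. (c(m := a)) i \<in> A" using * by simp
  ultimately show "f \<in> power_span A t (Suc m)" unfolding power_span_def by blast
next
  fix f assume "f \<in> power_span A t (Suc m)"
  then obtain c where "\<forall>i. c i \<in> A" "f = c m * t ^ m + (\<Sum>i<m. c i * t ^ i)"
    by (auto simp: power_span_def add.commute)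
  then show "f \<in> {a * t ^ m + p |a p. a \<in> A \<and> p \<in> power_span A t m}"
    unfolding power_span_def by blast
qed

lemma power_span_add: "p \<in> power_span A t m \<Longrightarrow> q \<in> power_span A t m \<Longrightarrow> p + q \<in> power_span A t m"
proof -
  assume "p \<in> power_span A t m" "q \<in> power_span A t m"
  then obtain c c' where *: "\<forall>i. c i \<in> A" "\<forall>i. c' i \<in> A" "p = (\<Sum>i<m. c i * t ^ i)" "q = (\<Sum>i<m. c' i * t ^ i)"
    by (auto simp: power_span_def)
  then have "p + q = (\<Sum>i<m. (c i + c' i) * t ^ i)" by (simp add: sum.distrib distrib_right)
  moreover have "\<forall>i. c i + c' i \<in> A" using * by auto
  ultimately show ?thesis unfolding power_span_def by (auto intro!: exI[of _ "\<lambda>i. c i + c' i"])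
qed

lemma power_span_mult: "a \<in> A \<Longrightarrow> p \<in> power_span A t m \<Longrightarrow> a * p \<in> power_span A t m"
proof -
  assume "a \<in> A" "p \<in> power_span A t m"
  then obtain c where *: "\<forall>i. c i \<in> A" "p = (\<Sum>i<m. c i * t ^ i)"
    by (auto simp: power_span_def)
  then have "a * p = (\<Sum>i<m. (a * c i) * t ^ i)" by (simp add: sum_distrib_left mult.assoc)
  moreover have "\<forall>i. a * c i \<in> A" using * \<open>a \<in> A\<close> by auto
  ultimately show ?thesis unfolding power_span_def by (auto intro!: exI[of _ "\<lambda>i. a * c i"])
qed

lemma power_span_uminus: "p \<in> power_span A t m \<Longrightarrow> - p \<in> power_span A t m"
  using power_span_mult[of "- 1" p] by auto

lemma power_span_zero: "0 \<in> power_span A t m"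
  by (induction m) (force simp: power_span_0 power_span_Suc)+

lemma power_span_mono: "m \<le> n \<Longrightarrow> power_span A t m \<subseteq> power_span A t n"
proof (induction n)
  case (Suc n)
  have "power_span A t n \<subseteq> power_span A t (Suc n)"
    unfolding power_span_Suc by force
  with Suc show ?case by (cases "m = Suc n") auto
qed simp

lemma power_span_shift: "p \<in> power_span A t m \<Longrightarrow> t * p \<in> power_span A t (Suc m)"
proof (induction m arbitrary: p)
  case (Suc m)
  then obtain a q where *: "p = a * t ^ m + q" "a \<in> A" "q \<in> power_span A t m"
    unfolding power_span_Suc by blast
  then have "t * p = a * t ^ Suc m + t * q" by (simp add: algebra_simps)
  with *(2) Suc.IH[OF *(3)] show ?case unfolding power_span_Suc[of t "Suc m"] by blast
qed (auto simp: power_span_0 power_span_zero)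

lemma power_span_shift_power: "p \<in> power_span A t m \<Longrightarrow> t ^ k * p \<in> power_span A t (m + k)"
proof (induction k)
  case (Suc k)
  then show ?case using power_span_shift[of "t ^ k * p" t "m + k"] by (simp add: mult.assoc)
qed simp

end

text \<open>For an ideal \<open>I\<close> of \<open>B = A[t]\<close> let \<open>L m\<close> be the ideal of the coefficients at \<open>t ^ m\<close> in the
representations of degree \<open>m\<close> of elements of \<open>I\<close>. The chain of the \<open>L m\<close> is constant from some \<open>n\<close> on.
Lifts of generators of \<open>L 0, \<dots>, L n\<close> generate \<open>I\<close>, as they allow the leading term of any element of \<open>I\<close> to
be removed.\<close>

theorem hilbert_basis:
  assumes "noetherian_subring A" and "comm_subring B" and "A \<subseteq> B" "t \<in> B"
    and B: "B \<subseteq> (\<Union>m. power_span A t m)"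
  shows "noetherian_subring B"
proof -
  interpret A: noetherian_subring A by fact
  interpret B: comm_subring B by fact
  have "noetherian_ring B.R"
  proof (rule B.noetherian_ringI)
    fix I assume I: "ideal I B.R"
    note I' = B.ideal_add[OF I] B.ideal_mult[OF I] B.ideal_mem[OF I]
    define L where "L m = {a \<in> A. \<exists>p\<in>power_span A t m. a * t ^ m + p \<in> I}" for m
    have L_ideal: "ideal (L m) A.R" for m
      unfolding A.ideal_iff
    proof (intro conjI ballI)
      show "L m \<subseteq> A" by (auto simp: L_def)
      show "0 \<in> L m" using A.power_span_zero[of t m] I
        by (auto simp: L_def intro!: bexI[of _ 0])
      fix a b assume "a \<in> L m" "b \<in> L m"
      then obtain p q where *: "a \<in> A" "b \<in> A" "p \<in> power_span A t m" "q \<in> power_span A t m"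
        "a * t ^ m + p \<in> I" "b * t ^ m + q \<in> I" by (auto simp: L_def)
      have "(a + b) * t ^ m + (p + q) = (a * t ^ m + p) + (b * t ^ m + q)" by (simp add: algebra_simps)
      also have "\<dots> \<in> I" using * I' by blast
      finally show "a + b \<in> L m" using * A.power_span_add[of p t m q] unfolding L_def by blast
    next
      fix a b assume "a \<in> A" "b \<in> L m"
      then obtain p where *: "a \<in> A" "b \<in> A" "p \<in> power_span A t m" "b * t ^ m + p \<in> I"
        by (auto simp: L_def)
      have "(a * b) * t ^ m + a * p = a * (b * t ^ m + p)" by (simp add: algebra_simps)
      also have "\<dots> \<in> I" using * I' assms(3) by blast
      finally show "a * b \<in> L m" using * A.power_span_mult[of a p t m] unfolding L_def by blast
    qed
    have L_Suc: "L m \<subseteq> L (Suc m)" for m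
    proof
      fix a assume "a \<in> L m"
      then obtain p where *: "a \<in> A" "p \<in> power_span A t m" "a * t ^ m + p \<in> I" by (auto simp: L_def)
      have "a * t ^ Suc m + t * p = t * (a * t ^ m + p)" by (simp add: algebra_simps)
      also have "\<dots> \<in> I" using * I' assms(4) by blast
      finally show "a \<in> L (Suc m)" using * A.power_span_shift[of p t m] unfolding L_def by blast
    qed
    then have L_mono: "L m \<subseteq> L n" if "m \<le> n" for m n
      using that by (rule lift_Suc_mono_le)
    obtain M where "M \<in> range L" "\<And>I. I \<in> range L \<Longrightarrow> M \<subseteq> I \<Longrightarrow> I = M"
      by (rule A.maximal_ideal_in_family[of "range L" "L 0"]) (use L_ideal in auto)
    then obtain n where "M = L n" "\<And>m. M \<subseteq> L m \<Longrightarrow> L m = M" by blast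
    then have n: "L n \<subseteq> L m \<Longrightarrow> L m = L n" for m by simp
    have "\<exists>F. finite F \<and> F \<subseteq> A \<and> L m = genideal A.R F" for m
      by (rule A.fin_gen[OF L_ideal[of m]]) blast
    then obtain F where F: "\<And>m. finite (F m)" "\<And>m. F m \<subseteq> A" "\<And>m. L m = genideal A.R (F m)" by metis
    have FL: "F m \<subseteq> L m" for m using A.genideal_self[of "F m"] F by auto
    then have "\<forall>m. \<forall>a\<in>F m. \<exists>p\<in>power_span A t m. a * t ^ m + p \<in> I" unfolding L_def by blast
    then obtain p where p: "\<And>m a. a \<in> F m \<Longrightarrow> p m a \<in> power_span A t m \<and> a * t ^ m + p m a \<in> I" by metis
    define G where "G = (\<Union>m\<le>n. (\<lambda>a. a * t ^ m + p m a) ` F m)"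
    have G: "finite G" "G \<subseteq> I" using F p by (auto simp: G_def)
    then have GB: "G \<subseteq> B" using I' by blast
    have gG: "ideal (genideal B.R G) B.R" using B.genideal_ideal GB by simp
    have GgG: "G \<subseteq> genideal B.R G" using B.genideal_self[of G] GB by simp
    have gGI: "genideal B.R G \<subseteq> I" using B.genideal_minimal[OF I] G by simp
    have lead: "\<exists>g\<in>genideal B.R G. g - a * t ^ m \<in> power_span A t m" if a: "a \<in> L m" for a m
    proof -
      \<comment> \<open>Beyond \<open>n\<close> the generators in degree \<open>n\<close> are shifted by a power of \<open>t\<close>.\<close>
      define \<mu> where "\<mu> = min m n"
      have "L m = L \<mu>" using n[of m] L_mono[of n m] by (auto simp: \<mu>_def min_def)
      then have "a \<in> genideal A.R (F \<mu>)" using a F(3) by simp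
      also have "\<dots> \<subseteq> {a \<in> A. \<exists>g\<in>genideal B.R G. g - a * t ^ m \<in> power_span A t m}" (is "_ \<subseteq> ?J")
      proof (rule A.genideal_minimal)
        show "ideal ?J A.R"
          unfolding A.ideal_iff
        proof (intro conjI ballI)
          show "0 \<in> ?J" using B.ideal_zero[OF gG] A.power_span_zero by (auto intro!: bexI[of _ 0])
          fix a b assume "a \<in> ?J" "b \<in> ?J"
          then obtain g h where *: "a \<in> A" "b \<in> A" "g \<in> genideal B.R G" "h \<in> genideal B.R G"
            "g - a * t ^ m \<in> power_span A t m" "h - b * t ^ m \<in> power_span A t m" by blast
          have "(g + h) - (a + b) * t ^ m = (g - a * t ^ m) + (h - b * t ^ m)" by (simp add: algebra_simps)
          also have "\<dots> \<in> power_span A t m" using * A.power_span_add by blast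
          finally show "a + b \<in> ?J" using * B.ideal_add[OF gG *(3,4)] by auto
        next
          fix a b assume "a \<in> A" "b \<in> ?J"
          then obtain g where *: "a \<in> A" "b \<in> A" "g \<in> genideal B.R G"
            "g - b * t ^ m \<in> power_span A t m" by blast
          have "a * g - (a * b) * t ^ m = a * (g - b * t ^ m)" by (simp add: algebra_simps)
          also have "\<dots> \<in> power_span A t m" using * A.power_span_mult by blast
          finally show "a * b \<in> ?J" using * B.ideal_mult[OF gG _ *(3)] assms(3) by auto
        qed auto
        show "F \<mu> \<subseteq> ?J"
        proof
          fix a assume a: "a \<in> F \<mu>"
          let ?g = "t ^ (m - \<mu>) * (a * t ^ \<mu> + p \<mu> a)"
          have "a * t ^ \<mu> + p \<mu> a \<in> genideal B.R G"
          proof (rule subsetD[OF GgG])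
            have "\<mu> \<le> n" by (simp add: \<mu>_def)
            then show "a * t ^ \<mu> + p \<mu> a \<in> G" using a unfolding G_def by blast
          qed
          then have "?g \<in> genideal B.R G" using assms(4) by (intro B.ideal_mult[OF gG]) auto
          moreover have "t ^ (m - \<mu>) * t ^ \<mu> = t ^ m" by (simp add: \<mu>_def flip: power_add)
          then have "?g - a * t ^ m = t ^ (m - \<mu>) * p \<mu> a" by (simp add: algebra_simps)
          then have "?g - a * t ^ m \<in> power_span A t m"
            using A.power_span_shift_power[of "p \<mu> a" t \<mu> "m - \<mu>"] p[OF a] by (simp add: \<mu>_def)
          ultimately show "a \<in> ?J" using a F(2) by blast
        qed
      qed
      finally show ?thesis by blast
    qed
    have "f \<in> genideal B.R G" if "f \<in> I" "f \<in> power_span A t m" for f m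
      using that
    proof (induction m arbitrary: f)
      case (Suc m)
      then obtain a q where *: "f = a * t ^ m + q" "a \<in> A" "q \<in> power_span A t m"
        unfolding A.power_span_Suc by blast
      then have "a \<in> L m" using Suc.prems unfolding L_def by blast
      then obtain g where g: "g \<in> genideal B.R G" "g - a * t ^ m \<in> power_span A t m" using lead by blast
      have "f - g = q + - (g - a * t ^ m)" using * by simp
      also have "\<dots> \<in> power_span A t m" using * g A.power_span_add A.power_span_uminus by blast
      finally have "f - g \<in> power_span A t m" .
      moreover have "f - g \<in> I" using B.ideal_diff[OF I Suc.prems(1)] g(1) gGI by blast
      ultimately have "f - g \<in> genideal B.R G" using Suc.IH[of "f - g"] by blast
      then have "(f - g) + g \<in> genideal B.R G" using B.ideal_add[OF gG] g by blast
      then show ?case by simp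
    qed (use B.ideal_zero[OF gG] A.power_span_0 in auto)
    moreover have "\<exists>m. f \<in> power_span A t m" if "f \<in> I" for f using I'(3)[OF that] B by blast
    ultimately have "I = genideal B.R G" using gGI by blast
    then show "\<exists>G\<subseteq>carrier B.R. finite G \<and> I = genideal B.R G"
      using G(1) GB by (intro exI[of _ G]) simp
  qed
  then show ?thesis by (intro noetherian_subring.intro noetherian_subring_axioms.intro assms(2))
qed

section \<open>Polynomial rings\<close>

type_synonym ('v, 'k) mpoly = "('v \<Rightarrow>\<^sub>0 nat) \<Rightarrow>\<^sub>0 'k"

abbreviation (input) lookup :: "('a \<Rightarrow>\<^sub>0 'b::zero) \<Rightarrow> 'a \<Rightarrow> 'b" where "lookup \<equiv> Poly_Mapping.lookup"
abbreviation (input) keys :: "('a \<Rightarrow>\<^sub>0 'b::zero) \<Rightarrow> 'a set" where "keys \<equiv> Poly_Mapping.keys"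
abbreviation (input) single :: "'a \<Rightarrow> 'b \<Rightarrow> ('a \<Rightarrow>\<^sub>0 'b::zero)" where "single \<equiv> Poly_Mapping.single"

definition polynomials :: "'v set \<Rightarrow> ('v, 'k::comm_ring_1) mpoly set" where
  "polynomials X = {p. \<forall>m\<in>keys p. keys m \<subseteq> X}"

lemma polynomial_ring_eq: "polynomial_ring X = ring_on (polynomials X)"
  by (simp add: polynomial_ring_def ring_on_def polynomials_def)

lemma keys_add_nat: "keys (s + t) = keys s \<union> keys (t :: 'v \<Rightarrow>\<^sub>0 nat)"
  by (auto simp: in_keys_iff lookup_add)

lemma keys_uminus [simp]: "keys (- p :: 'b \<Rightarrow>\<^sub>0 'k::ab_group_add) = keys p"
  by (auto simp: in_keys_iff)

lemma comm_subring_polynomials: "comm_subring (polynomials X)"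
proof
  fix p q :: "('a \<Rightarrow>\<^sub>0 nat) \<Rightarrow>\<^sub>0 'b" assume p: "p \<in> polynomials X" and q: "q \<in> polynomials X"
  show "p + q \<in> polynomials X"
    using p q Poly_Mapping.keys_add[of p q] by (auto simp: polynomials_def)
  show "p * q \<in> polynomials X"
    using p q Poly_Mapping.keys_mult[of p q] by (fastforce simp: polynomials_def keys_add_nat)
qed (auto simp: polynomials_def)

lemma single_in_polynomials: "keys t \<subseteq> X \<Longrightarrow> single t c \<in> polynomials X"
  by (auto simp: polynomials_def)

lemma poly_mapping_sum_single:
  "p = (\<Sum>t\<in>keys p. single t (lookup p t))"
proof (rule poly_mapping_eqI)
  fix k
  show "lookup p k =
    lookup (\<Sum>t\<in>keys p. single t (lookup p t)) k"
    by (simp add: lookup_sum lookup_single when_def in_keys_iff)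
qed

lemma times_single:
  fixes h :: "'b::comm_monoid_add \<Rightarrow>\<^sub>0 'k::comm_ring_1"
  shows "h * single s c =
    (\<Sum>t\<in>keys h. single (t + s) (lookup h t * c))"
  by (subst poly_mapping_sum_single[of h]) (simp add: sum_distrib_right mult_single)

lemma lookup_times_single:
  fixes h :: "'b::cancel_comm_monoid_add \<Rightarrow>\<^sub>0 'k::comm_ring_1"
  shows "lookup (h * single s c) (t + s) = lookup h t * c"
  by (simp add: times_single lookup_sum lookup_single when_def in_keys_iff)

lemma poly_var_power: "poly_var x ^ n = single (single x n) 1"
  by (induction n) (simp_all add: poly_var_def mult_single flip: single_add)

theorem noetherian_polynomials:
  assumes "finite X"
  shows "noetherian_subring (polynomials X :: ('v, 'k::field) mpoly set)"
  using assms
proof (induction X rule: finite_induct)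
  case empty
  interpret comm_subring "polynomials {} :: ('v, 'k::field) mpoly set"
    by (rule comm_subring_polynomials)
  have const: "\<exists>c. p = single 0 c" if "p \<in> polynomials {}" for p :: "('v \<Rightarrow>\<^sub>0 nat) \<Rightarrow>\<^sub>0 'k"
  proof
    have "keys p \<subseteq> {0}" using that by (auto simp: polynomials_def)
    then show "p = single 0 (lookup p 0)"
      by (intro poly_mapping_eqI) (auto simp: lookup_single when_def in_keys_iff)
  qed
  have "noetherian_ring R"
  proof (rule noetherian_ringI)
    fix I assume I: "ideal I R"
    show "\<exists>F\<subseteq>carrier R. finite F \<and> I = genideal R F"
    proof (cases "I \<subseteq> {0}")
      case True
      then have "I = genideal R {}" using ideal_zero[OF I] genideal_empty by auto
      then show ?thesis by (intro exI[of _ "{}"]) simp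
    next
      case False
      then obtain p where p: "p \<in> I" "p \<noteq> 0" by blast
      then obtain c where c: "p = single 0 c" using const ideal_mem[OF I] by blast
      moreover have "c \<noteq> 0" using p(2) c by auto
      ultimately have "single 0 (inverse c) * p = 1" by (simp add: mult_single)
      then have "1 \<in> I"
        using ideal_mult[OF I single_in_polynomials p(1), of 0 "inverse c"] by simp
      then have "I = polynomials {}" by (rule ideal_one[OF I])
      also have "\<dots> = genideal R {1}"
        using ideal_one[OF genideal_ideal[of "{1}"]] genideal_self[of "{1}"] by simp
      finally have "I = genideal R {1}" .
      then show ?thesis by (intro exI[of _ "{1}"]) simp
    qed
  qed
  then show ?case
    by (intro noetherian_subring.intro noetherian_subring_axioms.intro comm_subring_axioms)
next
  case (insert x X)
  interpret A: comm_subring "polynomials X :: ('v, 'k::field) mpoly set"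
    by (rule comm_subring_polynomials)
  have span: "single t c \<in> (\<Union>m. power_span (polynomials X) (poly_var x) m)"
    if t: "keys t \<subseteq> insert x X" for t and c :: 'k
  proof -
    define k where "k = lookup t x"
    define s where "s = t - single x k"
    have "y \<in> X" if "y \<in> keys s" for y
    proof -
      have "y \<noteq> x" "y \<in> keys t"
        using that by (auto simp: s_def k_def in_keys_iff lookup_minus lookup_single when_def split: if_splits)
      then show ?thesis using t by blast
    qed
    then have "keys s \<subseteq> X" by blast
    then have "single s c \<in> polynomials X" by (rule single_in_polynomials)
    moreover have "t = s + single x k"
      by (rule poly_mapping_eqI) (auto simp: s_def k_def lookup_add lookup_minus lookup_single when_def)
    then have "single t c = single s c * poly_var x ^ k + 0"
      by (simp add: poly_var_power mult_single)
    ultimately have "single t c \<in> power_span (polynomials X) (poly_var x) (Suc k)"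
      unfolding A.power_span_Suc using A.power_span_zero by blast
    then show ?thesis by blast
  qed
  have sum: "sum f T \<in> (\<Union>m. power_span (polynomials X) (poly_var x) m)"
    if "finite T" "\<And>i. i \<in> T \<Longrightarrow> f i \<in> (\<Union>m. power_span (polynomials X) (poly_var x) m)"
    for f :: "('v \<Rightarrow>\<^sub>0 nat) \<Rightarrow> ('v, 'k) mpoly" and T
    using that
  proof (induction T rule: finite_induct)
    case (insert i T)
    then obtain m n where mn: "f i \<in> power_span (polynomials X) (poly_var x) m"
      "sum f T \<in> power_span (polynomials X) (poly_var x) n" by blast
    then have "f i + sum f T \<in> power_span (polynomials X) (poly_var x) (max m n)"
      using A.power_span_mono[of m "max m n"] A.power_span_mono[of n "max m n"]
      by (intro A.power_span_add) auto
    then show ?case using insert.hyps by auto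
  qed (use A.power_span_zero in auto)
  show ?case
  proof (rule hilbert_basis[OF insert.IH comm_subring_polynomials])
    show "(polynomials X :: ('v, 'k) mpoly set) \<subseteq> polynomials (insert x X)" by (auto simp: polynomials_def)
    show "(poly_var x :: ('v \<Rightarrow>\<^sub>0 nat) \<Rightarrow>\<^sub>0 'k) \<in> polynomials (insert x X)"
      unfolding poly_var_def by (rule single_in_polynomials) simp
    show "(polynomials (insert x X) :: ('v, 'k) mpoly set)
        \<subseteq> (\<Union>m. power_span (polynomials X) (poly_var x) m)"
    proof (rule subsetI)
      fix p :: "('v \<Rightarrow>\<^sub>0 nat) \<Rightarrow>\<^sub>0 'k" assume p: "p \<in> polynomials (insert x X)"
      have "(\<Sum>t\<in>keys p. single t (lookup p t))
          \<in> (\<Union>m. power_span (polynomials X) (poly_var x) m)"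
      proof (rule sum)
        fix t assume "t \<in> keys p"
        then show "single t (lookup p t)
            \<in> (\<Union>m. power_span (polynomials X) (poly_var x) m)"
          using p by (intro span) (simp add: polynomials_def)
      qed simp
      then show "p \<in> (\<Union>m. power_span (polynomials X) (poly_var x) m)"
        by (simp only: poly_mapping_sum_single[of p, symmetric])
    qed
  qed
qed

section \<open>Initial forms\<close>

text \<open>The initial form of \<open>g i\<close> with respect to the weight \<open>\<omega>\<close> is the monomial \<open>m i\<close>. Since these
monomials are pairwise coprime, the \<open>g i\<close> inherit from them that they form a regular sequence, and, if
the monomials are squarefree, that they generate a radical ideal.\<close>

locale initial_monomials = comm_subring "polynomials X :: ('v, 'k::comm_ring_1) mpoly set"
  for X :: "'v set" +
  fixes \<omega> :: "('v \<Rightarrow>\<^sub>0 nat) \<Rightarrow> nat" and I :: "'i set"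
    and g :: "'i \<Rightarrow> ('v, 'k::comm_ring_1) mpoly" and m :: "'i \<Rightarrow> ('v \<Rightarrow>\<^sub>0 nat)"
  assumes weight_add: "\<omega> (s + t) = \<omega> s + \<omega> t"
    and fin: "finite I"
    and g_mem: "i \<in> I \<Longrightarrow> g i \<in> polynomials X"
    and m_mem: "i \<in> I \<Longrightarrow> keys (m i) \<subseteq> X"
    and initial: "i \<in> I \<Longrightarrow> t \<in> keys (g i - single (m i) 1) \<Longrightarrow> \<omega> t < \<omega> (m i)"
    and disjoint: "i \<in> I \<Longrightarrow> j \<in> I \<Longrightarrow> i \<noteq> j \<Longrightarrow> keys (m i) \<inter> keys (m j) = {}"
begin

abbreviation "A \<equiv> polynomials X :: ('v, 'k) mpoly set"

text \<open>The inequality is strict so that \<open>low 0\<close> contains only the zero polynomial; this is the base of the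
inductions on \<open>W\<close>.\<close>

definition low :: "nat \<Rightarrow> ('v, 'k) mpoly set" where
  "low W = {f. \<forall>t\<in>keys f. \<omega> t < W}"

definition gen :: "'i set \<Rightarrow> ('v, 'k) mpoly set" where
  "gen J = genideal R (g ` J)"

definition top_divisible :: "'i set \<Rightarrow> nat \<Rightarrow> ('v, 'k) mpoly \<Rightarrow> bool" where
  "top_divisible J W f \<longleftrightarrow> (\<forall>t\<in>keys f. \<omega> t = W \<longrightarrow> (\<exists>i\<in>J. \<exists>u. t = m i + u))"

lemma low_0: "low 0 = {0}"
  by (auto simp: low_def)

lemma low_zero [simp]: "0 \<in> low W"
  by (simp add: low_def)

lemma low_mono: "f \<in> low V \<Longrightarrow> V \<le> W \<Longrightarrow> f \<in> low W"
  by (fastforce simp: low_def)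

lemma low_add: "f \<in> low W \<Longrightarrow> h \<in> low W \<Longrightarrow> f + h \<in> low W"
  using Poly_Mapping.keys_add[of f h] by (auto simp: low_def)

lemma low_uminus: "f \<in> low W \<Longrightarrow> - f \<in> low W"
  by (auto simp: low_def)

lemma low_diff: "f \<in> low W \<Longrightarrow> h \<in> low W \<Longrightarrow> f - h \<in> low W"
  using low_add[of f W "- h"] low_uminus by simp

lemma low_sum: "(\<And>i. i \<in> T \<Longrightarrow> f i \<in> low W) \<Longrightarrow> sum f T \<in> low W"
  by (induction T rule: infinite_finite_induct) (auto intro: low_add)

lemma low_mult: "f \<in> low (Suc V) \<Longrightarrow> h \<in> low W \<Longrightarrow> f * h \<in> low (V + W)"
  using Poly_Mapping.keys_mult[of f h] by (fastforce simp: low_def weight_add)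

lemma lookup_low: "f \<in> low W \<Longrightarrow> W \<le> \<omega> t \<Longrightarrow> lookup f t = 0"
  by (auto simp: low_def in_keys_iff not_le[symmetric])

lemma single_low: "\<omega> t < W \<Longrightarrow> single t c \<in> low W"
  by (auto simp: low_def)

lemma tail_low: "i \<in> I \<Longrightarrow> g i - single (m i) 1 \<in> low (\<omega> (m i))"
  using initial by (auto simp: low_def)

lemma g_low: "i \<in> I \<Longrightarrow> g i \<in> low (Suc (\<omega> (m i)))"
  using low_add[OF low_mono[OF tail_low] single_low, of i "Suc (\<omega> (m i))" "m i" 1] by simp

lemma gen_sub: "J \<subseteq> I \<Longrightarrow> g ` J \<subseteq> A"
  using g_mem by auto

lemma ideal_gen: "J \<subseteq> I \<Longrightarrow> ideal (gen J) R"
  unfolding gen_def using genideal_ideal gen_sub by simp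

lemma g_gen: "J \<subseteq> I \<Longrightarrow> i \<in> J \<Longrightarrow> g i \<in> gen J"
  unfolding gen_def using genideal_self[of "g ` J"] gen_sub by auto

lemma split_mult:
  "h * g j = h * single (m j) 1 + h * (g j - single (m j) 1)"
  by (simp add: algebra_simps)

lemma lookup_mult_top:
  assumes "h \<in> low (Suc W)" "j \<in> I" "\<omega> s = W + \<omega> (m j)"
  shows "lookup (h * g j) s = lookup (h * single (m j) 1) s"
  using lookup_low[OF low_mult[OF assms(1) tail_low[OF assms(2)]], of s] assms(3)
  by (subst split_mult) (simp add: lookup_add)

lemma keys_mult_top:
  assumes "h \<in> low (Suc W)" "j \<in> I" "t \<in> keys h" "\<omega> t = W"
  shows "t + m j \<in> keys (h * g j)"
  using assms lookup_mult_top[OF assms(1,2), of "t + m j"]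
  by (simp add: in_keys_iff weight_add lookup_times_single)

lemma top_mult_divisible:
  assumes "h \<in> low (Suc W)" "j \<in> I" "s \<in> keys (h * g j)" "\<omega> s = W + \<omega> (m j)"
  shows "\<exists>u. s = m j + u"
proof -
  have "s \<in> keys (h * single (m j) 1)"
    using assms lookup_mult_top[OF assms(1,2,4)] by (simp add: in_keys_iff)
  then show ?thesis
    using Poly_Mapping.keys_mult[of h "single (m j) 1"] by (auto simp: add.commute)
qed

text \<open>The monomial \<open>m j\<close> contains no variable of \<open>m i\<close> and cannot contribute to the divisibility.\<close>

lemma divides_cancel:
  assumes "i \<in> I" "j \<in> I" "i \<noteq> j" "t + m j = m i + u"
  shows "\<exists>v. t = m i + v"
proof
  show "t = m i + (t - m i)"
  proof (rule poly_mapping_eqI)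
    fix x
    have "x \<notin> keys (m i) \<or> x \<notin> keys (m j)" using disjoint assms by blast
    moreover have "lookup t x + lookup (m j) x =
        lookup (m i) x + lookup u x"
      using assms(4) by (metis lookup_add)
    ultimately show "lookup t x = lookup (m i + (t - m i)) x"
      by (auto simp: lookup_add lookup_minus in_keys_iff)
  qed
qed

text \<open>If \<open>t = m i + u\<close> is a term of top weight, then subtracting a multiple of \<open>u * g i\<close> replaces this term by
terms of smaller weight.\<close>

lemma reduce_top:
  assumes J: "J \<subseteq> I" and f: "f \<in> A" "f \<in> low (Suc W)" and div: "top_divisible J W f"
  obtains p where "p \<in> gen J" "f - p \<in> low W"
proof -
  define T where "T = {t \<in> keys f. \<omega> t = W}"
  define c where "c = lookup f"
  obtain i u where iu: "\<And>t. t \<in> T \<Longrightarrow> i t \<in> J \<and> t = m (i t) + u t"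
    using div unfolding top_divisible_def T_def by (metis (mono_tags, lifting) mem_Collect_eq)
  define p where "p = (\<Sum>t\<in>T. single (u t) (c t) * g (i t))"
  have "p \<in> gen J"
    unfolding p_def
  proof (rule ideal_sum[OF ideal_gen[OF J]])
    fix t assume t: "t \<in> T"
    then have "keys t \<subseteq> X" using f(1) by (auto simp: T_def polynomials_def)
    then have "keys (u t) \<subseteq> X" using iu[OF t] keys_add_nat[of "m (i t)" "u t"] by auto
    then show "single (u t) (c t) * g (i t) \<in> gen J"
      using iu[OF t] by (intro ideal_mult[OF ideal_gen[OF J]] single_in_polynomials g_gen[OF J]) auto
  qed
  moreover have "f - p \<in> low W"
  proof -
    have eq: "f - p = (f - (\<Sum>t\<in>T. single t (c t)))
        - (\<Sum>t\<in>T. single (u t) (c t) * (g (i t) - single (m (i t)) 1))"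
    proof -
      have "single (u t) (c t) * (g (i t) - single (m (i t)) 1)
          = single (u t) (c t) * g (i t) - single t (c t)" if "t \<in> T" for t
        using iu[OF that] by (simp add: algebra_simps mult_single)
      then show ?thesis unfolding p_def by (simp add: sum_subtractf)
    qed
    have "f - (\<Sum>t\<in>T. single t (c t)) \<in> low W"
    proof -
      have fT: "finite T" by (simp add: T_def)
      have "\<omega> s < W" if s: "s \<in> keys (f - (\<Sum>t\<in>T. single t (c t)))" for s
      proof -
        have "s \<in> keys f \<and> s \<notin> T"
          using s fT by (auto simp: in_keys_iff lookup_minus lookup_sum lookup_single when_def c_def T_def split: if_splits)
        then show ?thesis using f(2) by (auto simp: T_def low_def less_Suc_eq)
      qed
      then show ?thesis by (simp add: low_def)
    qed
    moreover have "(\<Sum>t\<in>T. single (u t) (c t) * (g (i t) - single (m (i t)) 1)) \<in> low W"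
    proof (rule low_sum)
      fix t assume t: "t \<in> T"
      then have "W = \<omega> (u t) + \<omega> (m (i t))"
        using iu[OF t] weight_add[of "m (i t)" "u t"] by (simp add: T_def)
      then show "single (u t) (c t) * (g (i t) - single (m (i t)) 1) \<in> low W"
        using low_mult[OF single_low tail_low, of "u t" "\<omega> (u t)" "i t" "c t"] iu[OF t] J by auto
    qed
    ultimately show ?thesis unfolding eq by (rule low_diff)
  qed
  ultimately show ?thesis using that by blast
qed

lemma gen_insert:
  assumes "insert j J \<subseteq> I" "f \<in> gen (insert j J)"
  obtains h where "h \<in> A" "f - h * g j \<in> gen J"
proof -
  have "f \<in> {r * g j + y |r y. r \<in> A \<and> y \<in> gen J}"
    using assms genideal_insert[of "g ` J" "g j"] gen_sub[of J] g_mem[of j] by (simp add: gen_def)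
  then show ?thesis using that by force
qed

text \<open>The initial forms of the elements of the ideal lie in the ideal of the monomials \<open>m i\<close>. By induction
on the generators, write \<open>f = h * g j + p\<close> with \<open>p\<close> in the ideal of the remaining ones. If \<open>h * g j\<close> has
larger weight than \<open>f\<close>, then its initial form cancels against that of \<open>p\<close>. Hence it is divisible by some
of the remaining \<open>m i\<close>, by coprimality so is the initial form of \<open>h\<close>, and the weight of \<open>h\<close> can be
lowered at the expense of \<open>p\<close>.\<close>

lemma top_divisible_gen:
  assumes "J \<subseteq> I" "f \<in> gen J" "f \<in> low (Suc W)"
  shows "top_divisible J W f"
proof -
  have "finite J" using assms(1) fin finite_subset by blast
  then show ?thesis using assms
  proof (induction J arbitrary: f W rule: finite_induct)
    case empty
    then have "f = 0" by (simp add: gen_def genideal_empty)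
    then show ?case by (simp add: top_divisible_def)
  next
    case (insert j J)
    have J: "J \<subseteq> I" "j \<in> I" using insert.prems by auto
    note iJ = ideal_gen[OF J(1)]
    have f: "f \<in> A" using ideal_mem[OF ideal_gen insert.prems(2)] insert.prems(1) by blast
    obtain h0 where h0: "h0 \<in> A" "f - h0 * g j \<in> gen J" using gen_insert insert.prems(1,2) by blast
    \<comment> \<open>The weight bound \<open>V0\<close> of the cofactor is lowered until \<open>h\<close> vanishes or \<open>h * g j\<close> has at most the weight of \<open>f\<close>.\<close>
    define V0 where "V0 = Suc (Max (insert 0 (\<omega> ` keys h0)))"
    have "h0 \<in> low V0" by (auto simp: low_def V0_def less_Suc_eq_le intro!: Max_ge)
    with h0 have "\<exists>h V. h \<in> A \<and> f - h * g j \<in> gen J \<and> h \<in> low V \<and> (V = 0 \<or> V + \<omega> (m j) \<le> Suc W)"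
    proof (induction V0 arbitrary: h0)
      case (Suc V)
      show ?case
      proof (cases "Suc V + \<omega> (m j) \<le> Suc W")
        case False
        then have "f \<in> low (V + \<omega> (m j))" using low_mono[OF insert.prems(3)] by simp
        moreover have "h0 * g j \<in> low (Suc (V + \<omega> (m j)))"
          using low_mult[OF Suc.prems(3) g_low[OF J(2)]] by simp
        ultimately have "f - h0 * g j \<in> low (Suc (V + \<omega> (m j)))" using low_mono[of f "V + \<omega> (m j)"] by (intro low_diff) auto
        then have top: "top_divisible J (V + \<omega> (m j)) (f - h0 * g j)"
          using insert.IH[OF J(1) Suc.prems(2)] by blast
        have "top_divisible J V h0"
          unfolding top_divisible_def
        proof (intro ballI impI)
          fix t assume t: "t \<in> keys h0" "\<omega> t = V"
          have "t + m j \<in> keys (h0 * g j)"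
            by (rule keys_mult_top[OF Suc.prems(3) J(2) t])
          moreover have w: "\<omega> (t + m j) = V + \<omega> (m j)" using t by (simp add: weight_add)
          moreover have "lookup f (t + m j) = 0"
            using lookup_low[OF \<open>f \<in> low (V + \<omega> (m j))\<close>] w by simp
          ultimately have "t + m j \<in> keys (f - h0 * g j)" by (simp add: in_keys_iff lookup_minus)
          then obtain i u where "i \<in> J" "t + m j = m i + u"
            using top w unfolding top_divisible_def by blast
          then show "\<exists>i\<in>J. \<exists>u. t = m i + u" using divides_cancel[of i j t u] J insert.hyps by blast
        qed
        then obtain p where p: "p \<in> gen J" "h0 - p \<in> low V"
          using reduce_top[OF J(1) Suc.prems(1,3)] by blast
        have "p \<in> A" using ideal_mem[OF iJ p(1)] .
        have "f - (h0 - p) * g j = (f - h0 * g j) + p * g j" by (simp add: algebra_simps)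
        also have "\<dots> \<in> gen J"
          using Suc.prems(2) ideal_mult'[OF iJ g_mem[OF J(2)] p(1)] by (rule ideal_add[OF iJ])
        finally show ?thesis using Suc.IH[of "h0 - p"] p Suc.prems(1) \<open>p \<in> A\<close> by blast
      qed (use Suc.prems in blast)
    qed blast
    then obtain h V where h: "h \<in> A" "f - h * g j \<in> gen J" "h \<in> low V" "V = 0 \<or> V + \<omega> (m j) \<le> Suc W" by blast
    have hg: "h * g j \<in> low (Suc W)"
    proof (cases V)
      case (Suc V')
      then show ?thesis
        using low_mult[of h V' "g j" "Suc (\<omega> (m j))"] g_low[OF J(2)] h low_mono by auto
    qed (use h low_0 in auto)
    then have top: "top_divisible J W (f - h * g j)"
      using insert.IH[OF J(1) h(2)] low_diff[OF insert.prems(3)] by blast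
    show ?case
      unfolding top_divisible_def
    proof (intro ballI impI)
      fix t assume t: "t \<in> keys f" "\<omega> t = W"
      show "\<exists>i\<in>insert j J. \<exists>u. t = m i + u"
      proof (cases "t \<in> keys (h * g j)")
        case True
        then have "h \<noteq> 0" by auto
        then obtain V' where V: "V = Suc V'" using h(3) low_0 by (cases V) auto
        have "h * g j \<in> low (Suc (V' + \<omega> (m j)))"
          using low_mult[of h V' "g j" "Suc (\<omega> (m j))"] g_low[OF J(2)] h(3) V by simp
        then have "W < Suc (V' + \<omega> (m j))" using True t(2) by (auto simp: low_def)
        then have "W = V' + \<omega> (m j)" using h(4) V by simp
        then show ?thesis using top_mult_divisible[of h V' j t] h(3) V J(2) True t by blast
      next
        case False
        then have "t \<in> keys (f - h * g j)" using t by (simp add: in_keys_iff lookup_minus)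
        then show ?thesis using top t unfolding top_divisible_def by blast
      qed
    qed
  qed
qed

lemma low_bound: obtains W where "f \<in> low W"
proof
  show "f \<in> low (Suc (Max (insert 0 (\<omega> ` keys f))))"
    by (auto simp: low_def less_Suc_eq_le intro!: Max_ge)
qed

text \<open>The initial form of \<open>h * g j\<close> is that of \<open>h\<close> times \<open>m j\<close>. So the initial form of \<open>h\<close> is divisible by
monomials \<open>m i\<close> with \<open>i \<in> J\<close>, and \<open>h\<close> is reduced to smaller weight modulo the ideal until it vanishes.\<close>

theorem regular:
  assumes J: "J \<subseteq> I" "j \<in> I - J" and h: "h \<in> A" "h * g j \<in> gen J"
  shows "h \<in> gen J"
proof -
  note iJ = ideal_gen[OF J(1)]
  have j: "j \<in> I" "j \<notin> J" using J(2) by auto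
  obtain W where "h \<in> low W" by (rule low_bound)
  then show ?thesis using h
  proof (induction W arbitrary: h)
    case 0
    then show ?case using low_0 ideal_zero[OF iJ] by auto
  next
    case (Suc W)
    have "top_divisible J W h"
      unfolding top_divisible_def
    proof (intro ballI impI)
      fix t assume t: "t \<in> keys h" "\<omega> t = W"
      have "h * g j \<in> low (Suc (W + \<omega> (m j)))" using low_mult[OF Suc.prems(1) g_low[OF j(1)]] by simp
      then have "top_divisible J (W + \<omega> (m j)) (h * g j)" by (rule top_divisible_gen[OF J(1) Suc.prems(3)])
      moreover have "t + m j \<in> keys (h * g j)" by (rule keys_mult_top[OF Suc.prems(1) j(1) t])
      ultimately obtain i u where "i \<in> J" "t + m j = m i + u"
        using t by (auto simp: top_divisible_def weight_add)
      then show "\<exists>i\<in>J. \<exists>u. t = m i + u" using divides_cancel[of i j t u] J by blast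
    qed
    then obtain p where p: "p \<in> gen J" "h - p \<in> low W"
      using reduce_top[OF J(1) Suc.prems(2,1)] by blast
    have "(h - p) * g j = h * g j - p * g j" by (simp add: algebra_simps)
    also have "\<dots> \<in> gen J"
      using Suc.prems(3) ideal_mult'[OF iJ g_mem[OF j(1)] p(1)] by (rule ideal_diff[OF iJ])
    finally have "h - p \<in> gen J"
      using Suc.IH[OF p(2)] Suc.prems(2) ideal_mem[OF iJ p(1)] by blast
    then have "(h - p) + p \<in> gen J" using p(1) ideal_add[OF iJ] by blast
    then show ?case by simp
  qed
qed

end

locale squarefree_initial_monomials = initial_monomials X \<omega> I g m
  for X :: "'v::linorder set" and \<omega> and I :: "'i set"
    and g :: "'i \<Rightarrow> ('v, 'k::idom) mpoly" and m +
  assumes squarefree: "i \<in> I \<Longrightarrow> lookup (m i) x \<le> 1"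
begin

text \<open>Suppose that some monomial \<open>t\<close> of top weight in \<open>f\<close> is divisible by no \<open>m i\<close>. As \<open>m i\<close> is squarefree, it
contains a variable \<open>x i\<close> that does not occur in \<open>t\<close>. Let \<open>p\<close> be the sum of the terms of top weight in \<open>f\<close>
without any of the variables \<open>x i\<close>. The monomials of \<open>p * p\<close> survive in \<open>f * f\<close>, where the monomials of top
weight are divisible by some \<open>m i\<close> and thus contain \<open>x i\<close>; but \<open>p * p\<close> is not zero. So all terms of top
weight in \<open>f\<close> can be removed modulo the ideal.\<close>

lemma radical_square:
  assumes "f \<in> A" "f * f \<in> gen I"
  shows "f \<in> gen I"
proof -
  note iI = ideal_gen[OF order_refl]
  obtain W where "f \<in> low W" by (rule low_bound)
  then show ?thesis using assms
  proof (induction W arbitrary: f)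
    case 0
    then show ?case using low_0 ideal_zero[OF iI] by auto
  next
    case (Suc W)
    have "top_divisible I W f"
      unfolding top_divisible_def
    proof (intro ballI impI)
      fix t assume t: "t \<in> keys f" "\<omega> t = W"
      show "\<exists>i\<in>I. \<exists>u. t = m i + u"
      proof (rule ccontr)
        assume not: "\<not> ?thesis"
        have "\<exists>x. x \<in> keys (m i) \<and> x \<notin> keys t" if i: "i \<in> I" for i
        proof (rule ccontr)
          assume sub: "\<nexists>x. x \<in> keys (m i) \<and> x \<notin> keys t"
          have "t = m i + (t - m i)"
          proof (rule poly_mapping_eqI)
            fix x
            have "lookup (m i) x \<noteq> 0 \<Longrightarrow> lookup t x \<noteq> 0"
              using sub unfolding in_keys_iff by blast
            then have "lookup (m i) x \<le> lookup t x"
              using squarefree[OF i, of x] by linarith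
            then show "lookup t x = lookup (m i + (t - m i)) x"
              by (simp add: lookup_add lookup_minus)
          qed
          with not i show False by blast
        qed
        then obtain x where x: "\<And>i. i \<in> I \<Longrightarrow> x i \<in> keys (m i) \<and> x i \<notin> keys t"
          by metis
        define T where "T = x ` I"
        define K where "K = {s \<in> keys f. \<omega> s = W \<and> keys s \<inter> T = {}}"
        define p where "p = (\<Sum>s\<in>K. single s (lookup f s))"
        have fK: "finite K" by (simp add: K_def)
        have lookup_p: "lookup p s = (if s \<in> K then lookup f s else 0)" for s
          using fK by (simp add: p_def lookup_sum lookup_single when_def)
        have "t \<in> K" using t x by (auto simp: K_def T_def)
        then have "lookup p t \<noteq> 0" using t by (simp add: lookup_p in_keys_iff)
        then have "p * p \<noteq> 0" by auto
        then obtain s where s: "s \<in> keys (p * p)" by (metis ex_in_conv keys_eq_empty)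
        have keys_p: "a \<in> K" if "a \<in> keys p" for a
          using that by (auto simp: in_keys_iff lookup_p split: if_splits)
        have sW: "\<omega> s = W + W" and sT: "keys s \<inter> T = {}"
          using Poly_Mapping.keys_mult[of p p] s keys_p by (force simp: K_def weight_add keys_add_nat)+
        have fp: "\<omega> b < W \<or> keys b \<inter> T \<noteq> {}" if "b \<in> keys (f - p)" for b
        proof -
          have "b \<in> keys f" "b \<notin> K"
            using that by (auto simp: in_keys_iff lookup_minus lookup_p split: if_splits)
          then show ?thesis using Suc.prems(1) by (auto simp: K_def low_def less_Suc_eq)
        qed
        have "s \<notin> keys ((f + p) * (f - p))"
        proof
          assume "s \<in> keys ((f + p) * (f - p))"
          then obtain a b where ab: "s = a + b" "a \<in> keys (f + p)" "b \<in> keys (f - p)"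
            using Poly_Mapping.keys_mult[of "f + p" "f - p"] by blast
          have "a \<in> keys f"
            using ab(2) keys_p Poly_Mapping.keys_add[of f p] by (auto simp: K_def)
          then have "\<omega> a \<le> W" using Suc.prems(1) by (auto simp: low_def less_Suc_eq_le)
          moreover have "\<omega> a + \<omega> b = W + W" using sW ab(1) weight_add by simp
          ultimately have "\<not> \<omega> b < W" by linarith
          moreover have "keys b \<inter> T = {}" using sT ab(1) by (auto simp: keys_add_nat)
          ultimately show False using fp[OF ab(3)] by blast
        qed
        moreover have "f * f = p * p + (f + p) * (f - p)" by (simp add: algebra_simps)
        ultimately have "s \<in> keys (f * f)"
          using s by (simp add: in_keys_iff lookup_add)
        moreover have "f * f \<in> low (Suc (W + W))" using low_mult[OF Suc.prems(1,1)] by simp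
        then have "top_divisible I (W + W) (f * f)" by (rule top_divisible_gen[OF order_refl Suc.prems(3)])
        ultimately obtain i u where "i \<in> I" "s = m i + u" using sW unfolding top_divisible_def by blast
        then have "x i \<in> keys s \<inter> T" using x by (auto simp: T_def keys_add_nat)
        then show False using sT by blast
      qed
    qed
    then obtain p where p: "p \<in> gen I" "f - p \<in> low W"
      using reduce_top[OF order_refl Suc.prems(2,1)] by blast
    have pA: "p \<in> A" using ideal_mem[OF iI p(1)] .
    have "(f - p) * (f - p) = f * f - (f + f - p) * p" by (simp add: algebra_simps)
    also have "\<dots> \<in> gen I"
    proof (rule ideal_diff[OF iI Suc.prems(3)])
      show "(f + f - p) * p \<in> gen I"
        by (intro ideal_mult[OF iI _ p(1)] diff_mem add_mem Suc.prems(2) pA)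
    qed
    finally have "f - p \<in> gen I" using Suc.IH[OF p(2)] Suc.prems(2) pA by blast
    then have "(f - p) + p \<in> gen I" using p(1) ideal_add[OF iI] by blast
    then show ?case by simp
  qed
qed

theorem radical:
  assumes "f \<in> A" "f ^ k \<in> gen I"
  shows "f \<in> gen I"
proof -
  note iI = ideal_gen[OF order_refl]
  have "f ^ 2 ^ k \<in> gen I"
  proof -
    have "k \<le> 2 ^ k" by (simp add: less_imp_le)
    then have "f ^ 2 ^ k = f ^ (2 ^ k - k) * f ^ k" by (simp flip: power_add)
    then show ?thesis using assms by (auto intro!: ideal_mult[OF iI])
  qed
  then show ?thesis
  proof (induction k)
    case (Suc k)
    have eq: "f ^ 2 ^ Suc k = f ^ 2 ^ k * f ^ 2 ^ k" by (simp add: mult_2 power_add)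
    have "f ^ 2 ^ k \<in> gen I"
      using radical_square[OF power_mem[OF assms(1)], of "2 ^ k"] Suc.prems[unfolded eq] by blast
    then show ?case by (rule Suc.IH)
  qed simp
qed

end

section \<open>Localization at a prime ideal\<close>

locale localized_subring = noetherian_subring +
  fixes P
  assumes P: "primeideal P R"
begin

abbreviation "L \<equiv> localization_at R P"
abbreviation "lfrac \<equiv> loc_frac R (A - P)"

lemma L_def: "L = localization R (A - P)"
  by (simp add: localization_at_def)

sublocale loc: cring_mult_set R "A - P"
proof (intro cring_mult_set.intro submonoid.intro is_cring)
  show "x \<otimes>\<^bsub>R\<^esub> y \<in> A - P" if "x \<in> A - P" "y \<in> A - P" for x y
    using compl_prime_mult[OF P that] by simp
  show "\<one>\<^bsub>R\<^esub> \<in> A - P" using one_compl_prime[OF P] by simp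
qed auto

sublocale L: cring L
  by (rule localization_at_cring[OF P])

lemma one_S: "1 \<in> A - P"
  by (rule one_compl_prime[OF P])

lemma mult_S: "s \<in> A - P \<Longrightarrow> t \<in> A - P \<Longrightarrow> s * t \<in> A - P"
  by (rule compl_prime_mult[OF P])

lemma lfrac_closed: "a \<in> A \<Longrightarrow> s \<in> A - P \<Longrightarrow> lfrac a s \<in> carrier L"
  using loc.loc_frac_closed[of a s] by (simp add: L_def)

lemma lfracE:
  assumes "x \<in> carrier L"
  obtains a s where "a \<in> A" "s \<in> A - P" "x = lfrac a s"
  using loc.localizationE[of x] assms by (auto simp: L_def)

lemma lfrac_mult:
  "a \<in> A \<Longrightarrow> b \<in> A \<Longrightarrow> s \<in> A - P \<Longrightarrow> t \<in> A - P \<Longrightarrow>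
    lfrac a s \<otimes>\<^bsub>L\<^esub> lfrac b t = lfrac (a * b) (s * t)"
  using loc.loc_frac_mult[of a b s t] by (simp add: L_def)

lemma lfrac_add:
  "a \<in> A \<Longrightarrow> b \<in> A \<Longrightarrow> s \<in> A - P \<Longrightarrow> t \<in> A - P \<Longrightarrow>
    lfrac a s \<oplus>\<^bsub>L\<^esub> lfrac b t = lfrac (a * t + b * s) (s * t)"
  using loc.loc_frac_add[of a b s t] by (simp add: L_def)

lemma lfrac_one: "\<one>\<^bsub>L\<^esub> = lfrac 1 1"
  using loc.loc_frac_one by (simp add: L_def)

lemma lfrac_zero: "\<zero>\<^bsub>L\<^esub> = lfrac 0 1"
  using loc.loc_frac_zero by (simp add: L_def)

lemma lfrac_eq_iff:
  "a \<in> A \<Longrightarrow> b \<in> A \<Longrightarrow> s \<in> A - P \<Longrightarrow> t \<in> A - P \<Longrightarrow>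
    lfrac a s = lfrac b t \<longleftrightarrow> (\<exists>u\<in>A - P. u * (a * t) = u * (b * s))"
  using loc.loc_frac_eq_iff[of a b s t] by simp

lemma lfrac_eqI:
  assumes "a \<in> A" "b \<in> A" "s \<in> A - P" "t \<in> A - P" "a * t = b * s"
  shows "lfrac a s = lfrac b t"
proof -
  have "1 * (a * t) = 1 * (b * s)" using assms(5) by simp
  then show ?thesis unfolding lfrac_eq_iff[OF assms(1-4)] using one_S by blast
qed

definition contraction :: "('a \<times> 'a) set set \<Rightarrow> 'a set" where
  "contraction \<QQ> = {a \<in> A. lfrac a 1 \<in> \<QQ>}"

definition extension :: "'a set \<Rightarrow> ('a \<times> 'a) set set" where
  "extension Q = {lfrac a s |a s. a \<in> Q \<and> s \<in> A - P}"

lemma lfrac_in_ideal_iff: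
  assumes "ideal \<QQ> L" "a \<in> A" "s \<in> A - P"
  shows "lfrac a s \<in> \<QQ> \<longleftrightarrow> a \<in> contraction \<QQ>"
proof
  interpret Q: ideal \<QQ> L by fact
  have sA: "s \<in> A" using assms(3) by blast
  have eq1: "lfrac s 1 \<otimes>\<^bsub>L\<^esub> lfrac a s = lfrac a 1"
    unfolding lfrac_mult[OF sA assms(2) one_S assms(3)]
    using assms sA mult_S[OF one_S assms(3)] one_S by (intro lfrac_eqI) (auto simp: algebra_simps)
  have eq2: "lfrac 1 s \<otimes>\<^bsub>L\<^esub> lfrac a 1 = lfrac a s"
    unfolding lfrac_mult[OF one_mem assms(2) assms(3) one_S] by simp
  show "a \<in> contraction \<QQ>" if "lfrac a s \<in> \<QQ>"
    using Q.I_l_closed[OF that lfrac_closed[OF sA one_S]] eq1 assms(2) by (simp add: contraction_def)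
  show "lfrac a s \<in> \<QQ>" if "a \<in> contraction \<QQ>"
    using Q.I_l_closed[OF _ lfrac_closed[OF one_mem assms(3)], of "lfrac a 1"] that eq2
    by (simp add: contraction_def)
qed

lemma contraction_ideal:
  assumes "ideal \<QQ> L"
  shows "ideal (contraction \<QQ>) R"
  unfolding ideal_iff
proof (intro conjI ballI)
  interpret Q: ideal \<QQ> L by fact
  show "contraction \<QQ> \<subseteq> A" by (auto simp: contraction_def)
  show "0 \<in> contraction \<QQ>" using Q.zero_closed by (simp add: contraction_def lfrac_zero)
  show "x + y \<in> contraction \<QQ>" if xy: "x \<in> contraction \<QQ>" "y \<in> contraction \<QQ>" for x y
  proof -
    have *: "x \<in> A" "y \<in> A" "lfrac x 1 \<in> \<QQ>" "lfrac y 1 \<in> \<QQ>" using xy by (simp_all add: contraction_def)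
    have "lfrac x 1 \<oplus>\<^bsub>L\<^esub> lfrac y 1 \<in> \<QQ>" using *(3,4) by (rule Q.a_closed)
    then show ?thesis
      unfolding lfrac_add[OF *(1,2) one_S one_S] using *(1,2) by (auto simp: contraction_def)
  qed
  show "a * x \<in> contraction \<QQ>" if ax: "a \<in> A" "x \<in> contraction \<QQ>" for a x
  proof -
    have *: "x \<in> A" "lfrac x 1 \<in> \<QQ>" using ax by (simp_all add: contraction_def)
    have "lfrac a 1 \<otimes>\<^bsub>L\<^esub> lfrac x 1 \<in> \<QQ>" using *(2) lfrac_closed[OF ax(1) one_S] by (rule Q.I_l_closed)
    then show ?thesis
      unfolding lfrac_mult[OF ax(1) *(1) one_S one_S] using *(1) ax(1) by (auto simp: contraction_def)
  qed
qed

lemma contraction_prime: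
  assumes "primeideal \<QQ> L"
  shows "primeideal (contraction \<QQ>) R" "contraction \<QQ> \<subseteq> P"
proof -
  interpret Q: primeideal \<QQ> L by fact
  have one: "lfrac 1 1 \<notin> \<QQ>"
    using Q.one_imp_carrier Q.I_notcarr lfrac_one by metis
  show "primeideal (contraction \<QQ>) R"
    unfolding primeideal_iff
  proof (intro conjI ballI impI)
    show "1 \<notin> contraction \<QQ>" using one by (simp add: contraction_def)
    show "a \<in> contraction \<QQ> \<or> b \<in> contraction \<QQ>"
      if ab: "a \<in> A" "b \<in> A" "a * b \<in> contraction \<QQ>" for a b
    proof -
      have "lfrac a 1 \<otimes>\<^bsub>L\<^esub> lfrac b 1 \<in> \<QQ>"
        unfolding lfrac_mult[OF ab(1,2) one_S one_S] using ab(3) by (simp add: contraction_def)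
      then have "lfrac a 1 \<in> \<QQ> \<or> lfrac b 1 \<in> \<QQ>"
        by (rule Q.I_prime[OF lfrac_closed[OF ab(1) one_S] lfrac_closed[OF ab(2) one_S]])
      then show ?thesis using ab(1,2) by (simp add: contraction_def)
    qed
  qed (rule contraction_ideal[OF Q.is_ideal])
  show "contraction \<QQ> \<subseteq> P"
  proof
    fix s assume s: "s \<in> contraction \<QQ>"
    show "s \<in> P"
    proof (rule ccontr)
      assume "s \<notin> P"
      then have sS: "s \<in> A - P" using s by (auto simp: contraction_def)
      then have "lfrac s s \<in> \<QQ>" using lfrac_in_ideal_iff[OF Q.is_ideal] s by blast
      moreover have "lfrac s s = lfrac 1 1" using sS one_S by (intro lfrac_eqI) auto
      ultimately show False using one by simp
    qed
  qed
qed

lemma extension_contraction: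
  assumes "ideal \<QQ> L"
  shows "extension (contraction \<QQ>) = \<QQ>"
proof
  show "extension (contraction \<QQ>) \<subseteq> \<QQ>"
    using lfrac_in_ideal_iff[OF assms] by (auto simp: extension_def contraction_def)
  show "\<QQ> \<subseteq> extension (contraction \<QQ>)"
  proof
    fix x assume x: "x \<in> \<QQ>"
    then have "x \<in> carrier L" using additive_subgroup.a_subset[OF ideal.axioms(1)[OF assms]] by blast
    then obtain a s where "a \<in> A" "s \<in> A - P" "x = lfrac a s" by (rule lfracE)
    with x show "x \<in> extension (contraction \<QQ>)"
      using lfrac_in_ideal_iff[OF assms] unfolding extension_def by blast
  qed
qed

lemma lfrac_in_extension_iff:
  assumes Q: "primeideal Q R" "Q \<subseteq> P" and a: "a \<in> A" "s \<in> A - P"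
  shows "lfrac a s \<in> extension Q \<longleftrightarrow> a \<in> Q"
proof
  assume "lfrac a s \<in> extension Q"
  then obtain b t where b: "b \<in> Q" "t \<in> A - P" "lfrac a s = lfrac b t" by (auto simp: extension_def)
  have bA: "b \<in> A" using ideal_mem[OF prime_ideal[OF Q(1)] b(1)] .
  obtain u where u: "u \<in> A - P" "u * (a * t) = u * (b * s)"
    using lfrac_eq_iff[OF a(1) bA a(2) b(2)] b(3) by blast
  have "u * (b * s) \<in> Q"
    using ideal_mult[OF prime_ideal[OF Q(1)], of "u * s" b] u a(2) b(1) by (auto simp: algebra_simps)
  then have "(u * t) * a \<in> Q" using u(2) by (simp add: algebra_simps)
  moreover have "u * t \<in> A - P" by (rule mult_S[OF u(1) b(2)])
  ultimately show "a \<in> Q" using prime_disj[OF Q(1), of "u * t" a] a(1) Q(2) by blast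
qed (use a in \<open>auto simp: extension_def\<close>)

lemma extension_prime:
  assumes Q: "primeideal Q R" "Q \<subseteq> P"
  shows "primeideal (extension Q) L" "contraction (extension Q) = Q"
proof -
  note iQ = prime_ideal[OF Q(1)] and iff = lfrac_in_extension_iff[OF Q]
  show "primeideal (extension Q) L"
  proof (rule primeidealI)
    show "ideal (extension Q) L"
    proof (rule L.ideal_of_closed)
      show "extension Q \<subseteq> carrier L" using lfrac_closed ideal_mem[OF iQ] by (auto simp: extension_def)
      show "\<zero>\<^bsub>L\<^esub> \<in> extension Q" unfolding lfrac_zero using iff[OF zero_mem one_S] ideal_zero[OF iQ] by blast
    next
      fix x y assume "x \<in> extension Q" "y \<in> extension Q"
      then obtain a s b t where *: "a \<in> Q" "s \<in> A - P" "x = lfrac a s" "b \<in> Q" "t \<in> A - P" "y = lfrac b t"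
        by (auto simp: extension_def)
      then have "a * t + b * s \<in> Q" using ideal_mult'[OF iQ] ideal_add[OF iQ] by auto
      moreover have "s * t \<in> A - P" by (rule mult_S[OF *(2,5)])
      moreover have "x \<oplus>\<^bsub>L\<^esub> y = lfrac (a * t + b * s) (s * t)"
        unfolding *(3,6) by (intro lfrac_add * ideal_mem[OF iQ])
      ultimately show "x \<oplus>\<^bsub>L\<^esub> y \<in> extension Q" unfolding extension_def by blast
    next
      fix x y assume "x \<in> carrier L" "y \<in> extension Q"
      then obtain a s b t where *: "a \<in> A" "s \<in> A - P" "x = lfrac a s" "b \<in> Q" "t \<in> A - P" "y = lfrac b t"
        by (auto simp: extension_def elim!: lfracE)
      then have "a * b \<in> Q" using ideal_mult[OF iQ] by auto
      moreover have "s * t \<in> A - P" by (rule mult_S[OF *(2,5)])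
      moreover have "x \<otimes>\<^bsub>L\<^esub> y = lfrac (a * b) (s * t)"
        unfolding *(3,6) by (intro lfrac_mult * ideal_mem[OF iQ *(4)])
      ultimately show "x \<otimes>\<^bsub>L\<^esub> y \<in> extension Q" unfolding extension_def by blast
    qed
    have "lfrac 1 1 \<in> carrier L" by (rule lfrac_closed[OF one_mem one_S])
    then show "carrier L \<noteq> extension Q" using iff[OF one_mem one_S] prime_one[OF Q(1)] by blast
    fix x y assume xy: "x \<in> carrier L" "y \<in> carrier L" "x \<otimes>\<^bsub>L\<^esub> y \<in> extension Q"
    from xy(1) obtain a s where a: "a \<in> A" "s \<in> A - P" "x = lfrac a s" by (rule lfracE)
    from xy(2) obtain b t where b: "b \<in> A" "t \<in> A - P" "y = lfrac b t" by (rule lfracE)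
    have "a * b \<in> Q"
      using xy(3) iff[OF mult_mem[OF a(1) b(1)] mult_S[OF a(2) b(2)]]
      unfolding a(3) b(3) lfrac_mult[OF a(1) b(1) a(2) b(2)] by blast
    then show "x \<in> extension Q \<or> y \<in> extension Q"
      using prime_disj[OF Q(1) a(1) b(1)] iff[OF a(1,2)] iff[OF b(1,2)] a(3) b(3) by blast
  qed (rule L.is_cring)
  show "contraction (extension Q) = Q"
    using iff[OF _ one_S] ideal_mem[OF iQ] by (auto simp: contraction_def)
qed

text \<open>Contraction and extension are mutually inverse, inclusion-preserving maps between the primes of the
localization and the primes contained in \<open>P\<close>.\<close>

lemma height_ge_localization:
  assumes "primeideal \<QQ> L"
  shows "height_ge L h \<QQ> \<longleftrightarrow> height_ge R h (contraction \<QQ>)"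
  using assms
proof (induction h arbitrary: \<QQ>)
  case 0
  then show ?case using contraction_prime by simp
next
  case (Suc h)
  note pQ = contraction_prime[OF Suc.prems]
  have ext: "extension (contraction \<QQ>) = \<QQ>" if "primeideal \<QQ> L" for \<QQ>
    using extension_contraction primeideal.axioms(1)[OF that] by blast
  show ?case
  proof
    assume "height_ge L (Suc h) \<QQ>"
    then obtain \<QQ>' where *: "\<QQ>' \<subset> \<QQ>" "height_ge L h \<QQ>'" by auto
    then have p: "primeideal \<QQ>' L" using height_ge_prime by blast
    have "contraction \<QQ>' \<subseteq> contraction \<QQ>" using *(1) by (auto simp: contraction_def)
    moreover have "contraction \<QQ>' \<noteq> contraction \<QQ>"
    proof
      assume "contraction \<QQ>' = contraction \<QQ>"
      then have "\<QQ>' = \<QQ>" using ext[OF p] ext[OF Suc.prems] by metis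
      then show False using *(1) by blast
    qed
    ultimately show "height_ge R (Suc h) (contraction \<QQ>)"
      unfolding height_ge.simps using Suc.IH[OF p] *(2) pQ(1) by blast
  next
    assume "height_ge R (Suc h) (contraction \<QQ>)"
    then obtain Q where *: "Q \<subset> contraction \<QQ>" "height_ge R h Q" by auto
    have Q: "primeideal Q R" "Q \<subseteq> P" using *(1) height_ge_prime[OF *(2)] pQ(2) by blast+
    note E = extension_prime[OF Q]
    have "extension Q \<subseteq> extension (contraction \<QQ>)" using *(1) unfolding extension_def by blast
    then have "extension Q \<subseteq> \<QQ>" using ext[OF Suc.prems] by simp
    moreover have "extension Q \<noteq> \<QQ>" using E(2) *(1) by blast
    ultimately show "height_ge L (Suc h) \<QQ>"
      unfolding height_ge.simps using Suc.IH[OF E(1)] unfolding E(2) using *(2) Suc.prems by blast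
  qed
qed

context
  fixes I
  assumes I: "ideal I R" and min: "minimal_prime R I P"
begin

abbreviation "I\<^sub>P \<equiv> ideal_localization_at R P I"

lemma I_P: "I \<subseteq> P"
  using min by (simp add: minimal_prime_def)

lemma lfrac_image_closed: "(\<lambda>a. lfrac a 1) ` I \<subseteq> carrier L"
  using lfrac_closed[OF _ one_S] ideal_mem[OF I] by auto

lemma I\<^sub>P_eq: "I\<^sub>P = genideal L ((\<lambda>a. lfrac a 1) ` I)"
  by (simp add: ideal_localization_at_def)

lemma ideal_I\<^sub>P: "ideal I\<^sub>P L"
  unfolding I\<^sub>P_eq by (rule L.genideal_ideal[OF lfrac_image_closed])

lemma lfrac_in_I\<^sub>P: "a \<in> I \<Longrightarrow> lfrac a 1 \<in> I\<^sub>P"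
  unfolding I\<^sub>P_eq using L.genideal_self[OF lfrac_image_closed] by blast

lemma contraction_over_I\<^sub>P:
  assumes "primeideal \<QQ> L" "I\<^sub>P \<subseteq> \<QQ>"
  shows "contraction \<QQ> = P"
proof -
  have "I \<subseteq> contraction \<QQ>"
    using lfrac_in_I\<^sub>P assms(2) ideal_mem[OF I] by (auto simp: contraction_def)
  then show ?thesis using min contraction_prime[OF assms(1)] by (auto simp: minimal_prime_def)
qed

lemma I\<^sub>P_extension: "I\<^sub>P \<subseteq> extension P"
  unfolding I\<^sub>P_eq
proof (rule L.genideal_minimal)
  show "ideal (extension P) L"
    using extension_prime(1)[OF P order_refl] by (rule primeideal.axioms(1))
  show "(\<lambda>a. lfrac a 1) ` I \<subseteq> extension P"
    using I_P one_S by (auto simp: extension_def)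
qed

lemma ideal_height_localization:
  assumes "height_ge R h P" "\<not> height_ge R (Suc h) P"
  shows "ideal_height L I\<^sub>P = enat h"
proof (rule antisym)
  note E = extension_prime[OF P order_refl]
  have "ideal_height L I\<^sub>P \<le> prime_height L (extension P)"
    unfolding ideal_height_def using E(1) I\<^sub>P_extension by (intro INF_lower) auto
  also have "\<dots> \<le> enat h"
    using assms(2) unfolding prime_height_le_iff[OF E(1)] height_ge_localization[OF E(1)] E(2) .
  finally show "ideal_height L I\<^sub>P \<le> enat h" .
  show "enat h \<le> ideal_height L I\<^sub>P"
  proof (rule ideal_height_geI)
    fix \<QQ> assume \<QQ>: "primeideal \<QQ> L" "I\<^sub>P \<subseteq> \<QQ>"
    show "height_ge L h \<QQ>"
      using height_ge_localization[OF \<QQ>(1)] contraction_over_I\<^sub>P[OF \<QQ>] assms(1) by simp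
  qed
qed

text \<open>If the fractions \<open>a b / s b\<close> generate \<open>I\<^sub>P\<close>, then \<open>P\<close> is minimal over the numerators \<open>a b\<close>, and Krull's
height theorem applies to them.\<close>

lemma min_generators_localization_ge:
  assumes "height_ge R h P"
  shows "enat h \<le> min_generators L I\<^sub>P"
  unfolding min_generators_def
proof (rule INF_greatest)
  fix B assume "B \<in> {B. finite B \<and> B \<subseteq> carrier L \<and> genideal L B = I\<^sub>P}"
  then have B: "finite B" "B \<subseteq> carrier L" "genideal L B = I\<^sub>P" by auto
  have "\<exists>a s. a \<in> A \<and> s \<in> A - P \<and> b = lfrac a s" if "b \<in> B" for b
    by (rule lfracE[of b]) (use that B(2) in auto)
  then obtain a s where as: "\<And>b. b \<in> B \<Longrightarrow> a b \<in> A \<and> s b \<in> A - P \<and> b = lfrac (a b) (s b)" by metis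
  have BI: "B \<subseteq> I\<^sub>P" using L.genideal_self[OF B(2)] B(3) by simp
  have "minimal_over P (a ` B)"
    unfolding minimal_prime_def
  proof (intro conjI allI impI)
    show "a ` B \<subseteq> P"
    proof clarify
      fix b assume b: "b \<in> B"
      then have "lfrac (a b) (s b) \<in> extension P" using as[OF b] BI I\<^sub>P_extension by auto
      then show "a b \<in> P" using lfrac_in_extension_iff[OF P order_refl] as[OF b] by blast
    qed
    fix Q assume Q: "primeideal Q R \<and> a ` B \<subseteq> Q \<and> Q \<subseteq> P"
    note E = extension_prime[of Q]
    have "B \<subseteq> extension Q" using as Q unfolding extension_def by blast
    then have "I\<^sub>P \<subseteq> extension Q"
      using L.genideal_minimal[of "extension Q" B] E(1) Q B(3) primeideal.axioms(1) by blast
    then have "contraction (extension Q) = P" using contraction_over_I\<^sub>P E(1) Q by blast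
    then show "Q = P" using E(2) Q by blast
  qed (rule P)
  moreover have "finite (a ` B)" "a ` B \<subseteq> A" using B as by auto
  ultimately have "h \<le> card (a ` B)" using krull_height assms by blast
  also have "\<dots> \<le> card B" by (rule card_image_le[OF B(1)])
  finally show "enat h \<le> enat (card B)" by simp
qed

text \<open>Multiplying by an element outside \<open>P\<close> does not change the ideal that an element generates in the
localization.\<close>

lemma min_generators_localization_le:
  assumes F: "finite F" "F \<subseteq> I" and gen: "\<And>a. a \<in> I \<Longrightarrow> \<exists>s\<in>A - P. s * a \<in> genideal R F"
  shows "min_generators L I\<^sub>P \<le> enat (card F)"
proof -
  define B where "B = (\<lambda>a. lfrac a 1) ` F"
  have FA: "F \<subseteq> A" using F(2) ideal_mem[OF I] by blast
  have B: "B \<subseteq> carrier L" using lfrac_image_closed F(2) by (auto simp: B_def)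
  have iB: "ideal (genideal L B) L" by (rule L.genideal_ideal[OF B])
  have "genideal L B = I\<^sub>P"
  proof
    show "genideal L B \<subseteq> I\<^sub>P"
      using lfrac_in_I\<^sub>P F(2) by (intro L.genideal_minimal[OF ideal_I\<^sub>P]) (auto simp: B_def)
    have "F \<subseteq> contraction (genideal L B)"
      using L.genideal_self[OF B] FA by (auto simp: contraction_def B_def)
    then have sub: "genideal R F \<subseteq> contraction (genideal L B)"
      by (rule genideal_minimal[OF contraction_ideal[OF iB]])
    show "I\<^sub>P \<subseteq> genideal L B"
      unfolding I\<^sub>P_eq
    proof (rule L.genideal_minimal[OF iB], clarify)
      fix a assume a: "a \<in> I"
      then have aA: "a \<in> A" by (rule ideal_mem[OF I])
      obtain s where s: "s \<in> A - P" "s * a \<in> genideal R F" using gen[OF a] by blast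
      then have "lfrac (s * a) s \<in> genideal L B"
        using sub lfrac_in_ideal_iff[OF iB, of "s * a" s] aA by auto
      moreover have "lfrac (s * a) s = lfrac a 1"
        using s(1) aA one_S by (intro lfrac_eqI) (auto simp: algebra_simps)
      ultimately show "lfrac a 1 \<in> genideal L B" by simp
    qed
  qed
  moreover have "finite B" using F(1) by (simp add: B_def)
  ultimately have "min_generators L I\<^sub>P \<le> enat (card B)"
    unfolding min_generators_def using B by (intro INF_lower) auto
  also have "\<dots> \<le> enat (card F)" unfolding B_def using card_image_le[OF F(1)] by simp
  finally show ?thesis .
qed

theorem complete_intersection_localization:
  assumes "height_ge R h P" "\<not> height_ge R (Suc h) P" and F: "finite F" "F \<subseteq> I" "card F \<le> h"
    and gen: "\<And>a. a \<in> I \<Longrightarrow> \<exists>s\<in>A - P. s * a \<in> genideal R F"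
  shows "complete_intersection L I\<^sub>P"
proof -
  have "min_generators L I\<^sub>P \<le> enat h"
    using min_generators_localization_le[OF F(1,2) gen] F(3) by (metis enat_ord_simps(1) order_trans)
  then show ?thesis
    unfolding complete_intersection_def ideal_height_localization[OF assms(1,2)]
    using min_generators_localization_ge[OF assms(1)] ideal_I\<^sub>P by auto
qed

end

end

section \<open>Trees and their degrees\<close>

definition forest :: "'a set set \<Rightarrow> bool" where
  "forest E \<longleftrightarrow> finite E \<and> (\<forall>e\<in>E. \<exists>u v. u \<noteq> v \<and> e = {u, v}) \<and> \<not> (\<exists>vs. graph_cycle E vs)"

lemma forest_finite: "forest E \<Longrightarrow> finite E"
  by (simp add: forest_def)

lemma graph_cycle_mono: "graph_cycle E vs \<Longrightarrow> E \<subseteq> E' \<Longrightarrow> graph_cycle E' vs"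
  unfolding graph_cycle_def by blast

lemma forest_subset:
  assumes "forest E" "E' \<subseteq> E"
  shows "forest E'"
proof -
  have "finite E'" using assms finite_subset by (auto simp: forest_def)
  moreover have "\<nexists>vs. graph_cycle E' vs"
    using assms graph_cycle_mono[OF _ assms(2)] by (auto simp: forest_def)
  ultimately show ?thesis using assms by (auto simp: forest_def)
qed

lemma forest_edge: "forest E \<Longrightarrow> {u, v} \<in> E \<Longrightarrow> u \<noteq> v"
  unfolding forest_def by (metis doubleton_eq_iff insert_absorb2)

lemma forest_edgeE:
  assumes "forest E" "e \<in> E"
  obtains u v where "u \<noteq> v" "e = {u, v}" "{u, v} \<in> E"
proof -
  have "\<exists>u v. u \<noteq> v \<and> e = {u, v}" using assms by (simp add: forest_def)
  then show ?thesis using assms(2) that by blast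
qed

lemma simple_graph_finite: "simple_graph V E \<Longrightarrow> finite E"
  unfolding simple_graph_def
  by (rule finite_subset[of E "Pow V"]) auto

lemma tree_forest: "graph_tree V E \<Longrightarrow> forest E"
  unfolding graph_tree_def forest_def using simple_graph_finite[of V E]
  by (simp add: simple_graph_def) blast

lemma degree_mono: "finite E \<Longrightarrow> E' \<subseteq> E \<Longrightarrow> graph_degree E' v \<le> graph_degree E v"
  unfolding graph_degree_def by (intro card_mono) auto

lemma degree_remove_edge:
  assumes "finite E" "e \<in> E"
  shows "graph_degree (E - {e}) v = (if v \<in> e then graph_degree E v - 1 else graph_degree E v)"
proof (cases "v \<in> e")
  case True
  have "{f \<in> E - {e}. v \<in> f} = {f \<in> E. v \<in> f} - {e}" by blast
  then show ?thesis using assms True by (simp add: graph_degree_def)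
next
  case False
  then have "{f \<in> E - {e}. v \<in> f} = {f \<in> E. v \<in> f}" by blast
  then show ?thesis using False by (simp add: graph_degree_def)
qed

lemma max_degree_le_iff:
  assumes "finite V" "V \<noteq> {}"
  shows "max_degree V E \<le> d \<longleftrightarrow> (\<forall>v\<in>V. graph_degree E v \<le> d)"
  unfolding max_degree_def using assms by (subst Max_le_iff) auto

abbreviation edge_path :: "'a set set \<Rightarrow> 'a list \<Rightarrow> bool" where
  "edge_path E vs \<equiv> distinct vs \<and> (\<forall>i. Suc i < length vs \<longrightarrow> {vs ! i, vs ! Suc i} \<in> E)"

lemma edge_path_closes_cycle:
  assumes "edge_path E vs" "3 \<le> length vs" "{last vs, hd vs} \<in> E"
  shows "graph_cycle E vs"
  unfolding graph_cycle_def
proof (intro conjI allI impI)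
  fix i assume i: "i < length vs"
  have ne: "vs \<noteq> []" using assms(2) by auto
  show "{vs ! i, vs ! (Suc i mod length vs)} \<in> E"
  proof (cases "Suc i = length vs")
    case True
    then have "i = length vs - 1" by simp
    then show ?thesis using True assms(3) ne by (simp add: last_conv_nth hd_conv_nth)
  next
    case False
    then have "Suc i < length vs" using i by simp
    then show ?thesis using assms(1) by simp
  qed
qed (use assms in auto)

text \<open>The first vertex \<open>c\<close> of a longest path is a leaf: a second neighbour would either prolong the path or
close a cycle.\<close>

lemma forest_leaf:
  assumes E: "forest E" "E \<noteq> {}"
  obtains p c where "p \<noteq> c" "{p, c} \<in> E" "\<And>e. e \<in> E \<Longrightarrow> c \<in> e \<Longrightarrow> e = {p, c}"
proof -
  let ?P = "\<lambda>vs. edge_path E vs \<and> 2 \<le> length vs"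
  have fin: "finite (\<Union>E)" using E(1) unfolding forest_def by (auto intro: finite_Union)
  have sub: "set vs \<subseteq> \<Union>E" if vs: "?P vs" for vs
  proof
    fix x assume "x \<in> set vs"
    then obtain i where i: "i < length vs" "x = vs ! i" by (auto simp: in_set_conv_nth)
    show "x \<in> \<Union>E"
    proof (cases "Suc i < length vs")
      case True
      then have "{vs ! i, vs ! Suc i} \<in> E" using vs by blast
      then show ?thesis using i by blast
    next
      case False
      then obtain j where j: "i = Suc j" using vs i by (cases i) auto
      then have "{vs ! j, vs ! Suc j} \<in> E" using vs i by blast
      then show ?thesis using i j by blast
    qed
  qed
  obtain u v where "u \<noteq> v" "{u, v} \<in> E" using E unfolding forest_def by (metis ex_in_conv)
  then have "?P [u, v]" by (simp add: less_Suc_eq)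
  moreover have "\<forall>vs. ?P vs \<longrightarrow> length vs < Suc (card (\<Union>E))"
  proof (intro allI impI)
    fix vs assume vs: "?P vs"
    then have "length vs = card (set vs)" by (simp add: distinct_card)
    also have "\<dots> \<le> card (\<Union>E)" by (rule card_mono[OF fin sub[OF vs]])
    finally show "length vs < Suc (card (\<Union>E))" by simp
  qed
  ultimately obtain vs where vs: "?P vs" and max: "\<And>ws. ?P ws \<Longrightarrow> length ws \<le> length vs"
    using ex_has_greatest_nat[of ?P "[u, v]" length "Suc (card (\<Union>E))"] by blast
  obtain c p rest where cp: "vs = c # p # rest"
    using vs by (metis One_nat_def Suc_1 Suc_le_length_iff)
  have edge: "{p, c} \<in> E" using vs cp by (auto simp: insert_commute)
  show ?thesis
  proof (rule that[of p c])
    show "p \<noteq> c" using vs cp by auto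
    show "{p, c} \<in> E" by (fact edge)
    fix e assume e: "e \<in> E" "c \<in> e"
    then obtain y where y: "e = {y, c}" "y \<noteq> c"
      using E(1) unfolding forest_def by (metis doubleton_eq_iff insertE singletonD)
    show "e = {p, c}"
    proof (rule ccontr)
      assume "e \<noteq> {p, c}"
      then have yp: "y \<noteq> p" using y by blast
      show False
      proof (cases "y \<in> set vs")
        case False
        have "?P (y # vs)"
        proof (intro conjI allI impI)
          fix i assume "Suc i < length (y # vs)"
          then show "{(y # vs) ! i, (y # vs) ! Suc i} \<in> E"
            using vs y e(1) cp by (cases i) auto
        qed (use vs False in auto)
        then show False using max[of "y # vs"] by simp
      next
        case True
        then obtain i where i: "i < length vs" "y = vs ! i" by (auto simp: in_set_conv_nth)
        have "i \<noteq> 0" using i(2) y(2) cp by (metis nth_Cons_0)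
        have "i \<noteq> 1" using i(2) yp cp by (metis One_nat_def nth_Cons_0 nth_Cons_Suc)
        let ?ws = "take (Suc i) vs"
        have "last ?ws = y" using i by (simp add: take_Suc_conv_app_nth)
        moreover have "hd ?ws = c" using cp by simp
        ultimately have "{last ?ws, hd ?ws} \<in> E" using y e(1) by simp
        moreover have "edge_path E ?ws" using vs i by auto
        moreover have "3 \<le> length ?ws" using i \<open>i \<noteq> 0\<close> \<open>i \<noteq> 1\<close> by auto
        ultimately have "graph_cycle E ?ws" by (intro edge_path_closes_cycle)
        then show False using E(1) unfolding forest_def by blast
      qed
    qed
  qed
qed

text \<open>A proper edge colouring \<open>col\<close> by \<open>{1..d}\<close> with a weight \<open>w v l\<close> for every variable \<open>x\<^sub>v\<^sub>l\<close> such that in the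
polynomial of an edge of colour \<open>l\<close> the monomial with second index \<open>l\<close> has the largest weight.\<close>

definition dominating_colouring ::
    "'a set set \<Rightarrow> nat \<Rightarrow> ('a set \<Rightarrow> nat) \<Rightarrow> ('a \<Rightarrow> nat \<Rightarrow> nat) \<Rightarrow> bool" where
  "dominating_colouring E d col w \<longleftrightarrow> (\<forall>e\<in>E. col e \<in> {1..d}) \<and>
    (\<forall>e\<in>E. \<forall>e'\<in>E. e \<noteq> e' \<longrightarrow> e \<inter> e' \<noteq> {} \<longrightarrow> col e \<noteq> col e') \<and>
    (\<forall>i j. {i, j} \<in> E \<longrightarrow> (\<forall>l\<in>{1..d}. l \<noteq> col {i, j} \<longrightarrow>
      w i l + w j l < w i (col {i, j}) + w j (col {i, j})))"

text \<open>Remove a leaf \<open>c\<close> with neighbour \<open>p\<close>. The other edges at \<open>p\<close> use at most \<open>d - 1\<close> colours, so a colour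
\<open>k\<close> is left for \<open>{p, c}\<close>. As \<open>c\<close> lies on no other edge, the weight of \<open>c\<close> at \<open>k\<close> can be made as large as
needed to dominate the weights of \<open>p\<close>.\<close>

lemma forest_dominating_colouring:
  assumes "forest E" "\<And>v. graph_degree E v \<le> d"
  shows "\<exists>col w. dominating_colouring E d col w"
  using assms
proof (induction "card E" arbitrary: E)
  case 0
  then have "E = {}" using forest_finite[OF 0(2)] by simp
  then show ?case by (simp add: dominating_colouring_def)
next
  case (Suc n)
  have fE: "finite E" using Suc.prems(1) by (rule forest_finite)
  have "E \<noteq> {}" using Suc.hyps(2) by auto
  obtain p c where pc: "p \<noteq> c" "{p, c} \<in> E" "\<And>e. e \<in> E \<Longrightarrow> c \<in> e \<Longrightarrow> e = {p, c}"
    using forest_leaf[OF Suc.prems(1) \<open>E \<noteq> {}\<close>] by blast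
  define E' where "E' = E - {{p, c}}"
  have E': "E' \<subseteq> E" by (auto simp: E'_def)
  have "n = card E'" using Suc.hyps(2) pc(2) fE by (simp add: E'_def)
  moreover have "forest E'" using forest_subset[OF Suc.prems(1) E'] .
  moreover have "graph_degree E' v \<le> d" for v
    using degree_mono[OF fE E', of v] Suc.prems(2)[of v] by linarith
  ultimately have "\<exists>col w. dominating_colouring E' d col w" by (rule Suc.hyps(1))
  then obtain col w where cw: "dominating_colouring E' d col w" by blast
  have col1: "col e \<in> {1..d}" if "e \<in> E'" for e
    using cw that by (simp add: dominating_colouring_def)
  have col2: "col e \<noteq> col e'" if "e \<in> E'" "e' \<in> E'" "e \<noteq> e'" "e \<inter> e' \<noteq> {}" for e e'
    using cw that by (simp add: dominating_colouring_def)
  have w: "w i l + w j l < w i (col {i, j}) + w j (col {i, j})"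
    if "{i, j} \<in> E'" "l \<in> {1..d}" "l \<noteq> col {i, j}" for i j l
    using cw that by (simp add: dominating_colouring_def)
  define used where "used = col ` {e \<in> E'. p \<in> e}"
  have "card used < card {1..d}"
  proof -
    have "card used \<le> graph_degree E' p"
      unfolding used_def graph_degree_def by (rule card_image_le) (use fE E'_def in auto)
    also have "\<dots> = graph_degree E p - 1"
      unfolding E'_def using degree_remove_edge[OF fE pc(2), of p] by simp
    finally have "card used \<le> graph_degree E p - 1" .
    moreover have "graph_degree E p \<noteq> 0"
      unfolding graph_degree_def using fE pc(2) by auto
    ultimately show ?thesis using Suc.prems(2)[of p] by simp
  qed
  moreover have "finite used" using fE by (simp add: used_def E'_def)
  ultimately have "\<not> {1..d} \<subseteq> used" using card_mono[of used "{1..d}"] by linarith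
  then obtain k where k: "k \<in> {1..d}" "k \<notin> used" by blast
  define col' where "col' = col({p, c} := k)"
  define w' where "w' = w(c := (\<lambda>l. if l = k then Suc (\<Sum>l\<in>{1..d}. w p l) else 0))"
  have cE': "c \<notin> e" if "e \<in> E'" for e using that pc(3) by (auto simp: E'_def)
  have kE': "col e \<noteq> k" if "e \<in> E'" "e \<inter> {p, c} \<noteq> {}" for e
  proof -
    have "p \<in> e" using that cE' by blast
    then have "col e \<in> used" using that(1) by (simp add: used_def)
    then show ?thesis using k(2) by blast
  qed
  have EE': "e = {p, c} \<or> e \<in> E'" if "e \<in> E" for e using that by (auto simp: E'_def)
  have "\<forall>e\<in>E. col' e \<in> {1..d}"
    using EE' col1 k(1) by (auto simp: col'_def)
  moreover have "col' e \<noteq> col' e'" if "e \<in> E" "e' \<in> E" "e \<noteq> e'" "e \<inter> e' \<noteq> {}" for e e'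
  proof (cases "e = {p, c}")
    case True
    then have "e' \<in> E'" "e' \<noteq> {p, c}" using EE'[OF that(2)] that(3) by blast+
    then show ?thesis using kE'[of e'] that(4) True by (simp add: col'_def Int_commute)
  next
    case False
    then have eE': "e \<in> E'" using EE'[OF that(1)] by blast
    show ?thesis
    proof (cases "e' = {p, c}")
      case True
      then show ?thesis using kE'[OF eE'] that(4) False by (simp add: col'_def)
    next
      case e': False
      then have "e' \<in> E'" using EE'[OF that(2)] by blast
      then show ?thesis using col2[OF eE' _ that(3,4)] False e' by (simp add: col'_def)
    qed
  qed
  moreover have "w' i l + w' j l < w' i (col' {i, j}) + w' j (col' {i, j})"
    if ij: "{i, j} \<in> E" and l: "l \<in> {1..d}" "l \<noteq> col' {i, j}" for i j l
  proof (cases "{i, j} = {p, c}")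
    case False
    then have "{i, j} \<in> E'" using EE' ij by blast
    moreover from this have "i \<noteq> c" "j \<noteq> c" using cE' by auto
    ultimately show ?thesis using w[of i j l] l False by (simp add: w'_def col'_def)
  next
    case True
    have "w p l \<le> (\<Sum>l\<in>{1..d}. w p l)" using l(1) by (intro member_le_sum) auto
    moreover have "l \<noteq> k" using l(2) True by (simp add: col'_def)
    moreover have "i = p \<and> j = c \<or> i = c \<and> j = p" using True by (auto simp: doubleton_eq_iff)
    moreover have "w' p = w p" "w' c l = 0" "w' c k = Suc (\<Sum>l\<in>{1..d}. w p l)" "col' {i, j} = k"
      using pc(1) \<open>l \<noteq> k\<close> True by (simp_all add: w'_def col'_def)
    ultimately show ?thesis by (elim disjE conjE) simp_all
  qed
  ultimately have "dominating_colouring E d col' w'" unfolding dominating_colouring_def by blast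
  then show ?case by blast
qed

lemma card_edges_avoiding:
  assumes "finite E"
  shows "card {e \<in> E. e \<inter> {v} = {}} + graph_degree E v = card E"
proof -
  have "{e \<in> E. e \<inter> {v} = {}} \<union> {e \<in> E. v \<in> e} = E" by blast
  moreover have "card ({e \<in> E. e \<inter> {v} = {}} \<union> {e \<in> E. v \<in> e}) =
      card {e \<in> E. e \<inter> {v} = {}} + card {e \<in> E. v \<in> e}"
    using assms by (intro card_Un_disjoint) auto
  ultimately show ?thesis by (simp add: graph_degree_def)
qed

lemma card_edges_avoiding_two:
  assumes E: "finite E" and uv: "{u, v} \<notin> E" "u \<noteq> v" and E2: "\<forall>e\<in>E. \<exists>u v. u \<noteq> v \<and> e = {u, v}"
  shows "card {e \<in> E. e \<inter> {u, v} = {}} + graph_degree E u + graph_degree E v = card E"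
proof -
  have "e = {u, v}" if "e \<in> E" "u \<in> e" "v \<in> e" for e
    using E2 that uv(2) by (metis doubleton_eq_iff insertE singletonD)
  then have "{e \<in> E. u \<in> e} \<inter> {e \<in> E. v \<in> e} = {}" using uv(1) by blast
  then have "card ({e \<in> E. u \<in> e} \<union> {e \<in> E. v \<in> e}) = graph_degree E u + graph_degree E v"
    unfolding graph_degree_def using E by (intro card_Un_disjoint) auto
  moreover have "card ({e \<in> E. e \<inter> {u, v} = {}} \<union> ({e \<in> E. u \<in> e} \<union> {e \<in> E. v \<in> e})) =
      card {e \<in> E. e \<inter> {u, v} = {}} + card ({e \<in> E. u \<in> e} \<union> {e \<in> E. v \<in> e})"
    using E by (intro card_Un_disjoint) auto
  moreover have "{e \<in> E. e \<inter> {u, v} = {}} \<union> ({e \<in> E. u \<in> e} \<union> {e \<in> E. v \<in> e}) = E" by blast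
  ultimately show ?thesis by simp
qed

text \<open>The set \<open>C\<close> consists of a vertex of degree at least \<open>d + 2\<close> or of two non-adjacent vertices of degree
\<open>d + 1\<close>. If neither exists, then the vertices of degree greater than \<open>d\<close> have degree \<open>d + 1\<close> and are
pairwise adjacent; there are at most two of them, as three would form a cycle, and an edge through all of
them can be deleted to make all degrees at most \<open>d\<close>.\<close>

lemma forest_obstruction:
  assumes E: "forest E" and big: "graph_degree E v0 > d"
    and bad: "\<And>e. e \<in> E \<Longrightarrow> \<exists>v. graph_degree (E - {e}) v > d"
  obtains C where "finite C" "C \<subseteq> \<Union>E" "d * card C + card {e \<in> E. e \<inter> C = {}} + 2 \<le> card E"
proof (cases "\<exists>v. graph_degree E v \<ge> d + 2")
  case True
  then obtain v where v: "graph_degree E v \<ge> d + 2" by blast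
  have "v \<in> \<Union>E"
  proof (rule ccontr)
    assume "v \<notin> \<Union>E"
    then have "{e \<in> E. v \<in> e} = {}" by blast
    with v show False by (simp add: graph_degree_def)
  qed
  then show ?thesis
    using that[of "{v}"] v card_edges_avoiding[OF forest_finite[OF E], of v] by simp
next
  case False
  have fE: "finite E" using E by (rule forest_finite)
  have E2: "\<forall>e\<in>E. \<exists>u v. u \<noteq> v \<and> e = {u, v}" using E by (simp add: forest_def)
  have le: "graph_degree E v \<le> d + 1" for v using False[simplified, rule_format, of v] by simp
  have mem: "v \<in> \<Union>E" if "graph_degree E v > d" for v
  proof (rule ccontr)
    assume "v \<notin> \<Union>E"
    then have "{e \<in> E. v \<in> e} = {}" by blast
    with that show False by (simp add: graph_degree_def)
  qed
  have two: thesis if "graph_degree E u > d" "graph_degree E v > d" "u \<noteq> v" "{u, v} \<notin> E" for u v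
    using that(1,2,3) mem[of u] mem[of v] card_edges_avoiding_two[OF fE that(4,3) E2]
    by (intro \<open>\<And>C. \<lbrakk>finite C; C \<subseteq> \<Union> E; d * card C + card {e \<in> E. e \<inter> C = {}} + 2 \<le> card E\<rbrakk> \<Longrightarrow> thesis\<close>[of "{u, v}"]) auto
  have other: "\<exists>x. graph_degree E x > d \<and> x \<notin> e" if e: "e \<in> E" for e
  proof -
    obtain x where x: "graph_degree (E - {e}) x > d" using bad[OF e] by blast
    have "x \<notin> e"
    proof
      assume "x \<in> e"
      then have "graph_degree (E - {e}) x = graph_degree E x - 1" using degree_remove_edge[OF fE e] by simp
      then show False using x le[of x] by linarith
    qed
    then show ?thesis using x degree_remove_edge[OF fE e, of x] by auto
  qed
  obtain e where e: "e \<in> E" "v0 \<in> e" using mem[OF big] by blast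
  obtain w where w: "graph_degree E w > d" "w \<notin> e" using other[OF e(1)] by blast
  then have vw: "v0 \<noteq> w" using e by blast
  show ?thesis
  proof (cases "{v0, w} \<in> E")
    case True
    obtain x where x: "graph_degree E x > d" "x \<noteq> v0" "x \<noteq> w" using other[OF True] by blast
    have "\<not> ({v0, x} \<in> E \<and> {w, x} \<in> E)"
    proof
      assume "{v0, x} \<in> E \<and> {w, x} \<in> E"
      then have edges: "{x, v0} \<in> E" "{w, x} \<in> E" by (simp_all only: insert_commute)
      have "edge_path E [v0, w, x]"
      proof (intro conjI allI impI)
        fix i assume "Suc i < length [v0, w, x]"
        then have "i = 0 \<or> i = 1" by auto
        then show "{[v0, w, x] ! i, [v0, w, x] ! Suc i} \<in> E"
          by (elim disjE) (simp_all add: True edges)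
      qed (use vw x in auto)
      then have "graph_cycle E [v0, w, x]"
        by (rule edge_path_closes_cycle) (simp_all add: edges)
      then show False using E by (auto simp: forest_def)
    qed
    then show ?thesis using two[OF big x(1)] two[OF w(1) x(1)] x(2,3) by metis
  qed (rule two[OF big w(1) vw])
qed

lemma edge_path_of_connected:
  assumes "(x, y) \<in> {(x, y). {x, y} \<in> E}\<^sup>*"
  shows "\<exists>vs. edge_path E vs \<and> vs \<noteq> [] \<and> hd vs = x \<and> last vs = y"
  using assms
proof (induction rule: converse_rtrancl_induct)
  case base
  show ?case by (rule exI[of _ "[y]"]) simp
next
  case (step x x')
  then obtain vs where vs: "edge_path E vs" "vs \<noteq> []" "hd vs = x'" "last vs = y" by blast
  have edge: "{x, x'} \<in> E" using step.hyps(1) by simp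
  show ?case
  proof (cases "x \<in> set vs")
    case False
    have "edge_path E (x # vs)"
    proof (intro conjI allI impI)
      fix i assume "Suc i < length (x # vs)"
      then show "{(x # vs) ! i, (x # vs) ! Suc i} \<in> E"
        using vs edge by (cases i) (auto simp: hd_conv_nth)
    qed (use vs False in auto)
    then show ?thesis using vs by (intro exI[of _ "x # vs"]) auto
  next
    case True
    then obtain i where i: "i < length vs" "x = vs ! i" by (auto simp: in_set_conv_nth)
    have "edge_path E (drop i vs)" using vs by auto
    then show ?thesis using vs i by (intro exI[of _ "drop i vs"]) (auto simp: hd_drop_conv_nth)
  qed
qed

text \<open>The two trees consist of the vertices that are reachable from \<open>u\<close> and from \<open>v\<close> without the edge
\<open>{u, v}\<close>. They are disjoint, because otherwise a path from \<open>u\<close> to \<open>v\<close> would close a cycle with \<open>{u, v}\<close>.\<close>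

lemma tree_split:
  assumes tree: "graph_tree V E" and e: "{u, v} \<in> E"
  obtains V1 E1 V2 E2 where "graph_tree V1 E1" "graph_tree V2 E2" "V1 \<inter> V2 = {}" "V1 \<union> V2 = V"
    "u \<in> V1" "v \<in> V2" "E - {{u, v}} = E1 \<union> E2"
proof -
  define E' where "E' = E - {{u, v}}"
  define Adj where "Adj = {(x, y). {x, y} \<in> E'}"
  define reach where "reach a = {x. (a, x) \<in> Adj\<^sup>*}" for a
  define part where "part a = {f \<in> E'. f \<subseteq> reach a}" for a
  note forest = tree_forest[OF tree]
  have simple: "simple_graph V E" and conn: "graph_connected V E" and acyc: "\<nexists>vs. graph_cycle E vs"
    using tree by (auto simp: graph_tree_def)
  have fV: "finite V" using simple by (simp add: simple_graph_def)
  have in_V: "x \<in> V" if "x \<in> f" "f \<in> E" for x f using simple that by (auto simp: simple_graph_def)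
  have uv: "u \<noteq> v" "u \<in> V" "v \<in> V" using forest_edge[OF forest e] in_V[OF _ e] by auto
  have sym: "sym Adj" by (auto simp: sym_def Adj_def insert_commute)
  have sym_star: "(y, x) \<in> Adj\<^sup>*" if "(x, y) \<in> Adj\<^sup>*" for x y
    using that sym_rtrancl[OF sym] by (auto dest: symD)
  have reach_step: "y \<in> reach a" if "x \<in> reach a" "{x, y} \<in> E'" for a x y
    using that by (auto simp: reach_def Adj_def intro: rtrancl_into_rtrancl)
  have reach_V: "reach a \<subseteq> V" if "a \<in> V" for a
  proof
    fix x assume "x \<in> reach a"
    then have "(a, x) \<in> Adj\<^sup>*" by (simp add: reach_def)
    then show "x \<in> V"
    proof (induction rule: rtrancl_induct)
      case (step y z)
      then have "{y, z} \<in> E" by (simp add: Adj_def E'_def)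
      then show ?case using in_V[of z "{y, z}"] by simp
    qed (fact that)
  qed
  have tree_part: "graph_tree (reach a) (part a)" if a: "a \<in> V" for a
    unfolding graph_tree_def
  proof (intro conjI)
    show "simple_graph (reach a) (part a)"
      unfolding simple_graph_def
    proof (intro conjI ballI)
      show "finite (reach a)" using reach_V[OF a] fV finite_subset by blast
      fix f assume f: "f \<in> part a"
      then have "f \<in> E" "f \<subseteq> reach a" by (auto simp: part_def E'_def)
      moreover from this obtain x y where "x \<noteq> y" "f = {x, y}" using simple by (auto simp: simple_graph_def)
      ultimately show "\<exists>x\<in>reach a. \<exists>y\<in>reach a. x \<noteq> y \<and> f = {x, y}" by blast
    qed
    have from_a: "(a, x) \<in> {(x, y). {x, y} \<in> part a}\<^sup>*" if "x \<in> reach a" for x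
    proof -
      have "(a, x) \<in> Adj\<^sup>*" using that by (simp add: reach_def)
      then show ?thesis
      proof (induction rule: rtrancl_induct)
        case (step y z)
        then have "y \<in> reach a" "{y, z} \<in> E'" by (auto simp: reach_def Adj_def)
        moreover from this have "z \<in> reach a" by (rule reach_step)
        ultimately have "(y, z) \<in> {(x, y). {x, y} \<in> part a}" by (simp add: part_def)
        with step.IH show ?case by (rule rtrancl_into_rtrancl)
      qed simp
    qed
    have "sym {(x, y). {x, y} \<in> part a}" by (auto simp: sym_def insert_commute)
    then have "sym ({(x, y). {x, y} \<in> part a}\<^sup>*)" by (rule sym_rtrancl)
    then have "(x, y) \<in> {(x, y). {x, y} \<in> part a}\<^sup>*" if "x \<in> reach a" "y \<in> reach a" for x y
      using from_a[OF that(1)] from_a[OF that(2)] by (meson rtrancl_trans symD)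
    moreover have "a \<in> reach a" by (simp add: reach_def)
    ultimately show "graph_connected (reach a) (part a)" unfolding graph_connected_def by blast
    show "\<nexists>vs. graph_cycle (part a) vs"
      using acyc graph_cycle_mono[of "part a" _ E] by (auto simp: part_def E'_def)
  qed
  have disj: "reach u \<inter> reach v = {}"
  proof (rule ccontr)
    assume "reach u \<inter> reach v \<noteq> {}"
    then obtain x where "(u, x) \<in> Adj\<^sup>*" "(v, x) \<in> Adj\<^sup>*" by (auto simp: reach_def)
    then have "(u, v) \<in> Adj\<^sup>*" using sym_star by (meson rtrancl_trans)
    then obtain vs where vs: "edge_path E' vs" "vs \<noteq> []" "hd vs = u" "last vs = v"
      using edge_path_of_connected[of u v E'] by (auto simp: Adj_def)
    have "length vs \<noteq> 1" using vs uv(1) by (auto simp: length_Suc_conv)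
    moreover have "length vs \<noteq> 2"
    proof
      assume l: "length vs = 2"
      then have "vs = [u, v]" using vs(2,3,4) by (auto simp: numeral_2_eq_2 length_Suc_conv)
      then have "{u, v} \<in> E'" using vs(1) by auto
      then show False by (simp add: E'_def)
    qed
    moreover have "length vs \<noteq> 0" using vs(2) by simp
    ultimately have "3 \<le> length vs" by linarith
    moreover have "edge_path E vs" using vs(1) by (auto simp: E'_def)
    moreover have "{last vs, hd vs} \<in> E" using vs e by (simp add: insert_commute)
    ultimately show False using edge_path_closes_cycle acyc by blast
  qed
  have cover: "reach u \<union> reach v = V"
  proof
    show "reach u \<union> reach v \<subseteq> V" using reach_V uv by blast
    show "V \<subseteq> reach u \<union> reach v"
    proof
      fix x assume "x \<in> V"
      then have "(u, x) \<in> {(x, y). {x, y} \<in> E}\<^sup>*" using conn uv by (auto simp: graph_connected_def)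
      then show "x \<in> reach u \<union> reach v"
      proof (induction rule: rtrancl_induct)
        case (step y z)
        show ?case
        proof (cases "{y, z} = {u, v}")
          case False
          then have "{y, z} \<in> E'" using step.hyps by (simp add: E'_def)
          then show ?thesis using step.IH reach_step[of y _ z] by blast
        next
          case True
          then have "z = u \<or> z = v" by (auto simp: doubleton_eq_iff)
          then show ?thesis by (auto simp: reach_def)
        qed
      qed (simp add: reach_def)
    qed
  qed
  have edges: "E - {{u, v}} = part u \<union> part v"
  proof
    show "part u \<union> part v \<subseteq> E - {{u, v}}" by (auto simp: part_def E'_def)
    show "E - {{u, v}} \<subseteq> part u \<union> part v"
    proof
      fix f assume f: "f \<in> E - {{u, v}}"
      then have "f \<in> E" by blast
      then obtain x y where xy: "f = {x, y}" "x \<in> V" using simple unfolding simple_graph_def by blast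
      have fE': "{x, y} \<in> E'" using f xy by (simp add: E'_def)
      then have "f \<in> part a" if "x \<in> reach a" for a
        using that reach_step[OF that] xy by (simp add: part_def)
      then show "f \<in> part u \<union> part v" using xy(2) cover by blast
    qed
  qed
  show ?thesis
    by (rule that[OF tree_part[OF uv(2)] tree_part[OF uv(3)] disj cover _ _ edges]) (simp_all add: reach_def)
qed

lemma tree_split_iff:
  assumes tree: "graph_tree V E"
  shows "(\<exists>V1 E1 V2 E2 u v.
       graph_tree V1 E1 \<and> graph_tree V2 E2 \<and> V1 \<inter> V2 = {} \<and> V1 \<union> V2 = V \<and>
       max_degree V1 E1 \<le> d \<and> max_degree V2 E2 \<le> d \<and>
       u \<in> V1 \<and> v \<in> V2 \<and> E = E1 \<union> E2 \<union> {{u, v}}) \<longleftrightarrow>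
    (\<exists>e\<in>E. \<forall>x. graph_degree (E - {e}) x \<le> d)" (is "?L \<longleftrightarrow> ?R")
proof
  assume ?L
  then obtain V1 E1 V2 E2 u v where *: "graph_tree V1 E1" "graph_tree V2 E2" "V1 \<inter> V2 = {}"
    "max_degree V1 E1 \<le> d" "max_degree V2 E2 \<le> d" "E = E1 \<union> E2 \<union> {{u, v}}" by blast
  have deg: "graph_degree E' x \<le> d"
    if "graph_tree V' E'" "max_degree V' E' \<le> d" "x \<in> V'" for V' E' x
    using that max_degree_le_iff[of V' E' d] by (auto simp: graph_tree_def graph_connected_def simple_graph_def)
  have sub: "f \<subseteq> V'" if "graph_tree V' E'" "f \<in> E'" for V' E' f
    using that by (auto simp: graph_tree_def simple_graph_def)
  have fin: "finite E'" if "graph_tree V' E'" for V' E'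
    using that simple_graph_finite by (auto simp: graph_tree_def)
  have "graph_degree (E - {{u, v}}) x \<le> d" for x
  proof -
    have "graph_degree (E - {{u, v}}) x \<le> graph_degree (E1 \<union> E2) x"
      using *(6) fin[OF *(1)] fin[OF *(2)] by (intro degree_mono) auto
    also have "\<dots> \<le> d"
    proof (cases "x \<in> V1")
      case True
      then have "{f \<in> E1 \<union> E2. x \<in> f} = {f \<in> E1. x \<in> f}" using sub[OF *(2)] *(3) by blast
      then show ?thesis using deg[OF *(1,4) True] by (simp add: graph_degree_def)
    next
      case False
      then have eq: "{f \<in> E1 \<union> E2. x \<in> f} = {f \<in> E2. x \<in> f}" using sub[OF *(1)] by blast
      show ?thesis
      proof (cases "x \<in> V2")
        case True
        then show ?thesis using eq deg[OF *(2,5) True] by (simp add: graph_degree_def)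
      next
        case False
        then have none: "{f \<in> E2. x \<in> f} = {}" using sub[OF *(2)] by blast
        show ?thesis unfolding graph_degree_def eq none by simp
      qed
    qed
    finally show ?thesis .
  qed
  then show ?R using *(6) by blast
next
  assume ?R
  then obtain e where e: "e \<in> E" "\<And>x. graph_degree (E - {e}) x \<le> d" by blast
  then obtain u v where uv: "e = {u, v}"
    using tree by (auto simp: graph_tree_def simple_graph_def)
  obtain V1 E1 V2 E2 where *: "graph_tree V1 E1" "graph_tree V2 E2" "V1 \<inter> V2 = {}" "V1 \<union> V2 = V"
    "u \<in> V1" "v \<in> V2" "E - {{u, v}} = E1 \<union> E2"
    using tree_split[OF tree] e(1) uv by metis
  have fE: "finite (E - {e})" using forest_finite[OF tree_forest[OF tree]] by simp
  have deg: "max_degree V' E' \<le> d" if "graph_tree V' E'" "E' \<subseteq> E - {e}" for V' E'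
  proof -
    have V': "finite V'" "V' \<noteq> {}" using that(1) by (auto simp: graph_tree_def graph_connected_def simple_graph_def)
    show ?thesis
      unfolding max_degree_le_iff[OF V'] using degree_mono[OF fE that(2)] e(2) le_trans by blast
  qed
  have "max_degree V1 E1 \<le> d" "max_degree V2 E2 \<le> d"
    using deg[OF *(1)] deg[OF *(2)] *(7) uv by auto
  moreover have "E = E1 \<union> E2 \<union> {{u, v}}" using *(7) e(1) uv by blast
  ultimately show ?L using *(1-6) by blast
qed

section \<open>Edge polynomials\<close>

text \<open>Edges are unordered, so the monomial \<open>x\<^sub>i\<^sub>l x\<^sub>j\<^sub>l\<close> of \<open>e = {i, j}\<close> is formed without choosing an order of the
end points.\<close>

definition edge_monomial :: "nat set \<Rightarrow> nat \<Rightarrow> (nat \<times> nat \<Rightarrow>\<^sub>0 nat)" where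
  "edge_monomial e l = (\<Sum>v\<in>e. single (v, l) 1)"

definition edge_poly :: "nat \<Rightarrow> nat set \<Rightarrow> (nat \<times> nat, 'k::comm_ring_1) mpoly" where
  "edge_poly d e = (\<Sum>l = 1..d. single (edge_monomial e l) 1)"

lemma lookup_edge_monomial:
  "finite e \<Longrightarrow> lookup (edge_monomial e l) x = (if x \<in> e \<times> {l} then 1 else 0)"
  by (cases x) (auto simp: edge_monomial_def lookup_sum lookup_single when_def)

lemma keys_edge_monomial: "finite e \<Longrightarrow> keys (edge_monomial e l) = e \<times> {l}"
  by (auto simp: in_keys_iff lookup_edge_monomial split: if_splits)

lemma edge_poly_pair:
  "i \<noteq> j \<Longrightarrow> edge_poly d {i, j} = (\<Sum>l = 1..d. poly_var (i, l) * poly_var (j, l))"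
  by (simp add: edge_poly_def edge_monomial_def poly_var_def mult_single)

lemma keys_sum_singles:
  "t \<in> keys (\<Sum>l\<in>S. single (m l) (c l)) \<Longrightarrow> \<exists>l\<in>S. t = m l"
  by (rule ccontr) (auto simp: in_keys_iff lookup_sum lookup_single when_def intro!: sum.neutral)

lemma keys_edge_poly: "t \<in> keys (edge_poly d e) \<Longrightarrow> \<exists>l\<in>{1..d}. t = edge_monomial e l"
  unfolding edge_poly_def by (rule keys_sum_singles)

lemma lss_ideal_eq:
  assumes "forest E"
  shows "(lss_ideal n E d :: (nat \<times> nat, 'k::field) mpoly set) =
    genideal (lss_ring n d) (edge_poly d ` E)"
proof -
  have pair: "edge_poly d {i, j} = (\<Sum>l = 1..d. poly_var (i, l) * poly_var (j, l) :: _ \<Rightarrow>\<^sub>0 'k)"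
    if "{i, j} \<in> E" for i j
    using edge_poly_pair[OF forest_edge[OF assms that]] .
  have "{\<Sum>l = 1..d. poly_var (i, l) * poly_var (j, l) :: _ \<Rightarrow>\<^sub>0 'k |i j. {i, j} \<in> E} = edge_poly d ` E"
  proof (intro equalityI subsetI)
    fix p :: "(nat \<times> nat \<Rightarrow>\<^sub>0 nat) \<Rightarrow>\<^sub>0 'k"
    assume "p \<in> {\<Sum>l = 1..d. poly_var (i, l) * poly_var (j, l) |i j. {i, j} \<in> E}"
    then show "p \<in> edge_poly d ` E" using pair by force
  next
    fix p :: "(nat \<times> nat \<Rightarrow>\<^sub>0 nat) \<Rightarrow>\<^sub>0 'k"
    assume "p \<in> edge_poly d ` E"
    then obtain e where e: "e \<in> E" "p = edge_poly d e" by blast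
    from forest_edgeE[OF assms e(1)] obtain i j where "e = {i, j}" .
    then show "p \<in> {\<Sum>l = 1..d. poly_var (i, l) * poly_var (j, l) |i j. {i, j} \<in> E}"
      using e pair[of i j] by blast
  qed
  then show ?thesis by (simp add: lss_ideal_def)
qed

lemma lookup_mult_const:
  fixes p q :: "('v \<Rightarrow>\<^sub>0 nat) \<Rightarrow>\<^sub>0 'k::comm_ring_1"
  assumes "\<And>r s. r \<in> keys p \<Longrightarrow> r \<noteq> 0 \<Longrightarrow> s \<in> keys q \<Longrightarrow> t \<noteq> r + s"
  shows "lookup (p * q) t = lookup p 0 * lookup q t"
proof -
  define c where "c = single (0 :: 'v \<Rightarrow>\<^sub>0 nat) (lookup p 0)"
  have "r \<noteq> 0 \<and> r \<in> keys p" if "r \<in> keys (p - c)" for r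
    using that by (cases "r = 0") (auto simp: in_keys_iff lookup_minus lookup_single when_def c_def)
  then have "t \<notin> keys ((p - c) * q)"
    using Poly_Mapping.keys_mult[of "p - c" q] assms by blast
  then have "lookup ((p - c) * q) t = 0" by (simp add: in_keys_iff)
  moreover have "p * q = (p - c) * q + q * c" by (simp add: algebra_simps)
  ultimately show ?thesis
    using lookup_times_single[of q 0 "lookup p 0" t] by (simp add: lookup_add c_def mult.commute)
qed

lemma lookup_mult_zero:
  fixes p q :: "('v \<Rightarrow>\<^sub>0 nat) \<Rightarrow>\<^sub>0 'k::comm_ring_1"
  shows "lookup (p * q) 0 = lookup p 0 * lookup q 0"
proof (rule lookup_mult_const)
  show "0 \<noteq> r + s" if "r \<noteq> 0" for r s :: "'v \<Rightarrow>\<^sub>0 nat"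
    using that keys_add_nat[of r s] by (metis Un_empty keys_zero keys_eq_empty)
qed

text \<open>The parameter \<open>ground\<close> determines the coefficient field.\<close>

locale lss = noetherian_subring "polynomials ({1..n} \<times> {1..d}) :: (nat \<times> nat, 'k::field) mpoly set"
  for n d :: nat and ground :: "'k::field itself"
begin

abbreviation "X \<equiv> {1..n} \<times> {1..d}"
abbreviation "A \<equiv> polynomials X :: (nat \<times> nat, 'k) mpoly set"

lemma lss_ring_eq: "(lss_ring n d :: (nat \<times> nat, 'k) mpoly ring) = R"
  by (simp add: lss_ring_def polynomial_ring_eq)

lemma edge_poly_mem: "e \<subseteq> {1..n} \<Longrightarrow> edge_poly d e \<in> A"
proof -
  assume e: "e \<subseteq> {1..n}"
  then have "finite e" using finite_subset by blast
  have "keys t \<subseteq> X" if "t \<in> keys (edge_poly d e :: _ \<Rightarrow>\<^sub>0 'k)" for t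
    using keys_edge_poly[OF that] e keys_edge_monomial[OF \<open>finite e\<close>] by auto
  then show ?thesis by (simp add: polynomials_def)
qed

text \<open>The initial monomial of the polynomial of an edge \<open>e\<close> is its monomial with the colour of \<open>e\<close> as second
index. For two edges these monomials are coprime: if the edges share a vertex, then they have different
colours.\<close>

lemma initial_monomials_forest:
  assumes E: "forest E" "\<And>e. e \<in> E \<Longrightarrow> e \<subseteq> {1..n}" and deg: "\<And>v. graph_degree E v \<le> d"
  obtains \<omega> m where
    "squarefree_initial_monomials X \<omega> E (edge_poly d :: nat set \<Rightarrow> _ \<Rightarrow>\<^sub>0 'k) m"
proof -
  obtain col w where cw: "dominating_colouring E d col w"
    using forest_dominating_colouring[OF E(1) deg] by blast
  have col: "col e \<in> {1..d}" if "e \<in> E" for e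
    using cw that by (simp add: dominating_colouring_def)
  have col_neq: "col e \<noteq> col e'" if "e \<in> E" "e' \<in> E" "e \<noteq> e'" "e \<inter> e' \<noteq> {}" for e e'
    using cw that by (simp add: dominating_colouring_def)
  have w: "w i l + w j l < w i (col {i, j}) + w j (col {i, j})"
    if "{i, j} \<in> E" "l \<in> {1..d}" "l \<noteq> col {i, j}" for i j l
    using cw that by (simp add: dominating_colouring_def)
  have finE: "finite e" if "e \<in> E" for e using E(2)[OF that] finite_subset by blast
  define \<omega> where "\<omega> t = (\<Sum>x\<in>X. lookup t x * w (fst x) (snd x))" for t :: "nat \<times> nat \<Rightarrow>\<^sub>0 nat"
  define m where "m e = edge_monomial e (col e)" for e
  have weight: "\<omega> (edge_monomial e l) = (\<Sum>v\<in>e. w v l)" if e: "e \<in> E" and l: "l \<in> {1..d}" for e l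
  proof -
    have "\<omega> (edge_monomial e l) = (\<Sum>x\<in>X. if x \<in> e \<times> {l} then w (fst x) (snd x) else 0)"
      unfolding \<omega>_def by (intro sum.cong) (auto simp: lookup_edge_monomial[OF finE[OF e]])
    also have "\<dots> = (\<Sum>x\<in>e \<times> {l}. w (fst x) (snd x))"
      using E(2)[OF e] l by (simp add: sum.If_cases) (intro sum.cong; auto)
    also have "e \<times> {l} = (\<lambda>v. (v, l)) ` e" by auto
    also have "(\<Sum>x\<in>(\<lambda>v. (v, l)) ` e. w (fst x) (snd x)) = (\<Sum>v\<in>e. w v l)"
      by (subst sum.reindex) (auto simp: inj_on_def)
    finally show ?thesis .
  qed
  have "squarefree_initial_monomials X \<omega> E (edge_poly d :: nat set \<Rightarrow> _ \<Rightarrow>\<^sub>0 'k) m"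
  proof (intro squarefree_initial_monomials.intro initial_monomials.intro comm_subring_axioms
      squarefree_initial_monomials_axioms.intro initial_monomials_axioms.intro)
    show "\<omega> (s + t) = \<omega> s + \<omega> t" for s t
      by (simp add: \<omega>_def lookup_add distrib_right sum.distrib)
    show "finite E" by (rule forest_finite[OF E(1)])
    show "edge_poly d e \<in> A" if "e \<in> E" for e by (rule edge_poly_mem[OF E(2)[OF that]])
    show "keys (m e) \<subseteq> X" if "e \<in> E" for e
      using E(2)[OF that] col[OF that] by (auto simp: m_def keys_edge_monomial[OF finE[OF that]])
    show "\<omega> t < \<omega> (m e)"
      if e: "e \<in> E" and t: "t \<in> keys (edge_poly d e - single (m e) 1 :: _ \<Rightarrow>\<^sub>0 'k)" for e t
    proof -
      have eq: "edge_poly d e - single (m e) 1 =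
          (\<Sum>l\<in>{1..d} - {col e}. single (edge_monomial e l) (1 :: 'k))"
        unfolding edge_poly_def m_def using col[OF e] by (simp add: sum_diff1)
      obtain l where l: "l \<in> {1..d} - {col e}" "t = edge_monomial e l"
        using keys_sum_singles[OF t[unfolded eq]] by blast
      obtain i j where ij: "i \<noteq> j" "e = {i, j}" using forest_edgeE[OF E(1) e] .
      show ?thesis
        using w[of i j l] weight[OF e, of l] weight[OF e col[OF e]] l e ij by (simp add: m_def)
    qed
    show "keys (m e) \<inter> keys (m e') = {}"
      if "e \<in> E" "e' \<in> E" "e \<noteq> e'" for e e'
      using col_neq[OF that] by (auto simp: m_def keys_edge_monomial finE that)
    show "lookup (m e) x \<le> 1" if "e \<in> E" for e x
      by (simp add: m_def lookup_edge_monomial[OF finE[OF that]])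
  qed
  then show ?thesis by (rule that)
qed

lemma height_forest_ge:
  assumes E: "forest E" "\<And>e. e \<in> E \<Longrightarrow> e \<subseteq> {1..n}" "\<And>v. graph_degree E v \<le> d"
    and P: "primeideal P R" "edge_poly d ` E \<subseteq> P"
  shows "height_ge R (card E) P"
proof -
  obtain \<omega> m where "squarefree_initial_monomials X \<omega> E (edge_poly d :: nat set \<Rightarrow> _ \<Rightarrow>\<^sub>0 'k) m"
    using initial_monomials_forest[OF E] by blast
  then interpret init: squarefree_initial_monomials X \<omega> E "edge_poly d :: nat set \<Rightarrow> _ \<Rightarrow>\<^sub>0 'k" m .
  show ?thesis
    by (rule height_ge_regular[OF init.fin init.gen_sub[OF order_refl] _ P])
      (rule init.regular[unfolded init.gen_def])
qed

lemma forest_radical: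
  assumes E: "forest E" "\<And>e. e \<in> E \<Longrightarrow> e \<subseteq> {1..n}" "\<And>v. graph_degree E v \<le> d"
    and f: "f \<in> A" "f ^ k \<in> genideal R (edge_poly d ` E)"
  shows "f \<in> genideal R (edge_poly d ` E)"
proof -
  obtain \<omega> m where "squarefree_initial_monomials X \<omega> E (edge_poly d :: nat set \<Rightarrow> _ \<Rightarrow>\<^sub>0 'k) m"
    using initial_monomials_forest[OF E] by blast
  then interpret init: squarefree_initial_monomials X \<omega> E "edge_poly d :: nat set \<Rightarrow> _ \<Rightarrow>\<^sub>0 'k" m .
  show ?thesis by (rule init.radical[unfolded init.gen_def, OF f])
qed

section \<open>The minimal number of generators\<close>

text \<open>Summing over the fixed set \<open>X\<close> makes additivity evident; for monomials of \<open>A\<close> this is the degree.\<close>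

definition total_degree :: "(nat \<times> nat \<Rightarrow>\<^sub>0 nat) \<Rightarrow> nat" where
  "total_degree t = (\<Sum>x\<in>X. lookup t x)"

lemma total_degree_add: "total_degree (s + t) = total_degree s + total_degree t"
  by (simp add: total_degree_def lookup_add sum.distrib)

lemma total_degree_pos:
  assumes "t \<noteq> 0" "keys t \<subseteq> X"
  shows "1 \<le> total_degree t"
proof -
  obtain x where x: "x \<in> keys t" using assms(1) by (metis ex_in_conv keys_eq_empty)
  then have "lookup t x \<le> total_degree t"
    unfolding total_degree_def using assms(2) by (intro member_le_sum) auto
  then show ?thesis using x by (simp add: in_keys_iff)
qed

lemma total_degree_edge_monomial:
  assumes "i \<noteq> j" "{i, j} \<subseteq> {1..n}" "l \<in> {1..d}"
  shows "total_degree (edge_monomial {i, j} l) = 2"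
proof -
  have "total_degree (edge_monomial {i, j} l) = card ({i, j} \<times> {l})"
  proof -
    have "total_degree (edge_monomial {i, j} l) = (\<Sum>x\<in>X. if x \<in> {i, j} \<times> {l} then 1 else 0)"
      unfolding total_degree_def by (intro sum.cong) (simp_all add: lookup_edge_monomial)
    also have "\<dots> = card (X \<inter> {i, j} \<times> {l})"
      by (simp only: sum.If_cases finite_SigmaI finite_atLeastAtMost Collect_mem_eq) simp
    also have "X \<inter> {i, j} \<times> {l} = {i, j} \<times> {l}" using assms by auto
    finally show ?thesis .
  qed
  then show ?thesis using assms(1) by (simp add: card_cartesian_product)
qed

definition order_two :: "(nat \<times> nat, 'k) mpoly set" where
  "order_two = {p \<in> A. \<forall>t\<in>keys p. 2 \<le> total_degree t}"

lemma order_two_ideal: "ideal order_two R"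
  unfolding ideal_iff
proof (intro conjI ballI)
  show "p + q \<in> order_two" if "p \<in> order_two" "q \<in> order_two" for p q
    using that add_mem[of p q] Poly_Mapping.keys_add[of p q] unfolding order_two_def by blast
  show "a * p \<in> order_two" if ap: "a \<in> A" "p \<in> order_two" for a p
  proof -
    have "2 \<le> total_degree t" if t: "t \<in> keys (a * p)" for t
    proof -
      obtain r s where "t = r + s" "s \<in> keys p"
        using Poly_Mapping.keys_mult[of a p] t by blast
      then show ?thesis using ap(2) total_degree_add[of r s] by (auto simp: order_two_def)
    qed
    then show ?thesis using ap mult_mem[of a p] unfolding order_two_def by blast
  qed
  show "order_two \<subseteq> A" "0 \<in> order_two" unfolding order_two_def using zero_mem by auto
qed

lemma lookup_mult_order_two:
  assumes a: "a \<in> A" and p: "p \<in> order_two" and t: "total_degree t = 2"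
  shows "lookup (a * p) t = lookup a 0 * lookup p t"
proof (rule lookup_mult_const)
  fix r s assume rs: "r \<in> keys a" "r \<noteq> 0" "s \<in> keys p"
  have "1 \<le> total_degree r" using rs a by (intro total_degree_pos) (auto simp: polynomials_def)
  moreover have "2 \<le> total_degree s" using p rs(3) by (simp add: order_two_def)
  ultimately show "t \<noteq> r + s" using t total_degree_add[of r s] by auto
qed

text \<open>For \<open>p\<close> in the ideal, the quadratic part of \<open>a * p\<close> is that of \<open>p\<close> times the constant term of \<open>a\<close>. So
the vectors \<open>\<pi> p\<close> of the coefficients of \<open>x\<^sub>i\<^sub>1 x\<^sub>j\<^sub>1\<close> for \<open>{i, j} \<in> E\<close> are all contained in the span of those of
any set of generators. The edge polynomials yield the unit vectors \<open>\<delta> e\<close>, so this span has dimension at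
least \<open>card E\<close>.\<close>

lemma card_generators_ge:
  assumes d: "d \<ge> 1" and E: "forest E" "\<And>e. e \<in> E \<Longrightarrow> e \<subseteq> {1..n}"
    and F: "finite F" "F \<subseteq> A" "genideal R F = genideal R (edge_poly d ` E)"
  shows "card E \<le> card F"
proof -
  let ?scale = "\<lambda>(c::'k) (p :: (nat \<times> nat \<Rightarrow>\<^sub>0 nat) \<Rightarrow>\<^sub>0 'k). single 0 c * p"
  interpret V: vector_space ?scale
    by unfold_locales (simp_all add: algebra_simps single_add mult_single flip: mult.assoc)
  define \<mu> where "\<mu> e = edge_monomial e 1" for e
  define \<pi> where "\<pi> p = (\<Sum>e\<in>E. single (\<mu> e) (lookup p (\<mu> e)))"
    for p :: "(nat \<times> nat \<Rightarrow>\<^sub>0 nat) \<Rightarrow>\<^sub>0 'k"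
  define \<delta> where "\<delta> e = single (\<mu> e) (1 :: 'k)" for e
  have fE: "finite E" using E(1) by (rule forest_finite)
  have finE: "finite e" if "e \<in> E" for e using E(2)[OF that] finite_subset by blast
  have deg: "total_degree (edge_monomial e l) = 2" if e: "e \<in> E" and l: "l \<in> {1..d}" for e l
  proof -
    obtain i j where "i \<noteq> j" "e = {i, j}" using forest_edgeE[OF E(1) e] .
    then show ?thesis using total_degree_edge_monomial[of i j l] E(2)[OF e] l by simp
  qed
  have \<mu>_deg: "total_degree (\<mu> e) = 2" if "e \<in> E" for e
    unfolding \<mu>_def using d by (intro deg that) simp
  have \<mu>_eq: "edge_monomial e' l = \<mu> e \<longleftrightarrow> e' = e \<and> l = 1" if "e \<in> E" "e' \<in> E" for e e' l
  proof
    assume "edge_monomial e' l = \<mu> e"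
    then have "e' \<times> {l} = e \<times> {1}" using keys_edge_monomial finE that unfolding \<mu>_def by metis
    moreover have "e \<noteq> {}" using forest_edgeE[OF E(1) that(1)] by blast
    ultimately show "e' = e \<and> l = 1" by auto
  qed (simp add: \<mu>_def)
  have edge_poly: "edge_poly d e \<in> order_two" if "e \<in> E" for e
    unfolding order_two_def using edge_poly_mem[OF E(2)[OF that]] keys_edge_poly deg[OF that] by fastforce
  have order_two: "F \<subseteq> order_two"
  proof -
    have "genideal R (edge_poly d ` E) \<subseteq> order_two"
      using edge_poly by (intro genideal_minimal order_two_ideal) auto
    then show ?thesis using genideal_self[of F] F by auto
  qed
  define S where "S = {p \<in> order_two. \<pi> p \<in> V.span (\<pi> ` F)}"
  have "ideal S R"
    unfolding ideal_iff
  proof (intro conjI ballI)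
    show "S \<subseteq> A" by (auto simp: S_def order_two_def)
    have "\<pi> 0 = 0" by (simp add: \<pi>_def)
    then show "0 \<in> S" using V.span_zero ideal_zero[OF order_two_ideal] by (simp add: S_def)
    fix p q assume pq: "p \<in> S" "q \<in> S"
    have "\<pi> (p + q) = \<pi> p + \<pi> q" by (simp add: \<pi>_def lookup_add single_add sum.distrib)
    then show "p + q \<in> S"
      using pq V.span_add ideal_add[OF order_two_ideal] by (auto simp: S_def)
  next
    fix a p assume ap: "a \<in> A" "p \<in> S"
    have "\<pi> (a * p) = ?scale (lookup a 0) (\<pi> p)"
      unfolding \<pi>_def sum_distrib_left
      using ap lookup_mult_order_two[OF ap(1) _ \<mu>_deg, of p] by (intro sum.cong) (auto simp: mult_single S_def)
    then show "a * p \<in> S"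
      using ap V.span_scale[of "\<pi> p" "\<pi> ` F"] ideal_mult[OF order_two_ideal] by (auto simp: S_def)
  qed
  then have "genideal R F \<subseteq> S"
    by (rule genideal_minimal) (use order_two V.span_base in \<open>auto simp: S_def\<close>)
  moreover have "edge_poly d ` E \<subseteq> genideal R F"
    unfolding F(3) using genideal_self[of "edge_poly d ` E"] edge_poly_mem E(2) by (auto simp: image_subset_iff)
  ultimately have "edge_poly d e \<in> S" if "e \<in> E" for e
    using that by blast
  moreover have "\<pi> (edge_poly d e) = \<delta> e" if e: "e \<in> E" for e
  proof -
    have "lookup (edge_poly d e) (\<mu> e') = (if e' = e then 1 else 0 :: 'k)" if "e' \<in> E" for e'
    proof -
      have "lookup (edge_poly d e) (\<mu> e') = (\<Sum>l = 1..d. if e' = e \<and> l = 1 then 1 else 0 :: 'k)"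
        unfolding edge_poly_def lookup_sum lookup_single
        using \<mu>_eq[OF that e] by (intro sum.cong) (auto simp: when_def)
      then show ?thesis using d by simp
    qed
    then have "\<pi> (edge_poly d e) = (\<Sum>e'\<in>E. if e' = e then \<delta> e else 0)"
      unfolding \<pi>_def \<delta>_def by (intro sum.cong) auto
    then show ?thesis using e fE by simp
  qed
  ultimately have span: "\<delta> ` E \<subseteq> V.span (\<pi> ` F)" by (force simp: S_def)
  have \<mu>_inj: "\<mu> e = \<mu> e' \<longleftrightarrow> e = e'" if "e \<in> E" "e' \<in> E" for e e'
    using \<mu>_eq[OF that(2,1), of 1] by (simp add: \<mu>_def)
  have inj: "inj_on \<delta> E"
  proof (rule inj_onI)
    fix e e' assume ee: "e \<in> E" "e' \<in> E" "\<delta> e = \<delta> e'"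
    then have "keys (\<delta> e) = keys (\<delta> e')" by simp
    then have "\<mu> e = \<mu> e'" by (simp add: \<delta>_def)
    then show "e = e'" using \<mu>_inj[OF ee(1,2)] by simp
  qed
  have "V.independent (\<delta> ` E)"
  proof
    assume "V.dependent (\<delta> ` E)"
    then obtain u v where uv: "v \<in> \<delta> ` E" "u v \<noteq> 0" "(\<Sum>v\<in>\<delta> ` E. ?scale (u v) v) = 0"
      using V.dependent_finite[of "\<delta> ` E"] fE by auto
    from uv(1) obtain e where e: "e \<in> E" "v = \<delta> e" by blast
    have "0 = lookup (\<Sum>e'\<in>E. ?scale (u (\<delta> e')) (\<delta> e')) (\<mu> e)"
      using uv(3) inj by (simp add: sum.reindex)
    also have "\<dots> = (\<Sum>e'\<in>E. if e' = e then u (\<delta> e') else 0)"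
      unfolding lookup_sum
      using \<mu>_inj e by (intro sum.cong) (auto simp: \<delta>_def mult_single lookup_single when_def)
    also have "\<dots> = u v" using e fE by simp
    finally show False using uv(2) by simp
  qed
  then have "card (\<delta> ` E) \<le> card (\<pi> ` F)"
    using V.independent_span_bound[of "\<pi> ` F"] F(1) span by auto
  also have "\<dots> \<le> card F" by (rule card_image_le[OF F(1)])
  finally show ?thesis using card_image[OF inj] by simp
qed

lemma min_generators_lss:
  assumes d: "d \<ge> 1" and E: "forest E" "\<And>e. e \<in> E \<Longrightarrow> e \<subseteq> {1..n}"
  shows "min_generators R (genideal R (edge_poly d ` E)) = enat (card E)"
proof (rule antisym)
  have "min_generators R (genideal R (edge_poly d ` E)) \<le> enat (card (edge_poly d ` E :: (_ \<Rightarrow>\<^sub>0 'k) set))"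
    unfolding min_generators_def
    by (rule INF_lower) (use forest_finite[OF E(1)] edge_poly_mem E(2) in auto)
  also have "\<dots> \<le> enat (card E)" using card_image_le[OF forest_finite[OF E(1)]] by simp
  finally show "min_generators R (genideal R (edge_poly d ` E)) \<le> enat (card E)" .
  show "enat (card E) \<le> min_generators R (genideal R (edge_poly d ` E))"
    unfolding min_generators_def
    by (rule INF_greatest) (use card_generators_ge[OF d E] in auto)
qed

section \<open>The height\<close>

lemma origin_prime: "primeideal {p \<in> A. lookup p 0 = 0} R"
  unfolding primeideal_iff ideal_iff
  using zero_mem add_mem mult_mem
  by (auto simp: lookup_add lookup_mult_zero lookup_one simp del: One_nat_def)

text \<open>When the variables at the vertices in \<open>C\<close> are set to zero, the polynomials of the edges that meet \<open>C\<close>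
vanish. Hence the variables at \<open>C\<close> and the polynomials of the other edges generate an ideal over the given
one. It is proper, as its generators vanish at the origin, and Krull's height theorem bounds its
height.\<close>

lemma height_lss_le:
  assumes E: "forest E" "\<And>e. e \<in> E \<Longrightarrow> e \<subseteq> {1..n}" and C: "finite C" "C \<subseteq> {1..n}"
  shows "ideal_height R (genideal R (edge_poly d ` E)) \<le> enat (d * card C + card {e \<in> E. e \<inter> C = {}})"
proof -
  define F :: "(nat \<times> nat, 'k) mpoly set"
    where "F = poly_var ` (C \<times> {1..d}) \<union> edge_poly d ` {e \<in> E. e \<inter> C = {}}"
  have fF: "finite F" using C(1) forest_finite[OF E(1)] by (simp add: F_def)
  have var: "poly_var x \<in> A" if "x \<in> X" for x
    using that by (auto simp: poly_var_def intro!: single_in_polynomials)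
  have FA: "F \<subseteq> A" using var edge_poly_mem E(2) C(2) by (auto simp: F_def)
  have gF: "ideal (genideal R F) R" using genideal_ideal FA by simp
  have Fg: "F \<subseteq> genideal R F" using genideal_self FA by simp
  have "edge_poly d e \<in> genideal R F" if e: "e \<in> E" for e
  proof (cases "e \<inter> C = {}")
    case True
    then show ?thesis using e Fg by (auto simp: F_def)
  next
    case False
    obtain a b where "a \<noteq> b" "e = {a, b}" using forest_edgeE[OF E(1) e] .
    then obtain i j where ij: "i \<noteq> j" "e = {i, j}" "i \<in> C"
      using False by (metis disjoint_insert(2) inf_bot_left insert_commute inf_commute)
    have "poly_var (i, l) * poly_var (j, l) \<in> genideal R F" if "l \<in> {1..d}" for l
    proof -
      have "poly_var (i, l) \<in> genideal R F" using Fg ij(3) that by (auto simp: F_def)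
      moreover have "poly_var (j, l) \<in> A" using var E(2)[OF e] ij(2) that by auto
      ultimately show ?thesis by (rule ideal_mult'[OF gF, rotated])
    qed
    then show ?thesis
      unfolding ij(2) edge_poly_pair[OF ij(1)] by (intro ideal_sum[OF gF])
  qed
  then have sub: "genideal R (edge_poly d ` E) \<subseteq> genideal R F"
    by (intro genideal_minimal[OF gF]) auto
  have "F \<subseteq> {p \<in> A. lookup p 0 = 0}"
  proof -
    have "lookup (poly_var x) 0 = (0 :: 'k)" for x :: "nat \<times> nat"
    proof -
      have "single x (1 :: nat) \<noteq> 0" by (metis lookup_single_eq lookup_zero zero_neq_one)
      then show ?thesis by (simp add: poly_var_def lookup_single when_def)
    qed
    moreover have "lookup (edge_poly d e) 0 = (0 :: 'k)" if e: "e \<in> E" for e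
    proof -
      obtain i j where ij: "i \<noteq> j" "e = {i, j}" using forest_edgeE[OF E(1) e] .
      show ?thesis
        unfolding ij(2) edge_poly_pair[OF ij(1)]
        by (simp add: lookup_sum lookup_mult_zero calculation)
    qed
    ultimately show ?thesis using FA by (auto simp: F_def)
  qed
  then have "ideal_height R (genideal R (edge_poly d ` E)) \<le> enat (card F)"
    by (rule ideal_height_le_card[OF fF FA origin_prime _ sub])
  also have "card F \<le> card (C \<times> {1..d}) + card {e \<in> E. e \<inter> C = {}}"
    unfolding F_def using C(1) forest_finite[OF E(1)]
    by (intro order_trans[OF card_Un_le] add_mono card_image_le) auto
  then have "enat (card F) \<le> enat (d * card C + card {e \<in> E. e \<inter> C = {}})"
    by (simp add: card_cartesian_product mult.commute)
  finally show ?thesis .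
qed

section \<open>Almost complete intersections\<close>

text \<open>Otherwise the variables at one or two suitable vertices show that the height is at most
\<open>card E - 2\<close>.\<close>

lemma almost_complete_intersection_necessary:
  assumes d: "d \<ge> 1" and E: "forest E" "\<And>e. e \<in> E \<Longrightarrow> e \<subseteq> {1..n}" and big: "graph_degree E v > d"
    and aci: "almost_complete_intersection R (genideal R (edge_poly d ` E))"
  shows "\<exists>e\<in>E. \<forall>x. graph_degree (E - {e}) x \<le> d"
proof (rule ccontr)
  assume "\<not> ?thesis"
  then have bad: "\<exists>x. graph_degree (E - {e}) x > d" if "e \<in> E" for e using that by (auto simp: not_le)
  obtain C where C: "finite C" "C \<subseteq> \<Union>E" "d * card C + card {e \<in> E. e \<inter> C = {}} + 2 \<le> card E"
    by (rule forest_obstruction[OF E(1) big bad])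
  then have "C \<subseteq> {1..n}" using E(2) by blast
  from height_lss_le[OF E C(1) this]
  have "ideal_height R (genideal R (edge_poly d ` E)) + 1 \<le> enat (d * card C + card {e \<in> E. e \<inter> C = {}}) + 1"
    by (rule add_right_mono)
  also have "\<dots> < enat (card E)" using C(3) by (simp add: one_enat_def)
  also have "\<dots> = ideal_height R (genideal R (edge_poly d ` E)) + 1"
    using aci min_generators_lss[OF d E] by (simp add: almost_complete_intersection_def)
  finally show False by simp
qed

text \<open>A minimal prime \<open>P\<close> has height \<open>card E\<close> or \<open>card E - 1\<close>. In the latter case it is minimal over the radical
ideal of the other edges, whence the polynomial of \<open>e0\<close> is a redundant generator at \<open>P\<close>.\<close>

lemma almost_complete_intersection_sufficient:
  assumes d: "d \<ge> 1" and E: "forest E" "\<And>e. e \<in> E \<Longrightarrow> e \<subseteq> {1..n}" and big: "graph_degree E v > d"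
    and e0: "e0 \<in> E" "\<And>x. graph_degree (E - {e0}) x \<le> d"
  shows "almost_complete_intersection R (genideal R (edge_poly d ` E))"
proof -
  let ?I = "genideal R (edge_poly d ` E)" and ?E' = "E - {e0}"
  let ?J = "genideal R (edge_poly d ` ?E')"
  have fE: "finite E" using E(1) by (rule forest_finite)
  have E': "forest ?E'" "\<And>e. e \<in> ?E' \<Longrightarrow> e \<subseteq> {1..n}"
    using forest_subset[OF E(1)] E(2) by auto
  have card: "card E = Suc (card ?E')" using e0(1) fE by (metis card_Suc_Diff1)
  have sub: "edge_poly d ` E \<subseteq> A" "edge_poly d ` ?E' \<subseteq> A"
    using edge_poly_mem E(2) by auto
  have I: "ideal ?I R" and J: "ideal ?J R" using genideal_ideal sub by simp_all
  have gens_I: "edge_poly d ` E \<subseteq> ?I" and gens_J: "edge_poly d ` ?E' \<subseteq> ?J"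
    using genideal_self sub by simp_all
  have gens_I': "edge_poly d ` ?E' \<subseteq> ?I"
    by (rule order_trans[OF image_mono[OF Diff_subset] gens_I])
  have height: "ideal_height R ?I = enat (card ?E')"
  proof (rule antisym)
    have "v \<in> {1..n}"
    proof (rule ccontr)
      assume "v \<notin> {1..n}"
      then have none: "{e \<in> E. v \<in> e} = {}" using E(2) by blast
      show False using big unfolding graph_degree_def none by simp
    qed
    then have "ideal_height R ?I \<le> enat (d * card {v} + card {e \<in> E. e \<inter> {v} = {}})"
      by (intro height_lss_le[OF E]) auto
    also have "\<dots> \<le> enat (card ?E')"
      using card_edges_avoiding[OF fE, of v] big card by simp
    finally show "ideal_height R ?I \<le> enat (card ?E')" .
    show "enat (card ?E') \<le> ideal_height R ?I"
    proof (rule ideal_height_geI)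
      fix P assume P: "primeideal P R" "?I \<subseteq> P"
      show "height_ge R (card ?E') P"
        by (rule height_forest_ge[OF E' e0(2) P(1) order_trans[OF gens_I' P(2)]])
    qed
  qed
  have "complete_intersection (localization_at R P) (ideal_localization_at R P ?I)"
    if min: "minimal_prime R ?I P" for P
  proof -
    have P: "primeideal P R" "?I \<subseteq> P" using min by (auto simp: minimal_prime_def)
    note iP = prime_ideal[OF P(1)]
    interpret loc: localized_subring A P
      by (intro localized_subring.intro noetherian_subring_axioms localized_subring_axioms.intro P)
    have ge: "height_ge R (card ?E') Q" if "primeideal Q R" "edge_poly d ` ?E' \<subseteq> Q" for Q
      by (rule height_forest_ge[OF E' e0(2) that])
    \<comment> \<open>The height of \<open>P\<close> is \<open>card E\<close> in the first case and \<open>card E - 1\<close> in the second.\<close>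
    show ?thesis
    proof (cases "height_ge R (card E) P")
      case True
      have "minimal_over P (edge_poly d ` E)"
        unfolding minimal_prime_def
      proof (intro conjI allI impI)
        show "edge_poly d ` E \<subseteq> P" using P(2) gens_I by blast
        fix Q assume Q: "primeideal Q R \<and> edge_poly d ` E \<subseteq> Q \<and> Q \<subseteq> P"
        then have "?I \<subseteq> Q" using genideal_minimal prime_ideal by blast
        then show "Q = P" using min Q by (auto simp: minimal_prime_def)
      qed (rule P)
      then have "h \<le> card (edge_poly d ` E :: (_ \<Rightarrow>\<^sub>0 'k) set)" if "height_ge R h P" for h
        using krull_height[OF _ sub(1) _ that] fE by blast
      moreover have "card (edge_poly d ` E :: (_ \<Rightarrow>\<^sub>0 'k) set) \<le> card E" by (rule card_image_le[OF fE])
      ultimately have "\<not> height_ge R (Suc (card E)) P" by (meson Suc_n_not_le_n order_trans)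
      then show ?thesis
      proof (rule loc.complete_intersection_localization[OF I min True])
        show "\<exists>s\<in>A - P. s * a \<in> genideal R (edge_poly d ` E)" if "a \<in> ?I" for a
          using that one_compl_prime[OF P(1)] by (intro bexI[of _ 1]) simp_all
      qed (use fE gens_I card_image_le[OF fE] in auto)
    next
      case False
      have JP: "?J \<subseteq> P"
        by (rule genideal_minimal[OF iP order_trans[OF gens_I' P(2)]])
      have "minimal_over P ?J"
        unfolding minimal_prime_def
      proof (intro conjI allI impI)
        fix Q assume Q: "primeideal Q R \<and> ?J \<subseteq> Q \<and> Q \<subseteq> P"
        show "Q = P"
        proof (rule ccontr)
          assume "Q \<noteq> P"
          then have "Q \<subset> P" using Q by blast
          moreover have "height_ge R (card ?E') Q" using ge[of Q] Q gens_J by blast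
          ultimately have "height_ge R (card E) P"
            unfolding card height_ge.simps using P(1) by blast
          with False show False by blast
        qed
      qed (use P JP in auto)
      moreover have f0: "edge_poly d e0 \<in> P" "edge_poly d e0 \<in> A"
        using P(2) gens_I sub(1) e0(1) by blast+
      ultimately obtain s k where s: "s \<in> A - P" "s * edge_poly d e0 ^ k \<in> ?J"
        using minimal_over_power[OF _ J] by blast
      have sA: "s \<in> A" using s(1) by blast
      \<comment> \<open>The factor \<open>s\<close> is taken into the base of the power, since radicality concerns powers only.\<close>
      have "(s * edge_poly d e0) ^ Suc k = (s ^ k * edge_poly d e0) * (s * edge_poly d e0 ^ k)"
        by (simp add: power_mult_distrib algebra_simps)
      also have "\<dots> \<in> ?J"
        by (intro ideal_mult[OF J _ s(2)] mult_mem power_mem sA f0(2))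
      finally have sf: "s * edge_poly d e0 \<in> ?J"
        using forest_radical[OF E' e0(2) mult_mem[OF sA f0(2)], of "Suc k"] by blast
      show ?thesis
      proof (rule loc.complete_intersection_localization[OF I min])
        show "height_ge R (card ?E') P" using ge[OF P(1)] JP gens_J by blast
        show "\<not> height_ge R (Suc (card ?E')) P" using False card by simp
        show "finite (edge_poly d ` ?E' :: (_ \<Rightarrow>\<^sub>0 'k) set)" using fE by simp
        show "edge_poly d ` ?E' \<subseteq> ?I" by (rule gens_I')
        show "card (edge_poly d ` ?E' :: (_ \<Rightarrow>\<^sub>0 'k) set) \<le> card ?E'" by (rule card_image_le) (use fE in simp)
        fix a assume a: "a \<in> ?I"
        have "(edge_poly d ` E :: (_ \<Rightarrow>\<^sub>0 'k) set) = insert (edge_poly d e0) (edge_poly d ` ?E')"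
          using e0(1) by blast
        then have "a \<in> genideal R (insert (edge_poly d e0) (edge_poly d ` ?E'))" using a by simp
        then obtain r y where ry: "r \<in> A" "y \<in> ?J" "a = r * edge_poly d e0 + y"
          unfolding genideal_insert[OF sub(2) f0(2)] by blast
        have "s * a = r * (s * edge_poly d e0) + s * y" using ry(3) by (simp add: algebra_simps)
        also have "\<dots> \<in> ?J"
          by (rule ideal_add[OF J ideal_mult[OF J ry(1) sf] ideal_mult[OF J sA ry(2)]])
        finally show "\<exists>s\<in>A - P. s * a \<in> ?J" using s(1) by blast
      qed
    qed
  qed
  then show ?thesis
    unfolding almost_complete_intersection_def
    using I min_generators_lss[OF d E] height card by (simp add: one_enat_def)
qed

end

theorem theorem3p2:
  fixes n d :: nat and E :: "nat set set"
  assumes "d \<ge> 1"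
    and "graph_tree {1..n} E"
    and "max_degree {1..n} E > d"
  shows "almost_complete_intersection
      (lss_ring n d :: ((nat \<times> nat \<Rightarrow>\<^sub>0 nat) \<Rightarrow>\<^sub>0 'k::field) ring) (lss_ideal n E d) \<longleftrightarrow>
    (\<exists>V\<^sub>1 E\<^sub>1 V\<^sub>2 E\<^sub>2 u v.
       graph_tree V\<^sub>1 E\<^sub>1 \<and> graph_tree V\<^sub>2 E\<^sub>2 \<and>
       V\<^sub>1 \<inter> V\<^sub>2 = {} \<and> V\<^sub>1 \<union> V\<^sub>2 = {1..n} \<and>
       max_degree V\<^sub>1 E\<^sub>1 \<le> d \<and> max_degree V\<^sub>2 E\<^sub>2 \<le> d \<and>
       u \<in> V\<^sub>1 \<and> v \<in> V\<^sub>2 \<and> E = E\<^sub>1 \<union> E\<^sub>2 \<union> {{u, v}})"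
proof -
  interpret noetherian_subring "polynomials ({1..n} \<times> {1..d}) :: (nat \<times> nat, 'k) mpoly set"
    by (rule noetherian_polynomials) simp
  interpret lss n d "TYPE('k)" by unfold_locales
  have forest: "forest E" by (rule tree_forest[OF assms(2)])
  have E: "e \<subseteq> {1..n}" if "e \<in> E" for e
    using assms(2) that by (auto simp: graph_tree_def simple_graph_def)
  have "{1..n} \<noteq> {}" using assms(2) by (auto simp: graph_tree_def graph_connected_def)
  then obtain v where v: "graph_degree E v > d"
    using assms(3) max_degree_le_iff[of "{1..n}" E d] by (auto simp: not_le)
  have "almost_complete_intersection R (genideal R (edge_poly d ` E)) \<longleftrightarrow>
      (\<exists>e\<in>E. \<forall>x. graph_degree (E - {e}) x \<le> d)"
    using almost_complete_intersection_necessary[OF assms(1) forest E v]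
      almost_complete_intersection_sufficient[OF assms(1) forest E v] by blast
  then show ?thesis
    unfolding tree_split_iff[OF assms(2)] lss_ideal_eq[OF forest] lss_ring_eq .
qed

end
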